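(* Let $K$ be a field. For each integer $n>2$, with $R_{n-1}$, $R_n$, the idempotent ${\bf e}\in R_n$, the set $I_{n-1}^{e}$ and the map $\hat{\ }$ as defined in the context, there is an isomorphism of $K$-algebras $$R_{n-1}\longrightarrow {\bf e}R_n{\bf e}$$ given by $${\bf e}({\bf i})\mapsto {\bf e}(\hat{{\bf i}})\ ({\bf i}\in I_{n-1}^{e}),\qquad y_{n-1}\mapsto {\bf e}\,y_n\,{\bf e},\qquad \psi_k\mapsto {\bf e}\,\psi_{k+1}\,{\bf e}\ (1\le k\le n-2).$$
   Context: Let $K$ be a field and $n>1$ an integer. The quiver $A_n^{(1)}$ (in this paper's indexing) has vertices $\{0,1,\dots,n-1\}$ and arrows $i\to i+1$ for $0\le i\le n-2$ together with $n-1\to 0$. (For $n=2$ there is an arrow in each direction between $0$ and $1$.) Let $I_n$ be the set of all permutations ${\bf i}=(i_1,\dots,i_n)$ of $(0,1,\dots,n-1)$. For $1\le k\le n-1$, $s_k\cdot{\bf i}$ is ${\bf i}$ with the entries $i_k,i_{k+1}$ interchanged. For vertices $i\ne j$: $i\not\leftrightarrow j$ means there is no arrow between them; $i\to j$ means there is an arrow from $i$ to $j$ only; $i\leftarrow j$ means there is an arrow from $j$ to $i$ only; $i\leftrightarrow j$ means there are arrows both ways. The KLR algebra $R_n(\alpha)$ (for $\alpha=\sum_{i}\alpha_i$, the sum over all vertices) is the unital associative $K$-algebra with generators ${\bf e}({\bf i})$ (${\bf i}\in I_n$), $y_1,\dots,y_n$, $\psi_1,\dots,\psi_{n-1}$ and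 relations, for all indices and ${\bf i},{\bf j}\in I_n$ for which they make sense: ${\bf e}({\bf i}){\bf e}({\bf j})=\delta_{{\bf i},{\bf j}}{\bf e}({\bf i})$; $\sum_{{\bf i}\in I_n}{\bf e}({\bf i})=1$; $y_k{\bf e}({\bf i})={\bf e}({\bf i})y_k$; $\psi_k{\bf e}({\bf i})={\bf e}(s_k\cdot{\bf i})\psi_k$; $y_ky_l=y_ly_k$; $\psi_ky_l=y_l\psi_k$ for $l\ne k,k+1$; $\psi_k\psi_l=\psi_l\psi_k$ for $|k-l|>1$; $\psi_ky_{k+1}{\bf e}({\bf i})=y_k\psi_k{\bf e}({\bf i})$; $y_{k+1}\psi_k{\bf e}({\bf i})=\psi_ky_k{\bf e}({\bf i})$; $\psi_k\psi_{k+1}\psi_k{\bf e}({\bf i})=\psi_{k+1}\psi_k\psi_{k+1}{\bf e}({\bf i})$; and $\psi_k^2{\bf e}({\bf i})$ equals ${\bf e}({\bf i})$ if $i_k\not\leftrightarrow i_{k+1}$; $(y_{k+1}-y_k){\bf e}({\bf i})$ if $i_k\to i_{k+1}$; $(y_k-y_{k+1}){\bf e}({\bf i})$ if $i_k\leftarrow i_{k+1}$; $(y_{k+1}-y_k)(y_k-y_{k+1}){\bf e}({\bf i})$ if $i_k\leftrightarrow i_{k+1}$. The cyclotomic ideal $I^{\Lambda}$ (for $\Lambda=\Lambda_0$) is the two-sided ideal of $R_n(\alpha)$ generated by $\{y_1{\bf e}({\bf i}) : {\bf i}\in I_n,\ i_1=0\}\cup\{{\bf e}({\bf i}) : {\bf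 i}\in I_n,\ i_1\ne 0\}$, and $R_n=R_n(\alpha)/I^{\Lambda}$. The images of the generators in $R_n$ are denoted by the same symbols. Further notation: $I_n^{e}=\{{\bf i}\in I_n : {\bf e}({\bf i})\ne 0 \text{ in } R_n\}$, $I_n^{1}=\{{\bf i}\in I_n^{e} : i_2=1\}$, and ${\bf e}=\sum_{{\bf i}\in I_n^{1}}{\bf e}({\bf i})\in R_n$, so that ${\bf e}R_n{\bf e}$ is an algebra with unit ${\bf e}$. For $n>2$ the map $\hat{\ }:I_{n-1}^{e}\to I_n^{1}$ is defined by $\hat{{\bf i}}=(0,1,i_2+1,\dots,i_{n-1}+1)$ for ${\bf i}=(0,i_2,\dots,i_{n-1})$; it is a bijection, with inverse $(0,1,i_3,\dots,i_n)\mapsto(0,i_3-1,\dots,i_n-1)$. *)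

theory Defs
  imports
    "HOL-Library.Poly_Mapping"
    "HOL-Combinatorics.Multiset_Permutations"
    "HOL-Algebra.QuotRing"
    "HOL-Algebra.Module"
begin

section \<open>Free associative algebras\<close>

text \<open>
  Words are wrapped in a type of their own, so that lists do not get a global
  instance of \<^class>\<open>monoid_add\<close>. The product of \<open>'a fword \<Rightarrow>\<^sub>0 'k\<close> provided by
  \<^theory>\<open>HOL-Library.Poly_Mapping\<close> is then the product of noncommutative polynomials.
\<close>

datatype 'a fword = FWord (letters: "'a list")

instantiation fword :: (type) monoid_add
begin

definition zero_fword :: "'a fword" where
  "0 = FWord []"

definition plus_fword :: "'a fword \<Rightarrow> 'a fword \<Rightarrow> 'a fword" where
  "u + v = FWord (letters u @ letters v)"

instance
  by standard (simp_all add: zero_fword_def plus_fword_def)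

end

type_synonym ('k, 'a) fpoly = "'a fword \<Rightarrow>\<^sub>0 'k"

definition fgen :: "'a \<Rightarrow> ('k::field, 'a) fpoly" where
  "fgen g = Poly_Mapping.single (FWord [g]) 1"

definition free_algebra :: "'a set \<Rightarrow> ('k::field, ('k, 'a) fpoly) module" where
  "free_algebra X =
     \<lparr>carrier = {p. \<forall>w \<in> Poly_Mapping.keys p. set (letters w) \<subseteq> X},
      mult = (*), one = 1, zero = 0, add = (+),
      smult = (\<lambda>c p. Poly_Mapping.map ((*) c) p)\<rparr>"

lemma ring_free_algebra: "ring (free_algebra X :: ('k::field, ('k, 'a) fpoly) module)"
proof -
  let ?F = "free_algebra X :: ('k, ('k, 'a) fpoly) module"
  have add: "p + q \<in> carrier ?F" if "p \<in> carrier ?F" "q \<in> carrier ?F" for p q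
    using that Poly_Mapping.keys_add[of p q] unfolding free_algebra_def by auto
  have mult: "p * q \<in> carrier ?F" if "p \<in> carrier ?F" "q \<in> carrier ?F" for p q
  proof -
    have "set (letters w) \<subseteq> X" if "w \<in> Poly_Mapping.keys (p * q)" for w
    proof -
      obtain u v where "w = u + v" "u \<in> Poly_Mapping.keys p" "v \<in> Poly_Mapping.keys q"
        using \<open>w \<in> _\<close> Poly_Mapping.keys_mult[of p q] by blast
      then show ?thesis
        using \<open>p \<in> _\<close> \<open>q \<in> _\<close> by (simp add: free_algebra_def plus_fword_def)
    qed
    then show ?thesis
      by (simp add: free_algebra_def)
  qed
  have neg: "- p \<in> carrier ?F" if "p \<in> carrier ?F" for p
    using that by (simp add: free_algebra_def)
  show ?thesis
  proof (rule ringI)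
    show "abelian_group ?F"
    proof (rule abelian_groupI)
      show "\<exists>y\<in>carrier ?F. y \<oplus>\<^bsub>?F\<^esub> x = \<zero>\<^bsub>?F\<^esub>" if "x \<in> carrier ?F" for x
        using neg[OF that] by (intro bexI[of _ "- x"]) (simp_all add: free_algebra_def)
      show "x \<oplus>\<^bsub>?F\<^esub> y \<in> carrier ?F" if "x \<in> carrier ?F" "y \<in> carrier ?F" for x y
        using add[OF that] by (simp add: free_algebra_def)
    qed (simp_all add: free_algebra_def add.assoc add.commute)
    show "monoid ?F"
    proof (rule monoidI)
      show "x \<otimes>\<^bsub>?F\<^esub> y \<in> carrier ?F" if "x \<in> carrier ?F" "y \<in> carrier ?F" for x y
        using mult[OF that] by (simp add: free_algebra_def)
    qed (simp_all add: free_algebra_def mult.assoc zero_fword_def)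
  qed (simp_all add: free_algebra_def distrib_left distrib_right)
qed


section \<open>Quotients, corners and isomorphisms of algebras\<close>

text \<open>
  \<open>A Quot I\<close> is only a ring. The scalar multiplication on cosets is added in the
  style of \<^const>\<open>rcoset_mult\<close>, so that \<open>c (I + a) = I + c a\<close>.
\<close>

definition quot_algebra ::
  "('k, 'b) module \<Rightarrow> 'b set \<Rightarrow> ('k, 'b set) module" where
  "quot_algebra A I =
     \<lparr>carrier = carrier (A Quot I), mult = mult (A Quot I), one = one (A Quot I),
      zero = zero (A Quot I), add = add (A Quot I),
      smult = (\<lambda>c S. \<Union>a\<in>S. I +>\<^bsub>A\<^esub> (c \<odot>\<^bsub>A\<^esub> a))\<rparr>"

definition corner_algebra :: "('k, 'b) module \<Rightarrow> 'b \<Rightarrow> ('k, 'b) module" where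
  "corner_algebra A e =
     A\<lparr>carrier := {e \<otimes>\<^bsub>A\<^esub> x \<otimes>\<^bsub>A\<^esub> e | x. x \<in> carrier A}, one := e\<rparr>"

definition algebra_iso :: "('k, 'b) module \<Rightarrow> ('k, 'c) module \<Rightarrow> ('b \<Rightarrow> 'c) set" where
  "algebra_iso A B =
     {f \<in> ring_iso A B. \<forall>c. \<forall>x \<in> carrier A. f (c \<odot>\<^bsub>A\<^esub> x) = c \<odot>\<^bsub>B\<^esub> f x}"


section \<open>The KLR algebra of the cyclic quiver\<close>

definition arrow :: "nat \<Rightarrow> nat \<Rightarrow> nat \<Rightarrow> bool" where
  "arrow n i j \<longleftrightarrow> (Suc i < n \<and> j = Suc i) \<or> (Suc i = n \<and> j = 0)"

text \<open>
  Sequences \<open>(i\<^sub>1, \<dots>, i\<^sub>n)\<close> are lists; positions are counted from 1 as in the relations.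
\<close>

abbreviation entry :: "nat list \<Rightarrow> nat \<Rightarrow> nat" where
  "entry i k \<equiv> i ! (k - 1)"

definition klr_seqs :: "nat \<Rightarrow> nat list set" where
  "klr_seqs n = permutations_of_set {0..<n}"

definition swap_at :: "nat \<Rightarrow> nat list \<Rightarrow> nat list" where
  "swap_at k i = i[k - 1 := entry i (k + 1), k := entry i k]"

datatype klr_gen = GE "nat list" | GY nat | GPsi nat

definition klr_gens :: "nat \<Rightarrow> klr_gen set" where
  "klr_gens n = GE ` klr_seqs n \<union> GY ` {1..n} \<union> GPsi ` {1..n-1}"

type_synonym 'k klr_free = "('k, klr_gen) fpoly"

abbreviation fE :: "nat list \<Rightarrow> 'k::field klr_free" where "fE i \<equiv> fgen (GE i)"
abbreviation fY :: "nat \<Rightarrow> 'k::field klr_free" where "fY k \<equiv> fgen (GY k)"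
abbreviation fPsi :: "nat \<Rightarrow> 'k::field klr_free" where "fPsi k \<equiv> fgen (GPsi k)"

text \<open>A pair \<open>(a, b)\<close> below stands for the relation \<open>a = b\<close>.\<close>

inductive_set klr_rels :: "nat \<Rightarrow> ('k::field klr_free \<times> 'k klr_free) set" for n :: nat where
  idem: "i \<in> klr_seqs n \<Longrightarrow> j \<in> klr_seqs n \<Longrightarrow>
    (fE i * fE j, if i = j then fE i else 0) \<in> klr_rels n"
| unit: "(\<Sum>i\<in>klr_seqs n. fE i, 1) \<in> klr_rels n"
| y_e: "k \<in> {1..n} \<Longrightarrow> i \<in> klr_seqs n \<Longrightarrow>
    (fY k * fE i, fE i * fY k) \<in> klr_rels n"
| psi_e: "k \<in> {1..n-1} \<Longrightarrow> i \<in> klr_seqs n \<Longrightarrow>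
    (fPsi k * fE i, fE (swap_at k i) * fPsi k) \<in> klr_rels n"
| y_y: "k \<in> {1..n} \<Longrightarrow> l \<in> {1..n} \<Longrightarrow>
    (fY k * fY l, fY l * fY k) \<in> klr_rels n"
| psi_y: "k \<in> {1..n-1} \<Longrightarrow> l \<in> {1..n} \<Longrightarrow> l \<noteq> k \<Longrightarrow> l \<noteq> k + 1 \<Longrightarrow>
    (fPsi k * fY l, fY l * fPsi k) \<in> klr_rels n"
| psi_psi: "k \<in> {1..n-1} \<Longrightarrow> l \<in> {1..n-1} \<Longrightarrow> \<bar>int k - int l\<bar> > 1 \<Longrightarrow>
    (fPsi k * fPsi l, fPsi l * fPsi k) \<in> klr_rels n"
| psi_y_Suc: "k \<in> {1..n-1} \<Longrightarrow> i \<in> klr_seqs n \<Longrightarrow>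
    (fPsi k * fY (k + 1) * fE i, fY k * fPsi k * fE i) \<in> klr_rels n"
| y_Suc_psi: "k \<in> {1..n-1} \<Longrightarrow> i \<in> klr_seqs n \<Longrightarrow>
    (fY (k + 1) * fPsi k * fE i, fPsi k * fY k * fE i) \<in> klr_rels n"
| braid: "k \<in> {1..n-1} \<Longrightarrow> k + 1 \<in> {1..n-1} \<Longrightarrow> i \<in> klr_seqs n \<Longrightarrow>
    (fPsi k * fPsi (k + 1) * fPsi k * fE i,
     fPsi (k + 1) * fPsi k * fPsi (k + 1) * fE i) \<in> klr_rels n"
| psi_sq_none: "k \<in> {1..n-1} \<Longrightarrow> i \<in> klr_seqs n \<Longrightarrow>
    \<not> arrow n (entry i k) (entry i (k + 1)) \<Longrightarrow>
    \<not> arrow n (entry i (k + 1)) (entry i k) \<Longrightarrow>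
    (fPsi k ^ 2 * fE i, fE i) \<in> klr_rels n"
| psi_sq_right: "k \<in> {1..n-1} \<Longrightarrow> i \<in> klr_seqs n \<Longrightarrow>
    arrow n (entry i k) (entry i (k + 1)) \<Longrightarrow>
    \<not> arrow n (entry i (k + 1)) (entry i k) \<Longrightarrow>
    (fPsi k ^ 2 * fE i, (fY (k + 1) - fY k) * fE i) \<in> klr_rels n"
| psi_sq_left: "k \<in> {1..n-1} \<Longrightarrow> i \<in> klr_seqs n \<Longrightarrow>
    \<not> arrow n (entry i k) (entry i (k + 1)) \<Longrightarrow>
    arrow n (entry i (k + 1)) (entry i k) \<Longrightarrow>
    (fPsi k ^ 2 * fE i, (fY k - fY (k + 1)) * fE i) \<in> klr_rels n"
| psi_sq_both: "k \<in> {1..n-1} \<Longrightarrow> i \<in> klr_seqs n \<Longrightarrow>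
    arrow n (entry i k) (entry i (k + 1)) \<Longrightarrow>
    arrow n (entry i (k + 1)) (entry i k) \<Longrightarrow>
    (fPsi k ^ 2 * fE i, (fY (k + 1) - fY k) * (fY k - fY (k + 1)) * fE i) \<in> klr_rels n"

definition klr_ideal :: "nat \<Rightarrow> 'k::field klr_free set" where
  "klr_ideal n = Idl\<^bsub>free_algebra (klr_gens n)\<^esub> {a - b | a b. (a, b) \<in> klr_rels n}"

definition klr_algebra :: "nat \<Rightarrow> ('k::field, 'k klr_free set) module" where
  "klr_algebra n = quot_algebra (free_algebra (klr_gens n)) (klr_ideal n)"

definition klr_gen_class :: "nat \<Rightarrow> klr_gen \<Rightarrow> 'k::field klr_free set" where
  "klr_gen_class n g = klr_ideal n +>\<^bsub>free_algebra (klr_gens n)\<^esub> fgen g"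


section \<open>The cyclotomic quotient for \<open>\<Lambda>\<^sub>0\<close>\<close>

definition cyc_ideal :: "nat \<Rightarrow> 'k::field klr_free set set" where
  "cyc_ideal n = Idl\<^bsub>klr_algebra n\<^esub>
     ({klr_gen_class n (GY 1) \<otimes>\<^bsub>klr_algebra n\<^esub> klr_gen_class n (GE i) | i.
         i \<in> klr_seqs n \<and> entry i 1 = 0} \<union>
      {klr_gen_class n (GE i) | i. i \<in> klr_seqs n \<and> entry i 1 \<noteq> 0})"

type_synonym 'k cyc = "'k klr_free set set"

definition cyc_algebra :: "nat \<Rightarrow> ('k::field, 'k cyc) module" where
  "cyc_algebra n = quot_algebra (klr_algebra n) (cyc_ideal n)"

definition cyc_gen :: "nat \<Rightarrow> klr_gen \<Rightarrow> 'k::field cyc" where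
  "cyc_gen n g = cyc_ideal n +>\<^bsub>klr_algebra n\<^esub> klr_gen_class n g"

abbreviation cyc_e :: "nat \<Rightarrow> nat list \<Rightarrow> 'k::field cyc" where
  "cyc_e n i \<equiv> cyc_gen n (GE i)"
abbreviation cyc_y :: "nat \<Rightarrow> nat \<Rightarrow> 'k::field cyc" where
  "cyc_y n k \<equiv> cyc_gen n (GY k)"
abbreviation cyc_psi :: "nat \<Rightarrow> nat \<Rightarrow> 'k::field cyc" where
  "cyc_psi n k \<equiv> cyc_gen n (GPsi k)"

text \<open>
  Whether an idempotent vanishes could depend on the field, so these sets take the field
  as a type argument.
\<close>

definition nz_seqs :: "'k::field itself \<Rightarrow> nat \<Rightarrow> nat list set" where
  "nz_seqs _ n = {i \<in> klr_seqs n. (cyc_e n i :: 'k cyc) \<noteq> \<zero>\<^bsub>cyc_algebra n\<^esub>}"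

definition nz_seqs1 :: "'k::field itself \<Rightarrow> nat \<Rightarrow> nat list set" where
  "nz_seqs1 K n = {i \<in> nz_seqs K n. entry i 2 = 1}"

definition cyc_idem :: "nat \<Rightarrow> 'k::field cyc" where
  "cyc_idem n = (\<Oplus>\<^bsub>cyc_algebra n\<^esub> i \<in> nz_seqs1 TYPE('k) n. cyc_e n i)"

definition hat :: "nat list \<Rightarrow> nat list" where
  "hat i = 0 # 1 # map Suc (tl i)"

end

theory Submission
  imports Defs "HOL-Library.Function_Algebras"
begin

text \<open>
  The idempotent \<open>e(i)\<close> vanishes in \<open>R\<^sub>n\<close> unless \<open>i\<close> is the residue sequence of a standard hook tableau,
  that is, a shuffle of \<open>0, 1, \<dots>, p - 1\<close> and \<open>n - 1, n - 2, \<dots>, p + 1\<close> that starts with \<open>0\<close>, followed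
  by \<open>p\<close>. Moreover \<open>y\<^sub>k = 0\<close> for \<open>k < n\<close> and \<open>y\<^sub>n\<^sup>2 = 0\<close>. With these facts the images of the generators
  satisfy the relations of \<open>R\<^sub>n\<^sub>-\<^sub>1\<close>.

  All idempotents with the same last entry \<open>p\<close> are equivalent through canonical products of crossings,
  so \<open>R\<^sub>n\<close> is determined by the spaces \<open>e(c\<^sub>p) R\<^sub>n e(c\<^sub>q)\<close> for one chosen sequence \<open>c\<^sub>p\<close> for each \<open>p\<close>. These
  are spanned by \<open>e(c\<^sub>p)\<close> and \<open>y\<^sub>n e(c\<^sub>p)\<close> for \<open>p = q\<close>, by one element for \<open>|p - q| = 1\<close>, and vanish otherwise,
  as for the Brauer tree algebra of a line. Multiplying two opposite elements gives \<open>\<plusminus> y\<^sub>n e(c\<^sub>p)\<close>, so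
  injectivity reduces to \<open>y\<^sub>n e(c\<^sub>p) \<noteq> 0\<close>, which is read off an explicit projective module. The map
  \<open>i \<mapsto> hat i\<close> sends \<open>c\<^sub>p\<close> to \<open>c\<^sub>p\<^sub>+\<^sub>1\<close> and the canonical products of \<open>R\<^sub>n\<^sub>-\<^sub>1\<close> to those with \<open>i\<^sub>2 = 1\<close>, which gives
  surjectivity.
\<close>

section \<open>Algebras over a field and their quotients\<close>

text \<open>Why a line appears: every residue occurs once, so a standard tableau has no second box
  on the diagonal and its shape is a hook. The last residue \<open>p\<close> may close the arm or
  the leg, so an admissible sequence belongs to two of the \<open>n\<close> hook shapes, and the
  endings \<open>p\<close> and \<open>p + 1\<close> share one of them: \<open>p\<close> is an edge
  of a line whose vertices are the hooks. The obstacle is the vertex 0. \<open>hat\<close> inserts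
  an entry, so the first crossing of the small algebra would become \<open>psi 2\<close>, which
  moves the entry 1 and has compression 0; every relation with that crossing has to hold because
  idempotents or dots vanish. For \<open>n = 3\<close> the small quiver has a double arrow, and its
  relation then asks exactly that the square of the last dot be 0. Spanning and independence are
  shown in different algebras. In the small one only an upper bound on the compressions is proved;
  independence is read off from their images in the large one. Hence the projective modules are
  built for \<open>n > 2\<close> only, where there is no double arrow.\<close>

locale central_scalars = ring A for A :: "('k::field, 'b) module" (structure) +
  assumes smult_one_closed [simp]: "c \<odot> \<one> \<in> carrier A"
    and smult_eq: "x \<in> carrier A \<Longrightarrow> c \<odot> x = (c \<odot> \<one>) \<otimes> x"
    and smult_one_comm: "x \<in> carrier A \<Longrightarrow> (c \<odot> \<one>) \<otimes> x = x \<otimes> (c \<odot> \<one>)"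
    and smult_one_add: "(a + b) \<odot> \<one> = a \<odot> \<one> \<oplus> b \<odot> \<one>"
    and smult_one_mult: "(a * b) \<odot> \<one> = (a \<odot> \<one>) \<otimes> (b \<odot> \<one>)"
    and one_smult_one: "1 \<odot> \<one> = \<one>"
begin

lemma smult_closed [simp]: "x \<in> carrier A \<Longrightarrow> c \<odot> x \<in> carrier A"
  by (subst smult_eq) auto

lemma smult_add_right: "x \<in> carrier A \<Longrightarrow> y \<in> carrier A \<Longrightarrow> c \<odot> (x \<oplus> y) = c \<odot> x \<oplus> c \<odot> y"
  by (simp add: smult_eq[of x] smult_eq[of y] smult_eq[of "x \<oplus> y"] r_distr)

lemma smult_add_left: "x \<in> carrier A \<Longrightarrow> (a + b) \<odot> x = a \<odot> x \<oplus> b \<odot> x"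
  by (simp add: smult_eq[of x] smult_one_add l_distr)

lemma smult_smult: "x \<in> carrier A \<Longrightarrow> a \<odot> (b \<odot> x) = (a * b) \<odot> x"
  by (simp add: smult_eq[of x] smult_eq[of "b \<odot> \<one> \<otimes> x"] smult_one_mult m_assoc)

lemma one_smult: "x \<in> carrier A \<Longrightarrow> 1 \<odot> x = x"
  by (simp add: smult_eq[of x] one_smult_one)

lemma smult_mult_left:
  "x \<in> carrier A \<Longrightarrow> y \<in> carrier A \<Longrightarrow> (c \<odot> x) \<otimes> y = c \<odot> (x \<otimes> y)"
  by (simp add: smult_eq[of x] smult_eq[of "x \<otimes> y"] m_assoc)

lemma smult_mult_right:
  assumes "x \<in> carrier A" "y \<in> carrier A"
  shows "x \<otimes> (c \<odot> y) = c \<odot> (x \<otimes> y)"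
  using assms smult_one_comm[of x c]
  by (simp add: smult_eq[of y] smult_eq[of "x \<otimes> y"] m_assoc[symmetric])

lemma quot_coset_mult:
  assumes "ideal I A" "x \<in> carrier A" "y \<in> carrier A"
  shows "(I +> x) \<otimes>\<^bsub>quot_algebra A I\<^esub> (I +> y) = I +> (x \<otimes> y)"
  using ideal.rcoset_mult_add[OF assms] by (simp add: quot_algebra_def FactRing_def)

lemma quot_coset_add:
  assumes "ideal I A" "x \<in> carrier A" "y \<in> carrier A"
  shows "(I +> x) \<oplus>\<^bsub>quot_algebra A I\<^esub> (I +> y) = I +> (x \<oplus> y)"
proof -
  interpret ideal I A by fact
  show ?thesis using assms by (simp add: quot_algebra_def FactRing_def a_rcos_sum)
qed

text \<open>Scalars enter the locale only through the central elements
  \<open>c \<odot> \<one>\<close>, so every ring ideal absorbs them. Hence the union of cosets that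
  defines the scalar multiple in \<open>quot_algebra\<close> is a single coset.\<close>

lemma quot_coset_smult:
  assumes "ideal I A" "x \<in> carrier A"
  shows "c \<odot>\<^bsub>quot_algebra A I\<^esub> (I +> x) = I +> (c \<odot> x)"
proof -
  interpret ideal I A by fact
  have eq: "I +> (c \<odot> a) = I +> (c \<odot> x)" if a: "a \<in> I +> x" for a
  proof -
    from a obtain h where h: "h \<in> I" "a = h \<oplus> x" by (auto simp: a_r_coset_def')
    have hc: "h \<in> carrier A" using h(1) by simp
    have "c \<odot> h \<in> I"
      using I_l_closed[OF h(1) smult_one_closed[of c]] hc by (simp add: smult_eq[of h])
    then have "c \<odot> a \<in> I +> (c \<odot> x)"
      using assms(2) hc by (auto simp: h(2) smult_add_right a_r_coset_def')
    then show ?thesis using a_repr_independence'[of "c \<odot> a" "c \<odot> x"] assms(2) by simp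
  qed
  have "x \<in> I +> x" using assms(2) by (rule a_rcos_self)
  then have "(\<Union>a\<in>I +> x. I +> (c \<odot> x)) = I +> (c \<odot> x)" by blast
  moreover have "(\<Union>a\<in>I +> x. I +> (c \<odot> a)) = (\<Union>a\<in>I +> x. I +> (c \<odot> x))"
    using eq by (rule SUP_cong[OF refl])
  ultimately show ?thesis by (simp only: quot_algebra_def module.simps)
qed

lemma quot_carrier: "carrier (quot_algebra A I) = (\<lambda>x. I +> x) ` carrier A"
  by (auto simp: quot_algebra_def FactRing_def A_RCOSETS_def')

lemma quot_one: "\<one>\<^bsub>quot_algebra A I\<^esub> = I +> \<one>"
  by (simp add: quot_algebra_def FactRing_def)

lemma quot_zero: "\<zero>\<^bsub>quot_algebra A I\<^esub> = I"
  by (simp add: quot_algebra_def FactRing_def)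

lemma quot_coset_eq_zero_iff:
  assumes "ideal I A" "x \<in> carrier A"
  shows "I +> x = \<zero>\<^bsub>quot_algebra A I\<^esub> \<longleftrightarrow> x \<in> I"
proof -
  interpret ideal I A by fact
  show ?thesis
    using assms(2) a_rcos_const a_rcos_self by (auto simp: quot_zero)
qed

lemma ring_quot_algebra:
  assumes "ideal I A"
  shows "ring (quot_algebra A I)"
proof -
  interpret ideal I A by fact
  interpret Q: ring "A Quot I" by (rule quotient_is_ring)
  have sel: "carrier (quot_algebra A I) = carrier (A Quot I)"
    "mult (quot_algebra A I) = mult (A Quot I)" "add (quot_algebra A I) = add (A Quot I)"
    "one (quot_algebra A I) = one (A Quot I)" "zero (quot_algebra A I) = zero (A Quot I)"
    by (simp_all add: quot_algebra_def)
  show ?thesis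
  proof (rule ringI)
    show "abelian_group (quot_algebra A I)"
      by (rule abelian_groupI)
        (simp_all only: sel Q.a_closed Q.zero_closed Q.l_zero Q.a_assoc Q.add.l_inv_ex, simp add: Q.a_comm)
    show "monoid (quot_algebra A I)"
      by (rule monoidI) (auto simp: sel Q.m_assoc)
  qed (auto simp: sel Q.l_distr Q.r_distr)
qed

lemma central_scalars_quot:
  assumes "ideal I A"
  shows "central_scalars (quot_algebra A I)"
proof -
  interpret Q: ring "quot_algebra A I" by (rule ring_quot_algebra) fact
  note [simp] = quot_coset_mult[OF assms] quot_coset_add[OF assms] quot_coset_smult[OF assms]
    quot_carrier quot_one
  show ?thesis
  proof
    fix c and X assume X: "X \<in> carrier (quot_algebra A I)"
    then obtain x where x: "x \<in> carrier A" "X = I +> x" by auto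
    show "c \<odot>\<^bsub>quot_algebra A I\<^esub> X = c \<odot>\<^bsub>quot_algebra A I\<^esub> \<one>\<^bsub>quot_algebra A I\<^esub> \<otimes>\<^bsub>quot_algebra A I\<^esub> X"
      using x by (simp add: smult_eq[of x])
    show "c \<odot>\<^bsub>quot_algebra A I\<^esub> \<one>\<^bsub>quot_algebra A I\<^esub> \<otimes>\<^bsub>quot_algebra A I\<^esub> X =
      X \<otimes>\<^bsub>quot_algebra A I\<^esub> (c \<odot>\<^bsub>quot_algebra A I\<^esub> \<one>\<^bsub>quot_algebra A I\<^esub>)"
      using x by (simp add: smult_one_comm)
  qed (auto simp: smult_one_add smult_one_mult one_smult_one)
qed

end

text \<open>Only keys of the fixed \<open>p\<close> are added in the inductive step, so a condition
  on the letters occurring in \<open>p\<close> stays available there.\<close>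

lemma poly_mapping_single_induct [case_names zero add]:
  fixes p :: "'a \<Rightarrow>\<^sub>0 'b::ab_group_add"
  assumes "P 0"
    and add: "\<And>w c q. w \<in> Poly_Mapping.keys p \<Longrightarrow> P q \<Longrightarrow> P (Poly_Mapping.single w c + q)"
  shows "P p"
proof -
  have "P q" if "finite W" "W \<subseteq> Poly_Mapping.keys p" "Poly_Mapping.keys q \<subseteq> W" for W q
    using that
  proof (induction W arbitrary: q rule: finite_induct)
    case empty
    then have "q = 0" by simp
    then show ?case using \<open>P 0\<close> by simp
  next
    case (insert w W)
    let ?r = "q - Poly_Mapping.single w (Poly_Mapping.lookup q w)"
    have "Poly_Mapping.keys ?r \<subseteq> W"
      using insert.prems(2)
      by (auto simp: in_keys_iff lookup_minus lookup_single when_def split: if_splits)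
    then have "P ?r" using insert by auto
    then have "P (Poly_Mapping.single w (Poly_Mapping.lookup q w) + ?r)"
      using insert.prems by (intro add) auto
    then show ?case by simp
  qed
  from this[of "Poly_Mapping.keys p" p] show ?thesis by simp
qed

section \<open>Scalars and induction in the free algebra\<close>

lemma map_mult_single:
  fixes p :: "('k::field, 'a) fpoly"
  shows "Poly_Mapping.map ((*) c) p = Poly_Mapping.single 0 c * p"
proof -
  have lookup: "Poly_Mapping.lookup (Poly_Mapping.map ((*) c) p) k = c * Poly_Mapping.lookup p k"
    for p :: "('k, 'a) fpoly" and k
    by (simp add: map.rep_eq when_def)
  show ?thesis
  proof (induction p rule: poly_mapping_single_induct)
    case zero
    show ?case by (rule poly_mapping_eqI) (simp add: lookup)
  next
    case (add w d q)
    have "Poly_Mapping.map ((*) c) (Poly_Mapping.single w d + q) =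
       Poly_Mapping.map ((*) c) (Poly_Mapping.single w d) + Poly_Mapping.map ((*) c) q"
      by (rule poly_mapping_eqI) (simp add: lookup lookup_add distrib_left del: map_single)
    then show ?case
      by (simp add: add.IH distrib_left mult_single)
  qed
qed

lemma single_0_comm:
  fixes p :: "('k::field, 'a) fpoly"
  shows "Poly_Mapping.single 0 c * p = p * Poly_Mapping.single 0 c"
  by (induction p rule: poly_mapping_single_induct)
    (simp_all add: distrib_left distrib_right mult_single mult.commute)

lemma free_algebra_sel [simp]:
  "\<zero>\<^bsub>free_algebra X\<^esub> = 0" "\<one>\<^bsub>free_algebra X\<^esub> = 1"
  "p \<oplus>\<^bsub>free_algebra X\<^esub> q = p + q" "p \<otimes>\<^bsub>free_algebra X\<^esub> q = p * q"
  "c \<odot>\<^bsub>free_algebra X\<^esub> p = Poly_Mapping.single 0 c * p"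
  by (simp_all add: free_algebra_def map_mult_single)

lemma single_in_free_algebra:
  "set (letters w) \<subseteq> X \<Longrightarrow> Poly_Mapping.single w c \<in> carrier (free_algebra X)"
  by (simp add: free_algebra_def)

lemma central_scalars_free_algebra:
  "central_scalars (free_algebra X :: ('k::field, ('k, 'a) fpoly) module)"
proof -
  interpret ring "free_algebra X :: ('k::field, ('k, 'a) fpoly) module" by (rule ring_free_algebra)
  show ?thesis
  proof
    show "c \<odot>\<^bsub>free_algebra X\<^esub> \<one>\<^bsub>free_algebra X\<^esub> \<otimes>\<^bsub>free_algebra X\<^esub> p =
      p \<otimes>\<^bsub>free_algebra X\<^esub> (c \<odot>\<^bsub>free_algebra X\<^esub> \<one>\<^bsub>free_algebra X\<^esub>)"
      for c and p :: "('k, 'a) fpoly"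
      using single_0_comm[of c p] by simp
    show "c \<odot>\<^bsub>free_algebra X\<^esub> \<one>\<^bsub>free_algebra X\<^esub> \<in> carrier (free_algebra X)" for c :: 'k
      by (simp add: single_in_free_algebra zero_fword_def)
  qed (simp_all add: single_add mult_single)
qed

lemma fgen_in_free_algebra: "g \<in> X \<Longrightarrow> fgen g \<in> carrier (free_algebra X)"
  by (simp add: fgen_def single_in_free_algebra)

text \<open>Words grow by one generator on the left, which is the form in which stability of a
  subspace under the generators is checked.\<close>

lemma free_algebra_induct [consumes 1, case_names zero one gen add smult]:
  fixes p :: "('k::field, 'a) fpoly"
  assumes "p \<in> carrier (free_algebra X)"
    and zero: "P 0" and one: "P 1"
    and gen: "\<And>g p. g \<in> X \<Longrightarrow> p \<in> carrier (free_algebra X) \<Longrightarrow> P p \<Longrightarrow> P (fgen g * p)"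
    and add: "\<And>p q. p \<in> carrier (free_algebra X) \<Longrightarrow> q \<in> carrier (free_algebra X) \<Longrightarrow>
      P p \<Longrightarrow> P q \<Longrightarrow> P (p + q)"
    and smult: "\<And>c p. p \<in> carrier (free_algebra X) \<Longrightarrow> P p \<Longrightarrow> P (Poly_Mapping.single 0 c * p)"
  shows "P p"
proof -
  interpret central_scalars "free_algebra X :: ('k::field, ('k, 'a) fpoly) module"
    by (rule central_scalars_free_algebra)
  have word: "P (Poly_Mapping.single (FWord w) 1) \<and>
    Poly_Mapping.single (FWord w) (1::'k) \<in> carrier (free_algebra X)" if "set w \<subseteq> X" for w
    using that
  proof (induction w)
    case Nil
    then show ?case using one one_closed by (simp add: zero_fword_def flip: single_one)
  next
    case (Cons g w)
    then have "P (fgen g * Poly_Mapping.single (FWord w) 1)" by (intro gen) auto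
    moreover have "fgen g * Poly_Mapping.single (FWord w) 1 = Poly_Mapping.single (FWord (g # w)) (1::'k)"
      by (simp add: fgen_def mult_single plus_fword_def)
    ultimately show ?case using Cons by (simp add: single_in_free_algebra)
  qed
  have "P p \<and> p \<in> carrier (free_algebra X)"
  proof (induction p rule: poly_mapping_single_induct)
    case zero
    then show ?case using assms(2) zero_closed by simp
  next
    case (add w c q)
    then have w: "set (letters w) \<subseteq> X" using assms(1) by (auto simp: free_algebra_def)
    have "P (Poly_Mapping.single 0 c * Poly_Mapping.single w 1)"
      using word[OF w] by (intro smult) auto
    then have "P (Poly_Mapping.single w c)" by (simp add: mult_single)
    then show ?case
      using add.IH a_closed[of "Poly_Mapping.single w c" q] single_in_free_algebra[OF w]
      by (auto intro: assms(5))
  qed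
  then show ?thesis by simp
qed

lemma minus_free_algebra:
  fixes p q :: "('k::field, 'a) fpoly"
  assumes "p \<in> carrier (free_algebra X)" "q \<in> carrier (free_algebra X)"
  shows "p - q = p \<ominus>\<^bsub>free_algebra X\<^esub> q" "p - q \<in> carrier (free_algebra X)"
proof -
  interpret ring "free_algebra X :: ('k::field, ('k, 'a) fpoly) module" by (rule ring_free_algebra)
  show c: "p - q \<in> carrier (free_algebra X)"
    using subsetD[OF keys_diff[of p q]] assms unfolding free_algebra_def by auto
  have "p = (p - q) \<oplus>\<^bsub>free_algebra X\<^esub> q" by simp
  also have "\<dots> \<ominus>\<^bsub>free_algebra X\<^esub> q = p - q"
    unfolding a_minus_def using assms c by (subst a_assoc) (simp_all only: a_inv_closed r_neg r_zero)
  finally show "p - q = p \<ominus>\<^bsub>free_algebra X\<^esub> q" ..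
qed

section \<open>Presentation of the cyclotomic algebra\<close>

abbreviation klr_free_algebra :: "nat \<Rightarrow> ('k::field, 'k klr_free) module" where
  "klr_free_algebra n \<equiv> free_algebra (klr_gens n)"

text \<open>Both quotient maps in one step: from here on the cyclotomic algebra is handled as a
  single quotient of the free algebra.\<close>

definition cyc_proj :: "nat \<Rightarrow> 'k::field klr_free \<Rightarrow> 'k cyc" where
  "cyc_proj n p =
     cyc_ideal n +>\<^bsub>klr_algebra n\<^esub> (klr_ideal n +>\<^bsub>klr_free_algebra n\<^esub> p)"

lemma length_klr_seqs: "i \<in> klr_seqs n \<Longrightarrow> length i = n"
  by (auto simp: klr_seqs_def permutations_of_set_def distinct_card[symmetric])

lemma finite_klr_seqs [simp]: "finite (klr_seqs n)"
  by (simp add: klr_seqs_def)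

lemma mset_swap_at: "0 < k \<Longrightarrow> k < length i \<Longrightarrow> mset (swap_at k i) = mset i"
  by (simp add: swap_at_def mset_swap)

lemma swap_at_klr_seqs:
  assumes "i \<in> klr_seqs n" "0 < k" "k < n"
  shows "swap_at k i \<in> klr_seqs n"
proof -
  have "mset (swap_at k i) = mset i"
    using assms length_klr_seqs by (intro mset_swap_at) auto
  then show ?thesis
    using assms(1) mset_eq_setD[of "swap_at k i" i] mset_eq_imp_distinct_iff[of "swap_at k i" i]
    by (auto simp: klr_seqs_def permutations_of_set_def)
qed

context fixes n :: nat
begin

interpretation F: central_scalars "klr_free_algebra n :: ('k::field, 'k klr_free) module"
  by (rule central_scalars_free_algebra)

lemma klr_free_closed:
  fixes p q :: "'k::field klr_free"
  shows
  "0 \<in> carrier (klr_free_algebra n :: ('k::field, 'k klr_free) module)"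
  "1 \<in> carrier (klr_free_algebra n :: ('k::field, 'k klr_free) module)"
  "p \<in> carrier (klr_free_algebra n) \<Longrightarrow> q \<in> carrier (klr_free_algebra n) \<Longrightarrow>
    p + q \<in> carrier (klr_free_algebra n)"
  "p \<in> carrier (klr_free_algebra n) \<Longrightarrow> q \<in> carrier (klr_free_algebra n) \<Longrightarrow>
    p - q \<in> carrier (klr_free_algebra n)"
  "p \<in> carrier (klr_free_algebra n) \<Longrightarrow> q \<in> carrier (klr_free_algebra n) \<Longrightarrow>
    p * q \<in> carrier (klr_free_algebra n)"
  "p \<in> carrier (klr_free_algebra n) \<Longrightarrow> p ^ m \<in> carrier (klr_free_algebra n)"
  "p \<in> carrier (klr_free_algebra n) \<Longrightarrow> Poly_Mapping.single 0 c * p \<in> carrier (klr_free_algebra n)"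
  "i \<in> klr_seqs n \<Longrightarrow> fE i \<in> carrier (klr_free_algebra n :: ('k::field, 'k klr_free) module)"
  "k \<in> {1..n} \<Longrightarrow> fY k \<in> carrier (klr_free_algebra n :: ('k::field, 'k klr_free) module)"
  "k \<in> {1..n-1} \<Longrightarrow> fPsi k \<in> carrier (klr_free_algebra n :: ('k::field, 'k klr_free) module)"
proof -
  show one: "1 \<in> carrier (klr_free_algebra n :: ('k::field, 'k klr_free) module)"
    using F.one_closed by simp
  show mult: "p * q \<in> carrier (klr_free_algebra n)"
    if "p \<in> carrier (klr_free_algebra n)" "q \<in> carrier (klr_free_algebra n)" for p q :: "'k klr_free"
    using F.m_closed that by simp
  show "p ^ m \<in> carrier (klr_free_algebra n)" if "p \<in> carrier (klr_free_algebra n)"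
    using that by (induction m) (auto simp: one mult)
  show "0 \<in> carrier (klr_free_algebra n :: ('k::field, 'k klr_free) module)"
    using F.zero_closed by simp
  show "p + q \<in> carrier (klr_free_algebra n)"
    if "p \<in> carrier (klr_free_algebra n)" "q \<in> carrier (klr_free_algebra n)"
    using F.a_closed that by simp
  show "Poly_Mapping.single 0 c * p \<in> carrier (klr_free_algebra n)"
    if "p \<in> carrier (klr_free_algebra n)"
    using F.smult_closed[OF that] by simp
qed (auto intro!: fgen_in_free_algebra minus_free_algebra(2) simp: klr_gens_def)

lemma sum_klr_free_closed:
  "(\<And>i. i \<in> I \<Longrightarrow> f i \<in> carrier (klr_free_algebra n)) \<Longrightarrow>
    sum f I \<in> carrier (klr_free_algebra n :: ('k::field, 'k klr_free) module)"
  by (induction I rule: infinite_finite_induct) (auto intro: klr_free_closed)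

lemma klr_rels_closed:
  assumes "(a, b) \<in> klr_rels n"
  shows "a \<in> carrier (klr_free_algebra n :: ('k::field, 'k klr_free) module)"
    "b \<in> carrier (klr_free_algebra n :: ('k::field, 'k klr_free) module)"
  using assms
  by (cases; force intro!: klr_free_closed sum_klr_free_closed swap_at_klr_seqs)+

lemma ideal_klr_ideal: "ideal (klr_ideal n) (klr_free_algebra n :: ('k::field, 'k klr_free) module)"
  unfolding klr_ideal_def
  by (rule F.genideal_ideal) (auto intro: klr_free_closed klr_rels_closed)

interpretation klr: central_scalars "klr_algebra n :: ('k::field, 'k klr_free set) module"
  unfolding klr_algebra_def by (rule F.central_scalars_quot[OF ideal_klr_ideal])

lemma klr_gen_class_closed:
  "g \<in> klr_gens n \<Longrightarrow> klr_gen_class n g \<in> carrier (klr_algebra n :: ('k::field, 'k klr_free set) module)"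
  by (auto simp: klr_gen_class_def klr_algebra_def F.quot_carrier intro: fgen_in_free_algebra)

lemma ideal_cyc_ideal:
  assumes "0 < n"
  shows "ideal (cyc_ideal n) (klr_algebra n :: ('k::field, 'k klr_free set) module)"
  unfolding cyc_ideal_def using assms
  by (intro klr.genideal_ideal) (auto intro!: klr_gen_class_closed klr.m_closed simp: klr_gens_def)

context assumes n_pos: "0 < n"
begin

interpretation cyc: central_scalars "cyc_algebra n :: ('k::field, 'k cyc) module"
  unfolding cyc_algebra_def by (rule klr.central_scalars_quot[OF ideal_cyc_ideal[OF n_pos]])

lemmas central_scalars_cyc_algebra = cyc.central_scalars_axioms

lemma klr_coset_closed:
  "p \<in> carrier (klr_free_algebra n) \<Longrightarrow>
    klr_ideal n +>\<^bsub>klr_free_algebra n\<^esub> p \<in> carrier (klr_algebra n :: ('k::field, 'k klr_free set) module)"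
  by (simp add: klr_algebra_def F.quot_carrier)

lemma klr_coset_hom:
  fixes p q :: "'k::field klr_free"
  assumes "p \<in> carrier (klr_free_algebra n)" "q \<in> carrier (klr_free_algebra n)"
  shows "(klr_ideal n +>\<^bsub>klr_free_algebra n\<^esub> p) \<oplus>\<^bsub>klr_algebra n\<^esub>
      (klr_ideal n +>\<^bsub>klr_free_algebra n\<^esub> q) = klr_ideal n +>\<^bsub>klr_free_algebra n\<^esub> (p + q)"
    "(klr_ideal n +>\<^bsub>klr_free_algebra n\<^esub> p) \<otimes>\<^bsub>klr_algebra n\<^esub>
      (klr_ideal n +>\<^bsub>klr_free_algebra n\<^esub> q) = klr_ideal n +>\<^bsub>klr_free_algebra n\<^esub> (p * q)"
  using F.quot_coset_add[OF ideal_klr_ideal assms] F.quot_coset_mult[OF ideal_klr_ideal assms]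
  by (simp_all add: klr_algebra_def)

lemma klr_coset_zero:
  "klr_ideal n +>\<^bsub>klr_free_algebra n\<^esub> 0 = \<zero>\<^bsub>klr_algebra n :: ('k::field, 'k klr_free set) module\<^esub>"
proof -
  have "(0 :: 'k klr_free) \<in> klr_ideal n"
    using additive_subgroup.zero_closed[OF ideal.axioms(1)[OF ideal_klr_ideal]] by simp
  then show ?thesis
    unfolding klr_algebra_def by (simp add: F.quot_coset_eq_zero_iff[OF ideal_klr_ideal klr_free_closed(1)])
qed

lemma cyc_proj_hom:
  fixes p q :: "'k::field klr_free"
  assumes "p \<in> carrier (klr_free_algebra n)" "q \<in> carrier (klr_free_algebra n)"
  shows "cyc_proj n (p + q) = cyc_proj n p \<oplus>\<^bsub>cyc_algebra n\<^esub> cyc_proj n q"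
    "cyc_proj n (p * q) = cyc_proj n p \<otimes>\<^bsub>cyc_algebra n\<^esub> cyc_proj n q"
    "cyc_proj n (Poly_Mapping.single 0 c * p) = c \<odot>\<^bsub>cyc_algebra n\<^esub> cyc_proj n p"
  using assms
    F.quot_coset_add[OF ideal_klr_ideal assms] F.quot_coset_mult[OF ideal_klr_ideal assms]
    F.quot_coset_smult[OF ideal_klr_ideal assms(1), of c]
    klr.quot_coset_add[OF ideal_cyc_ideal[OF n_pos] klr_coset_closed klr_coset_closed, OF assms]
    klr.quot_coset_mult[OF ideal_cyc_ideal[OF n_pos] klr_coset_closed klr_coset_closed, OF assms]
    klr.quot_coset_smult[OF ideal_cyc_ideal[OF n_pos] klr_coset_closed, OF assms(1), of c]
  by (simp_all add: cyc_proj_def cyc_algebra_def flip: klr_algebra_def)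

lemma cyc_proj_one: "cyc_proj n 1 = \<one>\<^bsub>cyc_algebra n :: ('k::field, 'k cyc) module\<^esub>"
  using F.quot_one[of "klr_ideal n :: 'k klr_free set"] klr.quot_one[of "cyc_ideal n :: 'k cyc"]
  by (simp add: cyc_proj_def cyc_algebra_def flip: klr_algebra_def)

lemma cyc_carrier:
  "carrier (cyc_algebra n :: ('k::field, 'k cyc) module) = cyc_proj n ` carrier (klr_free_algebra n)"
proof -
  have "carrier (klr_algebra n :: ('k, 'k klr_free set) module) =
    (\<lambda>p. klr_ideal n +>\<^bsub>klr_free_algebra n\<^esub> p) ` carrier (klr_free_algebra n)"
    by (simp add: klr_algebra_def F.quot_carrier)
  then show ?thesis
    by (simp add: cyc_algebra_def klr.quot_carrier cyc_proj_def image_image)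
qed

lemma cyc_proj_closed:
  "p \<in> carrier (klr_free_algebra n) \<Longrightarrow> cyc_proj n p \<in> carrier (cyc_algebra n :: ('k::field, 'k cyc) module)"
  by (simp add: cyc_carrier)

lemma cyc_proj_0: "cyc_proj n 0 = \<zero>\<^bsub>cyc_algebra n :: ('k::field, 'k cyc) module\<^esub>"
proof -
  have c: "cyc_proj n 0 \<in> carrier (cyc_algebra n :: ('k, 'k cyc) module)"
    by (rule cyc_proj_closed[OF klr_free_closed(1)])
  have "cyc_proj n 0 \<oplus>\<^bsub>cyc_algebra n\<^esub> cyc_proj n 0 = (cyc_proj n 0 :: 'k cyc)"
    using cyc_proj_hom(1)[OF klr_free_closed(1,1), where ?'k = 'k] by (simp only: add_0)
  then show ?thesis by (simp only: cyc.add.l_cancel_one[OF c c])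
qed

lemma cyc_gen_eq: "cyc_gen n g = cyc_proj n (fgen g)"
  by (simp add: cyc_gen_def cyc_proj_def klr_gen_class_def)

lemma cyc_proj_rel:
  fixes a b :: "'k::field klr_free"
  assumes "(a, b) \<in> klr_rels n"
  shows "cyc_proj n a = cyc_proj n b"
proof -
  note c = klr_rels_closed[OF assms]
  have "a - b \<in> klr_ideal n"
    unfolding klr_ideal_def using assms
    by (intro subsetD[OF F.genideal_self]) (auto intro: klr_free_closed klr_rels_closed)
  then have "klr_ideal n +>\<^bsub>klr_free_algebra n\<^esub> (a - b) = \<zero>\<^bsub>klr_algebra n\<^esub>"
    unfolding klr_algebra_def using c
    by (subst F.quot_coset_eq_zero_iff[OF ideal_klr_ideal]) (auto intro: klr_free_closed)
  then have "cyc_proj n (a - b) = cyc_ideal n +>\<^bsub>klr_algebra n\<^esub> \<zero>\<^bsub>klr_algebra n\<^esub>"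
    by (simp add: cyc_proj_def)
  also have "\<dots> = cyc_proj n 0"
    by (simp add: cyc_proj_def klr_coset_zero)
  finally have zero: "cyc_proj n (a - b) = \<zero>\<^bsub>cyc_algebra n\<^esub>"
    by (simp add: cyc_proj_0)
  have "cyc_proj n ((a - b) + b) = cyc_proj n (a - b) \<oplus>\<^bsub>cyc_algebra n\<^esub> cyc_proj n b"
    using c by (intro cyc_proj_hom klr_free_closed)
  then show ?thesis
    using cyc_proj_closed[OF c(2)] by (simp add: zero)
qed

lemma cyc_proj_cyc_rel:
  assumes "i \<in> klr_seqs n"
  shows "entry i 1 = 0 \<Longrightarrow> cyc_proj n (fY 1 * fE i) = \<zero>\<^bsub>cyc_algebra n :: ('k::field, 'k cyc) module\<^esub>"
    "entry i 1 \<noteq> 0 \<Longrightarrow> cyc_proj n (fE i) = \<zero>\<^bsub>cyc_algebra n :: ('k::field, 'k cyc) module\<^esub>"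
proof -
  let ?S = "{klr_gen_class n (GY 1) \<otimes>\<^bsub>klr_algebra n\<^esub> klr_gen_class n (GE i) | i.
         i \<in> klr_seqs n \<and> entry i 1 = 0} \<union>
      {klr_gen_class n (GE i) | i. i \<in> klr_seqs n \<and> entry i 1 \<noteq> 0} :: 'k klr_free set set"
  have "?S \<subseteq> carrier (klr_algebra n)"
    using n_pos by (auto intro!: klr_gen_class_closed klr.m_closed simp: klr_gens_def)
  then have sub: "?S \<subseteq> cyc_ideal n"
    unfolding cyc_ideal_def by (rule klr.genideal_self)
  have zero: "cyc_ideal n +>\<^bsub>klr_algebra n\<^esub> x = \<zero>\<^bsub>cyc_algebra n\<^esub>" if "x \<in> ?S" for x
    using that sub \<open>?S \<subseteq> carrier (klr_algebra n)\<close> unfolding cyc_algebra_def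
    by (subst klr.quot_coset_eq_zero_iff[OF ideal_cyc_ideal[OF n_pos]]) auto
  { assume i: "entry i 1 = 0"
    have "klr_ideal n +>\<^bsub>klr_free_algebra n\<^esub> (fY 1 * fE i :: 'k klr_free) =
      klr_gen_class n (GY 1) \<otimes>\<^bsub>klr_algebra n\<^esub> klr_gen_class n (GE i)"
      using assms n_pos by (simp add: klr_gen_class_def klr_coset_hom klr_free_closed)
    then show "cyc_proj n (fY 1 * fE i) = \<zero>\<^bsub>cyc_algebra n :: ('k::field, 'k cyc) module\<^esub>"
      unfolding cyc_proj_def using assms i by (intro zero) auto }
  { assume i: "entry i 1 \<noteq> 0"
    then show "cyc_proj n (fE i) = \<zero>\<^bsub>cyc_algebra n :: ('k::field, 'k cyc) module\<^esub>"
      unfolding cyc_proj_def using assms i by (intro zero) (auto simp: klr_gen_class_def) }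
qed

text \<open>The universal property of the presentation, phrased with ideals. The image of
  \<open>S\<close> in the KLR algebra is an ideal containing the cyclotomic generators, so
  \<open>p\<close> agrees with an element of \<open>S\<close> modulo \<open>klr_ideal n\<close>, and
  the latter lies in \<open>S\<close> as well.\<close>

lemma cyc_proj_kernel_minimal:
  fixes p :: "'k::field klr_free"
  assumes S: "ideal S (klr_free_algebra n)"
    and rel: "\<And>a b. (a, b) \<in> klr_rels n \<Longrightarrow> a - b \<in> S"
    and y: "\<And>i. i \<in> klr_seqs n \<Longrightarrow> entry i 1 = 0 \<Longrightarrow> fY 1 * fE i \<in> S"
    and e: "\<And>i. i \<in> klr_seqs n \<Longrightarrow> entry i 1 \<noteq> 0 \<Longrightarrow> fE i \<in> S"
    and p: "p \<in> carrier (klr_free_algebra n)" "cyc_proj n p = \<zero>\<^bsub>cyc_algebra n\<^esub>"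
  shows "p \<in> S"
proof -
  interpret S: ideal S "klr_free_algebra n" by fact
  let ?c = "\<lambda>p :: 'k klr_free. klr_ideal n +>\<^bsub>klr_free_algebra n\<^esub> p"
  have sub: "klr_ideal n \<subseteq> S"
    unfolding klr_ideal_def using rel by (intro F.genideal_minimal[OF S]) auto
  note c_add = klr_coset_hom(1) and c_mult = klr_coset_hom(2) and c_0 = klr_coset_zero
  have ideal: "ideal (?c ` S) (klr_algebra n)"
  proof (rule idealI)
    show "ring (klr_algebra n :: ('k, 'k klr_free set) module)" by (rule klr.ring_axioms)
    show "subgroup (?c ` S) (add_monoid (klr_algebra n))"
    proof (rule klr.add.subgroupI)
      show "?c ` S \<subseteq> carrier (klr_algebra n)" by (auto intro: klr_coset_closed)
      show "?c ` S \<noteq> {}" using S.zero_closed by auto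
      fix X assume "X \<in> ?c ` S"
      then obtain a where a: "a \<in> S" "X = ?c a" by auto
      have na: "- a \<in> S" "- a \<in> carrier (klr_free_algebra n)"
        using S.a_inv_closed[OF a(1)] S.a_Hcarr[OF a(1)]
          minus_free_algebra[OF klr_free_closed(1)[where ?'k = 'k] S.a_Hcarr[OF a(1)]]
        by (simp_all add: a_minus_def)
      have "?c (- a) \<oplus>\<^bsub>klr_algebra n\<^esub> X = \<zero>\<^bsub>klr_algebra n\<^esub>"
        using a na by (simp add: c_add c_0)
      then have "\<ominus>\<^bsub>klr_algebra n\<^esub> X = ?c (- a)"
        using a na by (intro klr.minus_equality) (auto intro: klr_coset_closed)
      then show "\<ominus>\<^bsub>klr_algebra n\<^esub> X \<in> ?c ` S" using na by simp
    next
      fix X Y assume "X \<in> ?c ` S" "Y \<in> ?c ` S"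
      then obtain a b where ab: "a \<in> S" "X = ?c a" "b \<in> S" "Y = ?c b" by auto
      then show "X \<oplus>\<^bsub>klr_algebra n\<^esub> Y \<in> ?c ` S"
        using S.a_closed[OF ab(1,3)] by (simp add: c_add)
    qed
  next
    fix X Y assume "X \<in> ?c ` S" "Y \<in> carrier (klr_algebra n :: ('k, 'k klr_free set) module)"
    then obtain a b where ab: "a \<in> S" "X = ?c a" "b \<in> carrier (klr_free_algebra n)" "Y = ?c b"
      by (auto simp: klr_algebra_def F.quot_carrier)
    then show "Y \<otimes>\<^bsub>klr_algebra n\<^esub> X \<in> ?c ` S" "X \<otimes>\<^bsub>klr_algebra n\<^esub> Y \<in> ?c ` S"
      using S.I_l_closed[OF ab(1,3)] S.I_r_closed[OF ab(1,3)] by (simp_all add: c_mult)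
  qed
  have "cyc_ideal n \<subseteq> ?c ` S"
    unfolding cyc_ideal_def using y e n_pos
    by (intro klr.genideal_minimal[OF ideal]) (auto simp: klr_gen_class_def c_mult klr_free_closed)
  moreover have "?c p \<in> cyc_ideal n"
    using p(2) klr.quot_coset_eq_zero_iff[OF ideal_cyc_ideal[OF n_pos] klr_coset_closed[OF p(1)]]
    by (simp add: cyc_proj_def cyc_algebra_def)
  ultimately obtain s where s: "s \<in> S" "?c p = ?c s" by auto
  interpret K: ideal "klr_ideal n" "klr_free_algebra n :: ('k, 'k klr_free) module"
    by (rule ideal_klr_ideal)
  have "p \<in> ?c s" using s(2) K.a_rcos_self[OF p(1)] by simp
  then obtain h where "h \<in> klr_ideal n" "p = h + s" by (auto simp: a_r_coset_def')
  then show ?thesis using sub S.a_closed[of h s] s by auto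
qed

end
end

section \<open>Modules over the free algebra, and the product of all cyclotomic algebras\<close>

locale free_action = Vector_Spaces.vector_space sc
  for sc :: "'k::field \<Rightarrow> 'v::ab_group_add \<Rightarrow> 'v" +
  fixes h :: "'g \<Rightarrow> 'v \<Rightarrow> 'v"
  assumes h_add: "h g (x + y) = h g x + h g y"
    and h_scale: "h g (sc c x) = sc c (h g x)"
begin

definition act :: "('k, 'g) fpoly \<Rightarrow> 'v \<Rightarrow> 'v" where
  "act p v = (\<Sum>w \<in> Poly_Mapping.keys p. sc (Poly_Mapping.lookup p w) (foldr h (letters w) v))"

lemma act_superset:
  assumes "finite W" "Poly_Mapping.keys p \<subseteq> W"
  shows "act p v = (\<Sum>w \<in> W. sc (Poly_Mapping.lookup p w) (foldr h (letters w) v))"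
  unfolding act_def using assms by (intro sum.mono_neutral_left) (auto simp: in_keys_iff)

lemma act_zero_left [simp]: "act 0 v = 0"
  by (simp add: act_def)

lemma act_add_left [simp]: "act (p + q) v = act p v + act q v"
  using keys_add[of p q]
  by (simp add: act_superset[of "Poly_Mapping.keys p \<union> Poly_Mapping.keys q"] lookup_add
      scale_left_distrib sum.distrib)

lemma act_single: "act (Poly_Mapping.single w c) v = sc c (foldr h (letters w) v)"
  by (simp add: act_superset[of "{w}"])

lemma act_one [simp]: "act 1 v = v"
proof -
  have "act (Poly_Mapping.single 0 1) v = v" by (simp only: act_single) (simp add: zero_fword_def)
  then show ?thesis by simp
qed

lemma act_gen [simp]: "act (fgen g) v = h g v"
  by (simp add: fgen_def act_single)

lemma act_minus_left [simp]: "act (p - q) v = act p v - act q v"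
proof -
  have "act (p - q + q) v = act (p - q) v + act q v" by (rule act_add_left)
  then show ?thesis by simp
qed

lemma act_sum_left: "act (sum f I) v = (\<Sum>i\<in>I. act (f i) v)"
  by (induction I rule: infinite_finite_induct) auto

lemma foldr_h_add: "foldr h w (x + y) = foldr h w x + foldr h w y"
  by (induction w) (auto simp: h_add)

lemma foldr_h_scale: "foldr h w (sc c x) = sc c (foldr h w x)"
  by (induction w) (auto simp: h_scale)

lemma act_scale_right: "act p (sc c v) = sc c (act p v)"
  by (simp add: act_def foldr_h_scale scale_sum_right mult.commute)

lemma act_zero_right [simp]: "act p 0 = 0"
  using act_scale_right[of p 0 0] by simp

lemma act_mult [simp]: "act (p * q) v = act p (act q v)"
proof (induction p rule: poly_mapping_single_induct)
  case (add u c r)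
  have "act (Poly_Mapping.single u c * q) v = sc c (foldr h (letters u) (act q v))"
  proof (induction q rule: poly_mapping_single_induct)
    case zero
    have "foldr h (letters u) 0 = 0" using foldr_h_scale[of "letters u" 0 0] by simp
    then show ?case by simp
  next
    case (add w d r)
    then show ?case
      by (simp add: distrib_left mult_single act_single plus_fword_def foldr_h_add foldr_h_scale
          scale_right_distrib)
  qed
  then show ?case using add by (simp add: distrib_right act_single)
qed simp

lemma act_scalar [simp]: "act (Poly_Mapping.single 0 c) v = sc c v"
  by (simp only: act_single) (simp add: zero_fword_def)

lemma act_closed:
  assumes "p \<in> carrier (free_algebra X)" "v \<in> V"
    and "\<And>g v. g \<in> X \<Longrightarrow> v \<in> V \<Longrightarrow> h g v \<in> V"
    and "0 \<in> V" "\<And>v w. v \<in> V \<Longrightarrow> w \<in> V \<Longrightarrow> v + w \<in> V" "\<And>c v. v \<in> V \<Longrightarrow> sc c v \<in> V"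
  shows "act p v \<in> V"
  using assms(1) by (induction rule: free_algebra_induct) (use assms(2-) in auto)

end

text \<open>The operators are total functions on a type, so the relations are required only on a
  stable subspace \<open>V\<close>. This covers both uses: the projective modules and the left
  action on the elements fixed by the unit of the corner.\<close>

locale klr_action = free_action sc h
  for sc :: "'k::field \<Rightarrow> 'v::ab_group_add \<Rightarrow> 'v" and h :: "klr_gen \<Rightarrow> 'v \<Rightarrow> 'v" +
  fixes n :: nat and V :: "'v set"
  assumes n_pos: "0 < n"
    and V_zero: "0 \<in> V"
    and V_add: "v \<in> V \<Longrightarrow> w \<in> V \<Longrightarrow> v + w \<in> V"
    and V_scale: "v \<in> V \<Longrightarrow> sc c v \<in> V"
    and V_gen: "g \<in> klr_gens n \<Longrightarrow> v \<in> V \<Longrightarrow> h g v \<in> V"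
    and act_rel: "(a, b) \<in> klr_rels n \<Longrightarrow> v \<in> V \<Longrightarrow> act a v = act b v"
    and act_y: "i \<in> klr_seqs n \<Longrightarrow> entry i 1 = 0 \<Longrightarrow> v \<in> V \<Longrightarrow> h (GY 1) (h (GE i) v) = 0"
    and act_e: "i \<in> klr_seqs n \<Longrightarrow> entry i 1 \<noteq> 0 \<Longrightarrow> v \<in> V \<Longrightarrow> h (GE i) v = 0"
begin

lemma act_V: "p \<in> carrier (klr_free_algebra n) \<Longrightarrow> v \<in> V \<Longrightarrow> act p v \<in> V"
  by (rule act_closed) (auto intro: V_zero V_add V_scale V_gen)

text \<open>The annihilator of \<open>V\<close> is a two-sided ideal, on the right because
  \<open>V\<close> is stable, and it contains all relators; \<open>cyc_proj_kernel_minimal\<close>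
  applies to it.\<close>

lemma act_eq_zero:
  assumes p: "p \<in> carrier (klr_free_algebra n)" "cyc_proj n p = \<zero>\<^bsub>cyc_algebra n\<^esub>"
    and v: "v \<in> V"
  shows "act p v = 0"
proof -
  let ?S = "{p \<in> carrier (klr_free_algebra n). \<forall>v\<in>V. act p v = 0}"
  have "p \<in> ?S"
  proof (rule cyc_proj_kernel_minimal[OF n_pos _ _ _ _ p])
    interpret F: central_scalars "klr_free_algebra n :: ('k::field, 'k klr_free) module"
      by (rule central_scalars_free_algebra)
    show "ideal ?S (klr_free_algebra n)"
    proof (rule idealI)
      show "ring (klr_free_algebra n :: ('k::field, 'k klr_free) module)" by (rule F.ring_axioms)
      show "subgroup ?S (add_monoid (klr_free_algebra n))"
      proof (rule F.add.subgroupI)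
        show "\<ominus>\<^bsub>klr_free_algebra n\<^esub> a \<in> ?S" if a: "a \<in> ?S" for a
        proof -
          have "0 - a = \<ominus>\<^bsub>klr_free_algebra n\<^esub> a"
            using minus_free_algebra(1)[OF klr_free_closed(1)[where ?'k = 'k], of a] a
            by (simp add: a_minus_def)
          moreover have "0 - a \<in> ?S"
            using a klr_free_closed(4)[OF klr_free_closed(1), of a n] act_minus_left[of 0 a]
            by (simp del: diff_0)
          ultimately show ?thesis by simp
        qed
      qed (auto intro: klr_free_closed)
    qed (auto intro: klr_free_closed act_V)
  next
    fix a b :: "'k klr_free" assume ab: "(a, b) \<in> klr_rels n"
    then show "a - b \<in> ?S" using klr_rels_closed[OF ab] act_rel[OF ab] by (auto intro: klr_free_closed)
  next
    fix i assume "i \<in> klr_seqs n"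
    then show "entry i 1 = 0 \<Longrightarrow> fY 1 * fE i \<in> ?S" "entry i 1 \<noteq> 0 \<Longrightarrow> fE i \<in> ?S"
      using act_y[of i] act_e[of i] n_pos by (auto intro!: klr_free_closed)
  qed
  then show ?thesis using v by simp
qed

lemma act_cong:
  assumes "p \<in> carrier (klr_free_algebra n)" "q \<in> carrier (klr_free_algebra n)"
    "cyc_proj n p = cyc_proj n q" "v \<in> V"
  shows "act p v = act q v"
proof -
  interpret cyc: central_scalars "cyc_algebra n :: ('k::field, 'k cyc) module"
    by (rule central_scalars_cyc_algebra[OF n_pos])
  have c: "cyc_proj n q \<in> carrier (cyc_algebra n)" "cyc_proj n (p - q) \<in> carrier (cyc_algebra n)"
    using assms by (auto intro!: cyc_proj_closed[OF n_pos] klr_free_closed)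
  have "cyc_proj n (p - q + q) = cyc_proj n (p - q) \<oplus>\<^bsub>cyc_algebra n\<^esub> cyc_proj n q"
    using assms by (intro cyc_proj_hom[OF n_pos] klr_free_closed)
  then have "cyc_proj n (p - q) \<oplus>\<^bsub>cyc_algebra n\<^esub> cyc_proj n q = cyc_proj n q"
    using assms by simp
  then have "cyc_proj n (p - q) = \<zero>\<^bsub>cyc_algebra n\<^esub>"
    using c cyc.add.r_cancel_one[OF c(1,2)] by simp
  then have "act (p - q) v = 0"
    using assms by (intro act_eq_zero klr_free_closed)
  then show ?thesis by simp
qed

end

lemma ring_cyc_algebra: "0 < n \<Longrightarrow> ring (cyc_algebra n :: ('k::field, 'k cyc) module)"
  using central_scalars_cyc_algebra by (rule central_scalars.axioms)

lemmas cyc_algebra_simps = ring.ring_simprules[OF ring_cyc_algebra]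

text \<open>
  Components are shifted by one because \<open>cyc_algebra 0\<close> need not be a ring: its ideal is generated with
  the junk value \<open>[] ! 0\<close>. The product is an instance of \<^class>\<open>ring\<close>, so that computations in
  all algebras \<open>R\<^sub>n\<close> can be done with equations between elements of one type.
\<close>

typedef (overloaded) ('k::field) cyc_prod =
  "{f :: nat \<Rightarrow> 'k cyc. \<forall>n. f n \<in> carrier (cyc_algebra (Suc n))}"
proof (intro exI CollectI allI)
  show "\<zero>\<^bsub>cyc_algebra (Suc n)\<^esub> \<in> carrier (cyc_algebra (Suc n) :: ('k::field, 'k cyc) module)" for n
    by (simp add: cyc_algebra_simps)
qed

definition component :: "nat \<Rightarrow> 'k::field cyc_prod \<Rightarrow> 'k cyc" where
  "component n x = Rep_cyc_prod x (n - 1)"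

definition of_components :: "(nat \<Rightarrow> 'k cyc) \<Rightarrow> 'k::field cyc_prod" where
  "of_components f = Abs_cyc_prod (\<lambda>n. f (Suc n))"

lemma component_closed: "0 < n \<Longrightarrow> component n x \<in> carrier (cyc_algebra n)"
  using Rep_cyc_prod[of x] unfolding component_def by (cases n) auto

lemma component_of_components:
  assumes "\<And>n. 0 < n \<Longrightarrow> f n \<in> carrier (cyc_algebra n)" "0 < n"
  shows "component n (of_components f) = f n"
  using assms by (simp add: component_def of_components_def Abs_cyc_prod_inverse)

lemma cyc_prod_eqI: "(\<And>n. 0 < n \<Longrightarrow> component n x = component n y) \<Longrightarrow> x = y"
  unfolding component_def by (metis Rep_cyc_prod_inject diff_Suc_1 ext zero_less_Suc)

instantiation cyc_prod :: (field) ring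
begin

definition "0 = of_components (\<lambda>n. \<zero>\<^bsub>cyc_algebra n\<^esub>)"
definition "x + y = of_components (\<lambda>n. component n x \<oplus>\<^bsub>cyc_algebra n\<^esub> component n y)"
definition "x - y = of_components (\<lambda>n. component n x \<ominus>\<^bsub>cyc_algebra n\<^esub> component n y)"
definition "- x = of_components (\<lambda>n. \<ominus>\<^bsub>cyc_algebra n\<^esub> component n x)"
definition "x * y = of_components (\<lambda>n. component n x \<otimes>\<^bsub>cyc_algebra n\<^esub> component n y)"

lemma component_simps:
  assumes n: "0 < n"
  shows "component n (0 :: 'a::field cyc_prod) = \<zero>\<^bsub>cyc_algebra n\<^esub>"
    "component n (x + y :: 'a::field cyc_prod) = component n x \<oplus>\<^bsub>cyc_algebra n\<^esub> component n y"
    "component n (x - y :: 'a::field cyc_prod) = component n x \<ominus>\<^bsub>cyc_algebra n\<^esub> component n y"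
    "component n (- x :: 'a::field cyc_prod) = \<ominus>\<^bsub>cyc_algebra n\<^esub> component n x"
    "component n (x * y :: 'a::field cyc_prod) = component n x \<otimes>\<^bsub>cyc_algebra n\<^esub> component n y"
proof -
  show "component n (0 :: 'a::field cyc_prod) = \<zero>\<^bsub>cyc_algebra n\<^esub>"
    "component n (x + y :: 'a::field cyc_prod) = component n x \<oplus>\<^bsub>cyc_algebra n\<^esub> component n y"
    "component n (x - y :: 'a::field cyc_prod) = component n x \<ominus>\<^bsub>cyc_algebra n\<^esub> component n y"
    "component n (- x :: 'a::field cyc_prod) = \<ominus>\<^bsub>cyc_algebra n\<^esub> component n x"
    "component n (x * y :: 'a::field cyc_prod) = component n x \<otimes>\<^bsub>cyc_algebra n\<^esub> component n y"
    unfolding zero_cyc_prod_def plus_cyc_prod_def minus_cyc_prod_def uminus_cyc_prod_def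
      times_cyc_prod_def
    by (subst component_of_components; simp add: n cyc_algebra_simps component_closed)+
qed

instance
proof
  fix a b c :: "'a cyc_prod"
  show "a * b * c = a * (b * c)" "a + b + c = a + (b + c)" "a + b = b + a" "0 + a = a"
    "- a + a = 0" "a - b = a + - b" "(a + b) * c = a * c + b * c" "a * (b + c) = a * b + a * c"
    by (rule cyc_prod_eqI; simp add: component_simps; simp add: cyc_algebra_simps component_closed)+
qed

end

definition cyc_scale :: "'k \<Rightarrow> 'k::field cyc_prod \<Rightarrow> 'k cyc_prod" where
  "cyc_scale c x = of_components (\<lambda>n. c \<odot>\<^bsub>cyc_algebra n\<^esub> component n x)"

lemma component_cyc_scale:
  assumes "0 < n"
  shows "component n (cyc_scale c x) = c \<odot>\<^bsub>cyc_algebra n\<^esub> component n x"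
  unfolding cyc_scale_def
  by (subst component_of_components) (auto intro: central_scalars.smult_closed[OF central_scalars_cyc_algebra] component_closed assms)

lemma vector_space_cyc_scale: "Vector_Spaces.vector_space cyc_scale"
proof
  fix a b and x y :: "'a cyc_prod"
  note cs = central_scalars_cyc_algebra
  show "cyc_scale a (x + y) = cyc_scale a x + cyc_scale a y"
    by (rule cyc_prod_eqI)
      (simp add: component_simps component_cyc_scale central_scalars.smult_add_right[OF cs] component_closed)
  show "cyc_scale (a + b) x = cyc_scale a x + cyc_scale b x"
    by (rule cyc_prod_eqI)
      (simp add: component_simps component_cyc_scale central_scalars.smult_add_left[OF cs] component_closed)
  show "cyc_scale a (cyc_scale b x) = cyc_scale (a * b) x"
    by (rule cyc_prod_eqI)
      (simp add: component_simps component_cyc_scale central_scalars.smult_smult[OF cs] component_closed)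
  show "cyc_scale 1 x = x"
    by (rule cyc_prod_eqI)
      (simp add: component_simps component_cyc_scale central_scalars.one_smult[OF cs] component_closed)
qed

lemma cyc_scale_mult_left: "cyc_scale c x * y = cyc_scale c (x * y)"
  by (rule cyc_prod_eqI)
    (simp add: component_simps component_cyc_scale component_closed
      central_scalars.smult_mult_left[OF central_scalars_cyc_algebra])

lemma cyc_scale_mult_right: "x * cyc_scale c y = cyc_scale c (x * y)"
  by (rule cyc_prod_eqI)
    (simp add: component_simps component_cyc_scale component_closed
      central_scalars.smult_mult_right[OF central_scalars_cyc_algebra])

definition cyc_in :: "nat \<Rightarrow> 'k cyc \<Rightarrow> 'k::field cyc_prod" where
  "cyc_in n x = of_components (\<lambda>m. if m = n then x else \<zero>\<^bsub>cyc_algebra m\<^esub>)"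

lemma component_cyc_in:
  assumes "x \<in> carrier (cyc_algebra n)" "0 < m"
  shows "component m (cyc_in n x) = (if m = n then x else \<zero>\<^bsub>cyc_algebra m\<^esub>)"
proof -
  show ?thesis
    unfolding cyc_in_def using assms
    by (subst component_of_components) (auto simp: cyc_algebra_simps)
qed

lemma cyc_in_hom:
  fixes x y :: "'k::field cyc"
  assumes "0 < n" "x \<in> carrier (cyc_algebra n)" "y \<in> carrier (cyc_algebra n)"
  shows "cyc_in n (x \<oplus>\<^bsub>cyc_algebra n\<^esub> y) = cyc_in n x + cyc_in n y"
    "cyc_in n (x \<otimes>\<^bsub>cyc_algebra n\<^esub> y) = cyc_in n x * cyc_in n y"
    "cyc_in n (c \<odot>\<^bsub>cyc_algebra n\<^esub> x) = cyc_scale c (cyc_in n x)"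
    "cyc_in n \<zero>\<^bsub>cyc_algebra n\<^esub> = (0 :: 'k cyc_prod)"
proof -
  note cs = central_scalars_cyc_algebra
  have zero: "c \<odot>\<^bsub>cyc_algebra m\<^esub> \<zero>\<^bsub>cyc_algebra m\<^esub> = \<zero>\<^bsub>cyc_algebra m\<^esub>" if "0 < m" for m and c :: 'k
    using central_scalars.smult_eq[OF cs[OF that], of "\<zero>\<^bsub>cyc_algebra m\<^esub>" c] that
    by (simp add: cyc_algebra_simps central_scalars.smult_one_closed[OF cs])
  note [simp] = component_simps component_cyc_scale component_cyc_in cyc_algebra_simps
    central_scalars.smult_closed[OF cs] zero assms
  show "cyc_in n (x \<oplus>\<^bsub>cyc_algebra n\<^esub> y) = cyc_in n x + cyc_in n y"
    "cyc_in n (x \<otimes>\<^bsub>cyc_algebra n\<^esub> y) = cyc_in n x * cyc_in n y"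
    "cyc_in n (c \<odot>\<^bsub>cyc_algebra n\<^esub> x) = cyc_scale c (cyc_in n x)"
    "cyc_in n \<zero>\<^bsub>cyc_algebra n\<^esub> = (0 :: 'k cyc_prod)"
    by (rule cyc_prod_eqI; simp)+
qed

section \<open>Residue sequences of hooks\<close>

lemma klr_seqs_nth:
  assumes "i \<in> klr_seqs n"
  shows "length i = n" "\<And>m. m < n \<Longrightarrow> i ! m < n"
    "\<And>l m. l < n \<Longrightarrow> m < n \<Longrightarrow> i ! l = i ! m \<longleftrightarrow> l = m"
    "\<And>v. v < n \<Longrightarrow> \<exists>m<n. i ! m = v"
proof -
  have i: "set i = {0..<n}" "distinct i" using assms by (auto simp: klr_seqs_def permutations_of_set_def)
  show len: "length i = n" using assms by (rule length_klr_seqs)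
  show "i ! m < n" if "m < n" for m using i(1) that nth_mem[of m i] by (simp add: len)
  show "i ! l = i ! m \<longleftrightarrow> l = m" if "l < n" "m < n" for l m
    using that by (simp add: len nth_eq_iff_index_eq[OF i(2)])
  show "\<exists>m<n. i ! m = v" if "v < n" for v
    using that i(1) by (metis atLeast0LessThan in_set_conv_nth len lessThan_iff)
qed

lemma klr_seqsI:
  assumes "length i = n" "\<And>m. m < n \<Longrightarrow> i ! m < n" "\<And>l m. l < m \<Longrightarrow> m < n \<Longrightarrow> i ! l \<noteq> i ! m"
  shows "i \<in> klr_seqs n"
proof -
  have d: "distinct i" using assms by (metis distinct_conv_nth linorder_neqE_nat)
  moreover have sub: "set i \<subseteq> {0..<n}" using assms(1,2) by (auto simp: in_set_conv_nth)
  moreover have "card (set i) = card {0..<n}" using d assms(1) by (simp add: distinct_card)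
  ultimately show ?thesis
    using card_subset_eq[OF _ sub] by (simp add: klr_seqs_def permutations_of_set_def)
qed

lemma length_swap_at [simp]: "length (swap_at k i) = length i"
  by (simp add: swap_at_def)

lemma nth_swap_at:
  "0 < k \<Longrightarrow> k < length i \<Longrightarrow> m < length i \<Longrightarrow>
    swap_at k i ! m = i ! (if m = k - 1 then k else if m = k then k - 1 else m)"
  by (simp add: swap_at_def nth_list_update)

lemma nth_swap_at_Suc:
  "Suc k < length i \<Longrightarrow> m < length i \<Longrightarrow>
    swap_at (Suc k) i ! m = (if m = k then i ! Suc k else if m = Suc k then i ! k else i ! m)"
  by (simp add: nth_swap_at)

lemma swap_at_swap_at:
  assumes "0 < k" "k < length i"
  shows "swap_at k (swap_at k i) = i"
proof -
  obtain k' where k: "k = Suc k'" using assms(1) gr0_implies_Suc by blast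
  show ?thesis
    using assms(2) unfolding k by (intro nth_equalityI) (simp_all add: nth_swap_at_Suc)
qed

lemma swap_at_commute:
  assumes "0 < k" "Suc k < l" "l < length i"
  shows "swap_at k (swap_at l i) = swap_at l (swap_at k i)"
proof -
  obtain k' l' where k: "k = Suc k'" "l = Suc l'" using assms gr0_implies_Suc by (metis Suc_lessE)
  have d: "k' < l'" "Suc k' < l'" "l' < length i" "Suc l' < length i" "k' < length i" "Suc k' < length i"
    using assms unfolding k by auto
  show ?thesis
  proof (rule nth_equalityI)
    fix m assume "m < length (swap_at k (swap_at l i))"
    then have m: "m < length i" by simp
    consider "m = k'" | "m = Suc k'" | "m = l'" | "m = Suc l'"
      | "m \<noteq> k'" "m \<noteq> Suc k'" "m \<noteq> l'" "m \<noteq> Suc l'" by auto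
    then show "swap_at k (swap_at l i) ! m = swap_at l (swap_at k i) ! m"
      unfolding k by cases (use d m in \<open>simp_all add: nth_swap_at_Suc\<close>)
  qed simp
qed

lemma swap_at_braid:
  assumes "0 < k" "Suc k < length i"
  shows "swap_at k (swap_at (Suc k) (swap_at k i)) = swap_at (Suc k) (swap_at k (swap_at (Suc k) i))"
proof -
  obtain k' where k: "k = Suc k'" using assms(1) gr0_implies_Suc by blast
  show ?thesis
    using assms(2) unfolding k
    by (intro nth_equalityI) (simp_all add: nth_swap_at_Suc)
qed

text \<open>Entries below \<open>p\<close> form the arm, entries above \<open>p\<close> the leg. The
  shuffle is expressed by order conditions on pairs of positions, so that an adjacent swap disturbs
  a single pair.\<close>

definition adm :: "nat \<Rightarrow> nat \<Rightarrow> nat list \<Rightarrow> bool" where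
  "adm n p i \<longleftrightarrow> i \<in> klr_seqs n \<and> i ! 0 = 0 \<and> i ! (n - 1) = p \<and>
     (\<forall>l m. l < m \<longrightarrow> m < n \<longrightarrow>
        (i ! l < p \<longrightarrow> i ! m < p \<longrightarrow> i ! l < i ! m) \<and> (p < i ! l \<longrightarrow> p < i ! m \<longrightarrow> i ! m < i ! l))"

lemma admD:
  assumes "adm n p i"
  shows "i \<in> klr_seqs n" "i ! 0 = 0" "i ! (n - 1) = p"
    "\<And>l m. l < m \<Longrightarrow> m < n \<Longrightarrow> i ! l < p \<Longrightarrow> i ! m < p \<Longrightarrow> i ! l < i ! m"
    "\<And>l m. l < m \<Longrightarrow> m < n \<Longrightarrow> p < i ! l \<Longrightarrow> p < i ! m \<Longrightarrow> i ! m < i ! l"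
  using assms unfolding adm_def by auto

lemma adm_length: "adm n p i \<Longrightarrow> length i = n"
  using admD(1) length_klr_seqs by blast

lemma adm_bounds:
  assumes "adm n p i" "1 < n"
  shows "0 < p" "p < n"
proof -
  note s = klr_seqs_nth[OF admD(1)[OF assms(1)]]
  show "p < n" using s(2)[of "n - 1"] admD(3)[OF assms(1)] assms(2) by simp
  show "0 < p" using s(3)[of 0 "n - 1"] admD(2,3)[OF assms(1)] assms(2) by (metis diff_less gr0I less_numeral_extra(1) less_trans zero_less_diff less_imp_neq)
qed

lemma adm_unique: "adm n p i \<Longrightarrow> adm n q i \<Longrightarrow> p = q"
  by (auto simp: adm_def)

lemma adm_side:
  assumes "adm n p i" "m < n - 1"
  shows "i ! m < p \<or> p < i ! m"
  using klr_seqs_nth(3)[OF admD(1)[OF assms(1)], of m "n - 1"] admD(3)[OF assms(1)] assms(2) by auto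

text \<open>An adjacent swap before the last place is harmless exactly when it exchanges an arm
  entry with a leg entry; \<open>1 < k\<close> keeps the entry 0 in front.\<close>

lemma adm_swap_iff:
  assumes a: "adm n p i" and k: "0 < k" "k < n - 1"
  shows "adm n p (swap_at k i) \<longleftrightarrow>
    1 < k \<and> (i ! (k - 1) < p \<and> p < i ! k \<or> p < i ! (k - 1) \<and> i ! k < p)"
proof
  note len = adm_length[OF a]
  have sw: "swap_at k i ! m = i ! (if m = k - 1 then k else if m = k then k - 1 else m)" if "m < n" for m
    using k that by (intro nth_swap_at) (auto simp: len)
  have sk: "swap_at k i ! (k - 1) = i ! k" "swap_at k i ! k = i ! (k - 1)"
    using k sw[of "k - 1"] sw[of k] by (simp_all split: if_splits)
  { assume b: "adm n p (swap_at k i)"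
    have k1: "1 < k"
    proof (rule ccontr)
      assume "\<not> 1 < k"
      then have "i ! k = i ! 0" using admD(2)[OF b] admD(2)[OF a] sw[of 0] k by simp
      then show False using klr_seqs_nth(3)[OF admD(1)[OF a], of k 0] k by simp
    qed
    have kn: "k - 1 < k" "k < n" and kn': "k - 1 < n - 1" using k by auto
    have nb: "\<not> (i ! (k - 1) < p \<and> i ! k < p)" "\<not> (p < i ! (k - 1) \<and> p < i ! k)"
      using admD(4,5)[OF a kn] admD(4,5)[OF b kn] unfolding sk by auto
    from k1 nb show "1 < k \<and> (i ! (k - 1) < p \<and> p < i ! k \<or> p < i ! (k - 1) \<and> i ! k < p)"
      using adm_side[OF a k(2)] adm_side[OF a kn'] by auto }
  { assume b: "1 < k \<and> (i ! (k - 1) < p \<and> p < i ! k \<or> p < i ! (k - 1) \<and> i ! k < p)"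
    show "adm n p (swap_at k i)"
      unfolding adm_def
    proof (intro conjI allI impI)
      show "swap_at k i \<in> klr_seqs n"
        using k by (intro swap_at_klr_seqs admD(1)[OF a]) auto
      show "swap_at k i ! 0 = 0" "swap_at k i ! (n - 1) = p"
        using b k admD(2,3)[OF a] by (auto simp: sw)
      fix l m assume lm: "l < m" "m < n"
      \<comment> \<open>\<open>t\<close> is the transposition of list indices; it preserves the
        order of every pair except \<open>(k - 1, k)\<close>.\<close>
      define t where "t = (\<lambda>m. if m = k - 1 then k else if m = k then k - 1 else m)"
      have t: "t l < t m \<or> (l = k - 1 \<and> m = k)" "t m < n"
        using lm k unfolding t_def by (cases "m = k"; cases "l = k"; linarith | simp)+
      have s: "swap_at k i ! l = i ! t l" "swap_at k i ! m = i ! t m"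
        using lm by (auto simp: sw t_def)
      show "swap_at k i ! l < swap_at k i ! m" if "swap_at k i ! l < p" "swap_at k i ! m < p"
        using t(1)
      proof
        assume "t l < t m"
        then show ?thesis using that t(2) unfolding s by (intro admD(4)[OF a])
      qed (use that b sk in auto)
      show "swap_at k i ! m < swap_at k i ! l" if "p < swap_at k i ! l" "p < swap_at k i ! m"
        using t(1)
      proof
        assume "t l < t m"
        then show ?thesis using that t(2) unfolding s by (intro admD(5)[OF a])
      qed (use that b sk in auto)
    qed }
qed

text \<open>The neighbour of \<open>p\<close> on the side of the entry before it must occur earlier
  than \<open>p\<close>, and monotonicity of that chain pushes it to index \<open>n - 2\<close>.
  Exchanging the two appends \<open>p\<close> to the opposite chain and removes its neighbour from
  its own.\<close>

lemma adm_swap_last: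
  assumes a: "adm n p i" and n: "2 < n"
  shows "adm n (i ! (n - 2)) (swap_at (n - 1) i)" "Suc (i ! (n - 2)) = p \<or> i ! (n - 2) = Suc p"
proof -
  let ?x = "i ! (n - 2)"
  note len = adm_length[OF a] and s = klr_seqs_nth[OF admD(1)[OF a]]
  have sw: "swap_at (n - 1) i ! m = (if m = n - 2 then p else if m = n - 1 then ?x else i ! m)" if "m < n" for m
    using n that admD(3)[OF a] by (subst nth_swap_at) (auto simp: len numeral_2_eq_2)
  have px: "?x \<noteq> 0" using s(3)[of "n - 2" 0] admD(2)[OF a] n by simp
  have xn: "?x < n" using s(2)[of "n - 2"] n by simp
  have adj: "Suc ?x = p \<or> ?x = Suc p"
  proof (cases "?x < p")
    case True
    have "p - 1 < n" using adm_bounds[OF a] n by simp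
    then obtain m where m: "m < n" "i ! m = p - 1" using s(4) by blast
    then have "m < n - 1" using admD(3)[OF a] True by (cases "m = n - 1") auto
    then have "m = n - 2 \<or> m < n - 2" by auto
    then show ?thesis
      using admD(4)[OF a, of m "n - 2"] m True n by auto
  next
    case False
    then have gt: "p < ?x" using adm_side[OF a, of "n - 2"] n by auto
    then have "Suc p < n" using xn by simp
    then obtain m where m: "m < n" "i ! m = Suc p" using s(4) by blast
    then have "m < n - 1" using admD(3)[OF a] by (cases "m = n - 1") auto
    then have "m = n - 2 \<or> m < n - 2" by auto
    then show ?thesis
      using admD(5)[OF a, of m "n - 2"] m gt n by auto
  qed
  then show "Suc ?x = p \<or> ?x = Suc p" .
  show "adm n ?x (swap_at (n - 1) i)"
    unfolding adm_def
  proof (intro conjI allI impI)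
    show "swap_at (n - 1) i \<in> klr_seqs n"
      using n by (intro swap_at_klr_seqs admD(1)[OF a]) auto
    show "swap_at (n - 1) i ! 0 = 0" "swap_at (n - 1) i ! (n - 1) = ?x"
      using n admD(2)[OF a] by (auto simp: sw simp del: One_nat_def)
    fix l m assume lm: "l < m" "m < n"
    have side: "i ! l < ?x \<longleftrightarrow> i ! l < p" "?x < i ! l \<longleftrightarrow> p < i ! l" if "l < n - 2" for l
    proof -
      have "i ! l \<noteq> p" "i ! l \<noteq> ?x"
        using s(3)[of l "n - 1"] s(3)[of l "n - 2"] that n admD(3)[OF a] by auto
      then show "i ! l < ?x \<longleftrightarrow> i ! l < p" "?x < i ! l \<longleftrightarrow> p < i ! l" using adj by linarith+
    qed
    have ord: "(i ! l < p \<longrightarrow> i ! m < p \<longrightarrow> i ! l < i ! m) \<and> (p < i ! l \<longrightarrow> p < i ! m \<longrightarrow> i ! m < i ! l)"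
      using admD(4,5)[OF a lm] by auto
    consider "m < n - 2" | "m = n - 2" | "m = n - 1" using lm n by linarith
    then have "(swap_at (n - 1) i ! l < ?x \<longrightarrow> swap_at (n - 1) i ! m < ?x \<longrightarrow> swap_at (n - 1) i ! l < swap_at (n - 1) i ! m) \<and>
       (?x < swap_at (n - 1) i ! l \<longrightarrow> ?x < swap_at (n - 1) i ! m \<longrightarrow> swap_at (n - 1) i ! m < swap_at (n - 1) i ! l)"
    proof cases
      case 1
      then have "swap_at (n - 1) i ! l = i ! l" "swap_at (n - 1) i ! m = i ! m"
        using lm by (simp_all add: sw del: One_nat_def)
      then show ?thesis using ord side 1 lm by simp
    next
      case 2
      then have "swap_at (n - 1) i ! l = i ! l" "swap_at (n - 1) i ! m = p"
        using lm n by (simp_all add: sw del: One_nat_def)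
      then show ?thesis using side[of l] 2 lm by simp
    next
      case 3
      have "swap_at (n - 1) i ! m = ?x" unfolding 3 using n by (subst sw) (auto simp del: One_nat_def)
      then show ?thesis by simp
    qed
    then show "swap_at (n - 1) i ! l < ?x \<Longrightarrow> swap_at (n - 1) i ! m < ?x \<Longrightarrow> swap_at (n - 1) i ! l < swap_at (n - 1) i ! m"
      "?x < swap_at (n - 1) i ! l \<Longrightarrow> ?x < swap_at (n - 1) i ! m \<Longrightarrow> swap_at (n - 1) i ! m < swap_at (n - 1) i ! l"
      by auto
  qed
qed

section \<open>Prefixes as arcs of the cyclic quiver\<close>

definition nbr :: "nat \<Rightarrow> nat \<Rightarrow> nat \<Rightarrow> bool" where
  "nbr n x y \<longleftrightarrow> arrow n x y \<or> arrow n y x"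

text \<open>Each new residue is joined to an earlier one, so the residues seen so far form an arc
  around 0: up to \<open>a\<close> on one side, and the last \<open>b\<close> residues on the other.
  A new residue extends one of the two ends.\<close>

lemma prefix_interval:
  assumes i: "i \<in> klr_seqs n" "i ! 0 = 0" and k: "0 < k" "k \<le> n"
    and nb: "\<And>m. 0 < m \<Longrightarrow> m < k \<Longrightarrow> \<exists>l<m. nbr n (i ! l) (i ! m)"
  shows "\<exists>a b. Suc (a + b) = k \<and> (\<forall>v<n. (\<exists>m<k. i ! m = v) \<longleftrightarrow> v \<le> a \<or> n - b \<le> v)"
  using k nb
proof (induction k)
  case (Suc k)
  note s = klr_seqs_nth[OF i(1)]
  show ?case
  proof (cases "k = 0")
    case True
    then show ?thesis using i(2) by (intro exI[of _ 0]) auto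
  next
    case False
    then obtain a b where ab: "Suc (a + b) = k" and pre: "\<And>v. v < n \<Longrightarrow> (\<exists>m<k. i ! m = v) \<longleftrightarrow> v \<le> a \<or> n - b \<le> v"
      using Suc by auto
    let ?x = "i ! k"
    have x: "?x < n" using s(2)[of k] Suc.prems(2) by simp
    have nx: "a < ?x" "?x < n - b"
      using pre[OF x] s(3)[of _ k] Suc.prems(2) by auto
    obtain l where l: "l < k" "nbr n (i ! l) ?x" using Suc.prems(3)[of k] False by auto
    have yl: "i ! l < n" using s(2)[of l] l Suc.prems(2) by simp
    then have y: "i ! l \<le> a \<or> n - b \<le> i ! l" using pre[OF yl] l(1) by auto
    have "?x = Suc a \<or> Suc ?x = n - b"
      using l(2) nx x yl y unfolding nbr_def arrow_def by auto
    then show ?thesis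
    proof
      assume e: "?x = Suc a"
      show ?thesis
      proof (rule exI[of _ "Suc a"], rule exI[of _ b], intro conjI allI impI)
        show "Suc (Suc a + b) = Suc k" using ab by simp
        show "(\<exists>m<Suc k. i ! m = v) \<longleftrightarrow> v \<le> Suc a \<or> n - b \<le> v" if "v < n" for v
          using pre[OF that] e by (auto simp: less_Suc_eq)
      qed
    next
      assume e: "Suc ?x = n - b"
      show ?thesis
      proof (rule exI[of _ a], rule exI[of _ "Suc b"], intro conjI allI impI)
        show "Suc (a + Suc b) = Suc k" using ab by simp
        show "(\<exists>m<Suc k. i ! m = v) \<longleftrightarrow> v \<le> a \<or> n - Suc b \<le> v" if "v < n" for v
          using pre[OF that] e by (auto simp: less_Suc_eq)
      qed
    qed
  qed
qed simp

text \<open>For \<open>l < m\<close>, the arc formed by the first \<open>m\<close> entries contains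
  \<open>i ! l\<close> but neither \<open>i ! m\<close> nor the last entry. Hence an earlier entry
  below the last one is at most \<open>a\<close>, and \<open>i ! m\<close> exceeds \<open>a\<close>;
  the leg is symmetric.\<close>

lemma adm_of_prefix:
  assumes i: "i \<in> klr_seqs n" "i ! 0 = 0" and n: "0 < n"
    and nb: "\<And>m. 0 < m \<Longrightarrow> m < n \<Longrightarrow> \<exists>l<m. nbr n (i ! l) (i ! m)"
  shows "adm n (i ! (n - 1)) i"
  unfolding adm_def
proof (intro conjI allI impI)
  note s = klr_seqs_nth[OF i(1)]
  let ?p = "i ! (n - 1)"
  fix l m assume lm: "l < m" "m < n"
  obtain a b where ab: "Suc (a + b) = m" and pre: "\<And>v. v < n \<Longrightarrow> (\<exists>l<m. i ! l = v) \<longleftrightarrow> v \<le> a \<or> n - b \<le> v"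
    using prefix_interval[OF i, of m] lm nb by auto
  have b: "i ! l < n" "i ! m < n" "?p < n" using s(2) lm by auto
  have 1: "i ! l \<le> a \<or> n - b \<le> i ! l" using pre[of "i ! l"] b lm by auto
  have 2: "a < i ! m" "i ! m < n - b" using pre[of "i ! m"] b lm s(3)[of _ m] by auto
  have 3: "a < ?p" "?p < n - b" using pre[of ?p] b lm s(3)[of _ "n - 1"] by auto
  show "i ! l < i ! m" if "i ! l < ?p" "i ! m < ?p" using 1 2 3 that by auto
  show "i ! m < i ! l" if "?p < i ! l" "?p < i ! m" using 1 2 3 that by auto
qed (use i in auto)

text \<open>\<open>Suc k < n\<close> leaves at least two residues outside the arc, so the new one
  cannot touch both of its ends.\<close>

lemma prefix_nbr_unique:
  assumes i: "i \<in> klr_seqs n" "i ! 0 = 0" and k: "0 < k" "Suc k < n"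
    and nb: "\<And>m. 0 < m \<Longrightarrow> m < k \<Longrightarrow> \<exists>l<m. nbr n (i ! l) (i ! m)"
    and l: "l < k" "nbr n (i ! l) (i ! k)" and l': "l' < k" "nbr n (i ! l') (i ! k)"
  shows "l = l'"
proof -
  note s = klr_seqs_nth[OF i(1)]
  obtain a b where ab: "Suc (a + b) = k" and pre: "\<And>v. v < n \<Longrightarrow> (\<exists>l<k. i ! l = v) \<longleftrightarrow> v \<le> a \<or> n - b \<le> v"
    using prefix_interval[OF i, of k] k nb by auto
  have b: "i ! l < n" "i ! k < n" "i ! l' < n" using s(2) k l l' by auto
  have 1: "i ! l \<le> a \<or> n - b \<le> i ! l" using pre[of "i ! l"] b l by auto
  have 2: "i ! l' \<le> a \<or> n - b \<le> i ! l'" using pre[of "i ! l'"] b l' by auto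
  have 3: "a < i ! k" "i ! k < n - b" using pre[of "i ! k"] b k s(3)[of _ k] by auto
  have "i ! l = i ! l'"
    using l(2) l'(2) 1 2 3 b ab k unfolding nbr_def arrow_def by auto
  then show ?thesis using s(3)[of l l'] l l' k by simp
qed

section \<open>Descents and the chosen sequences\<close>

definition desc :: "nat \<Rightarrow> nat \<Rightarrow> nat list \<Rightarrow> nat \<Rightarrow> bool" where
  "desc n p i k \<longleftrightarrow> 0 < k \<and> k < n - 1 \<and> p < i ! (k - 1) \<and> i ! k < p"

text \<open>The termination measure for sorting: earlier positions have larger coefficients, so
  moving a large entry to the right lowers it.\<close>

definition weight :: "nat list \<Rightarrow> nat" where
  "weight i = (\<Sum>m<length i. (length i - m) * i ! m)"

lemma weight_swap:
  assumes "0 < k" "k < length i" "i ! k < i ! (k - 1)"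
  shows "weight (swap_at k i) < weight i"
proof -
  let ?n = "length i"
  have split: "sum f {..<?n} = f (k - 1) + (f k + sum f ({..<?n} - {k - 1, k}))" for f :: "nat \<Rightarrow> nat"
  proof -
    have "{..<?n} - {k - 1, k} = {..<?n} - {k - 1} - {k}" by auto
    then show ?thesis
      using assms sum.remove[of "{..<?n}" "k - 1" f] sum.remove[of "{..<?n} - {k - 1}" k f] by simp
  qed
  define r where "r = (\<Sum>m\<in>{..<?n} - {k - 1, k}. (?n - m) * i ! m)"
  have r': "(\<Sum>m\<in>{..<?n} - {k - 1, k}. (?n - m) * swap_at k i ! m) = r"
    unfolding r_def using assms by (intro sum.cong) (auto simp: nth_swap_at)
  have w1: "weight i = (?n - (k - 1)) * i ! (k - 1) + ((?n - k) * i ! k + r)"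
    unfolding weight_def split r_def ..
  have w2: "weight (swap_at k i) = (?n - (k - 1)) * i ! k + ((?n - k) * i ! (k - 1) + r)"
    unfolding weight_def length_swap_at split r' using assms by (simp add: nth_swap_at)
  have "?n - (k - 1) = Suc (?n - k)" using assms by simp
  then show ?thesis unfolding w1 w2 using assms(3) by simp
qed

lemma adm_desc:
  assumes "adm n p i" "desc n p i k"
  shows "adm n p (swap_at k i)" "weight (swap_at k i) < weight i" "1 < k"
proof -
  have "1 < k"
  proof (rule ccontr)
    assume "\<not> 1 < k"
    then show False using assms admD(2)[OF assms(1)] unfolding desc_def by (auto simp: not_less le_Suc_eq)
  qed
  then show "1 < k" "adm n p (swap_at k i)"
    using assms adm_swap_iff[OF assms(1), of k] by (auto simp: desc_def)
  show "weight (swap_at k i) < weight i"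
    using assms adm_length[OF assms(1)] by (intro weight_swap) (auto simp: desc_def)
qed

lemma adm_swap_desc:
  assumes "adm n p i" "0 < k" "k < n - 1" "adm n p (swap_at k i)"
  shows "desc n p i k \<or> desc n p (swap_at k i) k"
  using assms adm_swap_iff[OF assms(1-3)] adm_length[OF assms(1)]
  by (auto simp: desc_def nth_swap_at)

text \<open>The sequence \<open>c_p\<close> of the overview, with the whole arm before the whole
  leg; \<open>adm_no_desc\<close> characterises it by the absence of descents.\<close>

definition base_seq :: "nat \<Rightarrow> nat \<Rightarrow> nat list" where
  "base_seq n p = [0..<p] @ rev [Suc p..<n] @ [p]"

lemma length_base_seq: "p < n \<Longrightarrow> length (base_seq n p) = n"
  by (simp add: base_seq_def)

lemma nth_base_seq:
  assumes "p < n" "m < n"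
  shows "base_seq n p ! m = (if m < p then m else if m < n - 1 then n - 1 - (m - p) else p)"
proof -
  have "rev [Suc p..<n] ! (m - p) = n - 1 - (m - p)" if "p \<le> m" "m < n - 1"
    using that by (subst rev_nth) auto
  moreover have "[p] ! (m - p - (n - Suc p)) = p" if "\<not> m < n - 1"
  proof -
    have "m - p - (n - Suc p) = 0" using that assms by auto
    then show ?thesis by simp
  qed
  ultimately show ?thesis using assms by (auto simp: base_seq_def nth_append)
qed

lemma base_seq_klr_seqs:
  assumes "p < n"
  shows "base_seq n p \<in> klr_seqs n"
  using assms by (intro klr_seqsI) (auto simp: length_base_seq nth_base_seq)

lemma adm_base_seq:
  assumes "0 < p" "p < n"
  shows "adm n p (base_seq n p)"
  unfolding adm_def using assms base_seq_klr_seqs[OF assms(2)]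
  by (auto simp: nth_base_seq split: if_splits)

lemma adm_no_desc:
  assumes a: "adm n p i" and n: "1 < n" and d: "\<And>k. \<not> desc n p i k"
  shows "i = base_seq n p"
proof -
  \<comment> \<open>An injective key realising the order arm, reversed leg, \<open>p\<close>: arm
    values stay below \<open>n\<close>, leg values \<open>2 * n - x\<close> lie between
    \<open>n\<close> and \<open>2 * n\<close>, and \<open>p\<close> gets \<open>3 * n\<close>. Two
    lists with the same entries and increasing keys coincide.\<close>
  define key where "key = (\<lambda>x. if x < p then x else if p < x then 2 * n - x else 3 * n)"
  note p = adm_bounds[OF a n]
  have inj: "inj_on key {0..<n}"
    using p by (auto simp: inj_on_def key_def split: if_splits)
  have sorted: "sorted_wrt (<) (map key i)" if a: "adm n p i" and d: "\<And>k. \<not> desc n p i k" for i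
  proof -
    note s = klr_seqs_nth[OF admD(1)[OF a]]
    have "key (i ! m) < key (i ! Suc m)" if m: "Suc m < n" for m
    proof (cases "Suc m = n - 1")
      case True
      then show ?thesis using admD(3)[OF a] adm_side[OF a, of m] s(2)[of m] m p by (auto simp: key_def)
    next
      case False
      then have m': "Suc m < n - 1" using m by auto
      have "\<not> (p < i ! m \<and> i ! Suc m < p)" using d[of "Suc m"] m' by (auto simp: desc_def)
      then show ?thesis
        using adm_side[OF a, of m] adm_side[OF a, of "Suc m"] m' admD(4,5)[OF a, of m "Suc m", OF lessI m]
          s(2)[of m] s(2)[of "Suc m"] m
        by (auto simp: key_def)
    qed
    then show ?thesis
      by (subst sorted_wrt_iff_nth_Suc_transp) (auto simp: s(1))
  qed
  have d': "\<not> desc n p (base_seq n p) k" for k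
    using p by (auto simp: desc_def nth_base_seq)
  have "set i = {0..<n}" "set (base_seq n p) = {0..<n}"
    using admD(1)[OF a] base_seq_klr_seqs[OF p(2)] by (auto simp: klr_seqs_def permutations_of_set_def)
  moreover from this have "map key i = map key (base_seq n p)"
    using sorted[OF a d] sorted[OF adm_base_seq[OF p] d'] by (intro strict_sorted_equal) auto
  ultimately show ?thesis
    using inj by (intro map_inj_on[of key i]) auto
qed

section \<open>Vanishing of idempotents and of the dots\<close>

lemma arrow_both: "1 < n \<Longrightarrow> arrow n u v \<Longrightarrow> arrow n v u \<Longrightarrow> n = 2"
  by (auto simp: arrow_def)

text \<open>The type has no unit: inside the product of all components the unit of one of them is
  only an idempotent. The unit relation therefore appears as absorption of the sum of the
  \<open>e i\<close>.\<close>

locale klr_elements =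
  fixes n :: nat and e :: "nat list \<Rightarrow> 'r::ring" and y psi :: "nat \<Rightarrow> 'r"
  assumes n_gt_1: "1 < n"
    and idem: "i \<in> klr_seqs n \<Longrightarrow> j \<in> klr_seqs n \<Longrightarrow> e i * e j = (if i = j then e i else 0)"
    and unit_y: "k \<in> {1..n} \<Longrightarrow> y k * sum e (klr_seqs n) = y k"
    and y_e: "k \<in> {1..n} \<Longrightarrow> i \<in> klr_seqs n \<Longrightarrow> y k * e i = e i * y k"
    and psi_e: "k \<in> {1..n-1} \<Longrightarrow> i \<in> klr_seqs n \<Longrightarrow> psi k * e i = e (swap_at k i) * psi k"
    and psi_y: "k \<in> {1..n-1} \<Longrightarrow> l \<in> {1..n} \<Longrightarrow> l \<noteq> k \<Longrightarrow> l \<noteq> k + 1 \<Longrightarrow> psi k * y l = y l * psi k"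
    and psi_psi: "k \<in> {1..n-1} \<Longrightarrow> l \<in> {1..n-1} \<Longrightarrow> \<bar>int k - int l\<bar> > 1 \<Longrightarrow> psi k * psi l = psi l * psi k"
    and psi_y_Suc: "k \<in> {1..n-1} \<Longrightarrow> i \<in> klr_seqs n \<Longrightarrow> psi k * y (k + 1) * e i = y k * psi k * e i"
    and y_Suc_psi: "k \<in> {1..n-1} \<Longrightarrow> i \<in> klr_seqs n \<Longrightarrow> y (k + 1) * psi k * e i = psi k * y k * e i"
    and braid: "k \<in> {1..n-1} \<Longrightarrow> k + 1 \<in> {1..n-1} \<Longrightarrow> i \<in> klr_seqs n \<Longrightarrow>
      psi k * psi (k + 1) * psi k * e i = psi (k + 1) * psi k * psi (k + 1) * e i"
    and psi_sq_none: "k \<in> {1..n-1} \<Longrightarrow> i \<in> klr_seqs n \<Longrightarrow>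
      \<not> arrow n (entry i k) (entry i (k + 1)) \<Longrightarrow> \<not> arrow n (entry i (k + 1)) (entry i k) \<Longrightarrow>
      psi k * psi k * e i = e i"
    and psi_sq_right: "k \<in> {1..n-1} \<Longrightarrow> i \<in> klr_seqs n \<Longrightarrow>
      arrow n (entry i k) (entry i (k + 1)) \<Longrightarrow> \<not> arrow n (entry i (k + 1)) (entry i k) \<Longrightarrow>
      psi k * psi k * e i = (y (k + 1) - y k) * e i"
    and psi_sq_left: "k \<in> {1..n-1} \<Longrightarrow> i \<in> klr_seqs n \<Longrightarrow>
      \<not> arrow n (entry i k) (entry i (k + 1)) \<Longrightarrow> arrow n (entry i (k + 1)) (entry i k) \<Longrightarrow>
      psi k * psi k * e i = (y k - y (k + 1)) * e i"
    and psi_sq_both: "k \<in> {1..n-1} \<Longrightarrow> i \<in> klr_seqs n \<Longrightarrow>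
      arrow n (entry i k) (entry i (k + 1)) \<Longrightarrow> arrow n (entry i (k + 1)) (entry i k) \<Longrightarrow>
      psi k * psi k * e i = (y (k + 1) - y k) * (y k - y (k + 1)) * e i"
    and cyc_y: "i \<in> klr_seqs n \<Longrightarrow> entry i 1 = 0 \<Longrightarrow> y 1 * e i = 0"
    and cyc_e: "i \<in> klr_seqs n \<Longrightarrow> entry i 1 \<noteq> 0 \<Longrightarrow> e i = 0"
begin

lemma e_e: "i \<in> klr_seqs n \<Longrightarrow> e i * e i = e i"
  by (simp add: idem)

lemma swap_klr: "i \<in> klr_seqs n \<Longrightarrow> 0 < k \<Longrightarrow> k < n \<Longrightarrow> swap_at k i \<in> klr_seqs n"
  by (rule swap_at_klr_seqs)

lemma psi_sq_swap:
  assumes "i \<in> klr_seqs n" "0 < k" "k < n"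
  shows "psi k * psi k * e i = psi k * e (swap_at k i) * psi k"
  using psi_e[of k i] assms by (simp add: mult.assoc)

definition prefix_adm :: "nat \<Rightarrow> nat list \<Rightarrow> bool" where
  "prefix_adm k i \<longleftrightarrow> i ! 0 = 0 \<and> (\<forall>m. 0 < m \<longrightarrow> m < k \<longrightarrow> (\<exists>l<m. nbr n (i ! l) (i ! m)))"

text \<open>
  Both claims are proved together by moving the entry in position \<open>k + 1\<close> one step to the left,
  where the statement for \<open>k\<close> applies.
\<close>

lemma prefix_vanish:
  assumes "0 < k" "k \<le> n" "i \<in> klr_seqs n"
  shows "(\<not> prefix_adm k i \<longrightarrow> e i = 0) \<and> (k < n \<longrightarrow> y k * e i = 0)"
  using assms
proof (induction k arbitrary: i)
  case (Suc k)
  note i = Suc.prems(3)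
  note s = klr_seqs_nth[OF i]
  show ?case
  proof (cases "k = 0")
    case True
    then show ?thesis using cyc_y[OF i] cyc_e[OF i] by (cases "i ! 0 = 0") (auto simp: prefix_adm_def)
  next
    case False
    then have k: "0 < k" "k < n" using Suc.prems by auto
    show ?thesis
    proof (cases "prefix_adm k i")
      case False
      then have "e i = 0" using Suc.IH[of i] i k by auto
      then show ?thesis by simp
    next
      case pre: True
      define j where "j = swap_at k i"
      have j: "j \<in> klr_seqs n" unfolding j_def using i k by (rule swap_klr)
      have jn: "j ! m = i ! (if m = k - 1 then k else if m = k then k - 1 else m)" if "m < n" for m
        unfolding j_def using k that by (intro nth_swap_at) (auto simp: s(1))
      have sq: "psi k * psi k * e i = psi k * e j * psi k"
        unfolding j_def by (rule psi_sq_swap) (use i k in auto)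
      have IHj: "\<not> prefix_adm k j \<Longrightarrow> e j = 0" "y k * e j = 0" and IHi: "y k * e i = 0"
        using Suc.IH[of j] Suc.IH[of i] i j k by auto
      \<comment> \<open>After the swap the entry \<open>i ! k\<close> stands at index
        \<open>k - 1\<close>, where it again needs an earlier neighbour; for \<open>k = 1\<close> it
        would have to be 0.\<close>
      have notadm: "\<not> prefix_adm k j" if nn: "\<And>l. l < k - 1 \<Longrightarrow> \<not> nbr n (i ! l) (i ! k)"
      proof
        assume p: "prefix_adm k j"
        show False
        proof (cases "k = 1")
          case True
          then have "i ! 1 = 0" using p jn[of 0] k by (simp add: prefix_adm_def)
          then show False using pre s(3)[of 0 1] k True by (auto simp: prefix_adm_def)
        next
          case False
          then have "0 < k - 1" "k - 1 < k" using k by auto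
          then obtain l where "l < k - 1" "nbr n (j ! l) (j ! (k - 1))"
            using p unfolding prefix_adm_def by blast
          then show False using nn[of l] jn[of l] jn[of "k - 1"] k by (simp split: if_splits)
        qed
      qed
      have both: "\<not> (arrow n (i ! (k - 1)) (i ! k) \<and> arrow n (i ! k) (i ! (k - 1)))" if "Suc k < n"
        using arrow_both[OF n_gt_1, of "i ! (k - 1)" "i ! k"] that k by auto
      have "e i = 0" if "\<not> prefix_adm (Suc k) i"
      proof -
        have nn: "\<not> nbr n (i ! l) (i ! k)" if "l < k" for l
          using \<open>\<not> prefix_adm (Suc k) i\<close> pre that by (auto simp: prefix_adm_def less_Suc_eq)
        then have "e j = 0" using notadm IHj(1) by simp
        moreover have "psi k * psi k * e i = e i"
          using nn[of "k - 1"] k i by (intro psi_sq_none) (auto simp: nbr_def)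
        ultimately show ?thesis using sq by simp
      qed
      moreover have "y (Suc k) * e i = 0" if kn: "Suc k < n"
      proof (cases "nbr n (i ! (k - 1)) (i ! k)")
        case True
        \<comment> \<open>The preceding entry is already the only neighbour, so the swapped
          idempotent vanishes. The quadratic relation then identifies the dots at \<open>k\<close>
          and \<open>Suc k\<close> on \<open>e i\<close>, and the first of them is 0 there.\<close>
        have "\<not> nbr n (i ! l) (i ! k)" if l: "l < k - 1" for l
        proof
          assume "nbr n (i ! l) (i ! k)"
          then have "k - 1 = l"
            using pre True l k unfolding prefix_adm_def
            by (intro prefix_nbr_unique[OF i _ k(1) kn, of "k - 1" l]) auto
          then show False using l by simp
        qed
        then have z: "psi k * psi k * e i = 0" using notadm IHj(1) sq by simp
        show ?thesis
        proof (cases "arrow n (i ! (k - 1)) (i ! k)")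
          case True
          then have "psi k * psi k * e i = (y (k + 1) - y k) * e i"
            using both[OF kn] k i by (intro psi_sq_right) auto
          then show ?thesis using z IHi by (simp add: left_diff_distrib)
        next
          case False
          then have "psi k * psi k * e i = (y k - y (k + 1)) * e i"
            using \<open>nbr n _ _\<close> k i by (intro psi_sq_left) (auto simp: nbr_def)
          then show ?thesis using z IHi by (simp add: left_diff_distrib)
        qed
      next
        case False
        then have "psi k * psi k * e i = e i"
          using k i by (intro psi_sq_none) (auto simp: nbr_def)
        \<comment> \<open>The crossing squares to the identity, so the dot slides through it to
          position \<open>k\<close> of the swapped sequence, where the induction hypothesis
          applies.\<close>
        then have "y (Suc k) * e i = y (Suc k) * psi k * e j * psi k" using sq by (simp add: mult.assoc)
        also have "y (Suc k) * psi k * e j = psi k * (y k * e j)"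
          using y_Suc_psi[of k j] k j by (simp add: mult.assoc)
        finally show ?thesis using IHj(2) by simp
      qed
      ultimately show ?thesis by simp
    qed
  qed
qed simp

lemma e_zero: "i \<in> klr_seqs n \<Longrightarrow> \<not> adm n (i ! (n - 1)) i \<Longrightarrow> e i = 0"
  using prefix_vanish[of n i] n_gt_1 adm_of_prefix[of i n] by (auto simp: prefix_adm_def)

lemma y_zero: "0 < k \<Longrightarrow> k < n \<Longrightarrow> y k = 0"
proof -
  assume k: "0 < k" "k < n"
  have "y k = (\<Sum>i\<in>klr_seqs n. y k * e i)" using unit_y[of k] k by (simp add: sum_distrib_left)
  also have "\<dots> = 0" using prefix_vanish[of k] k by (intro sum.neutral) auto
  finally show ?thesis .
qed

lemma psi_eq_zero:
  assumes "i \<in> klr_seqs n" "0 < k" "k < n" "\<not> adm n (swap_at k i ! (n - 1)) (swap_at k i)"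
  shows "psi k * e i = 0" "e i * psi k = 0"
proof -
  have z: "e (swap_at k i) = 0" using assms swap_klr by (intro e_zero) auto
  then show "psi k * e i = 0" using psi_e[of k i] assms by simp
  have "psi k * e (swap_at k i) = e i * psi k"
    using psi_e[of k "swap_at k i"] swap_klr[of i k] assms klr_seqs_nth(1)[of i]
    by (simp add: swap_at_swap_at)
  then show "e i * psi k = 0" using z by simp
qed

text \<open>Since \<open>y (n - 1) = 0\<close>, the quadratic relation leaves only the last dot,
  with a sign given by the orientation of the arrow. Neither of the last two entries is 0, so the
  arrow back to 0 does not interfere.\<close>

lemma psi_sq_last:
  assumes a: "adm n p i" and n: "2 < n"
  shows "psi (n - 1) * psi (n - 1) * e i = (if p = Suc (i ! (n - 2)) then y n * e i else - (y n * e i))"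
proof -
  note i = admD(1)[OF a]
  have ends: "entry i (n - 1) = i ! (n - 2)" "entry i (n - 1 + 1) = p"
    using admD(3)[OF a] n by (simp_all add: numeral_2_eq_2)
  have y0: "y (n - 1) = 0" using n by (intro y_zero) auto
  have nz: "i ! (n - 2) \<noteq> 0" using klr_seqs_nth(3)[OF i, of "n - 2" 0] admD(2)[OF a] n by auto
  have pz: "0 < p" using adm_bounds[OF a] n by simp
  from adm_swap_last(2)[OF a n] show ?thesis
  proof
    assume p: "Suc (i ! (n - 2)) = p"
    have "arrow n (entry i (n - 1)) (entry i (n - 1 + 1))" "\<not> arrow n (entry i (n - 1 + 1)) (entry i (n - 1))"
      unfolding ends using p nz n adm_bounds[OF a] by (auto simp: arrow_def)
    then have "psi (n - 1) * psi (n - 1) * e i = (y (n - 1 + 1) - y (n - 1)) * e i"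
      using i n by (intro psi_sq_right) auto
    then show ?thesis using p n y0 by simp
  next
    assume p: "i ! (n - 2) = Suc p"
    have "arrow n (entry i (n - 1 + 1)) (entry i (n - 1))" "\<not> arrow n (entry i (n - 1)) (entry i (n - 1 + 1))"
      unfolding ends using p pz n klr_seqs_nth(2)[OF i, of "n - 2"] by (auto simp: arrow_def)
    then have "psi (n - 1) * psi (n - 1) * e i = (y (n - 1) - y (n - 1 + 1)) * e i"
      using i n by (intro psi_sq_left) auto
    then show ?thesis using p n y0 by simp
  qed
qed

text \<open>For \<open>n > 2\<close> the last dot is up to sign the square of the last crossing, and
  another dot slides into that crossing as \<open>y (n - 1) = 0\<close>. For \<open>n = 2\<close>
  the double arrow makes the square of the crossing equal to minus the square of the dot, and it
  passes through a sequence starting with 1.\<close>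

lemma y_sq_e: "i \<in> klr_seqs n \<Longrightarrow> y n * (y n * e i) = 0"
proof -
  assume i: "i \<in> klr_seqs n"
  show ?thesis
  proof (cases "adm n (i ! (n - 1)) i")
    case False
    then show ?thesis using e_zero[OF i] by simp
  next
    case a: True
    note len = klr_seqs_nth(1)[OF i]
    define j where "j = swap_at (n - 1) i"
    have j: "j \<in> klr_seqs n" unfolding j_def using n_gt_1 i by (intro swap_klr) auto
    have y0: "y (n - 1) = 0" using n_gt_1 by (intro y_zero) auto
    have sq: "psi (n - 1) * psi (n - 1) * e i = psi (n - 1) * e j * psi (n - 1)"
      unfolding j_def using i n_gt_1 by (intro psi_sq_swap) auto
    show ?thesis
    proof (cases "n = 2")
      case True
      have "\<not> adm n (j ! (n - 1)) j"
      proof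
        assume b: "adm n (j ! (n - 1)) j"
        have "j ! 0 = i ! 1" unfolding j_def using len True by (subst nth_swap_at) auto
        then show False using admD(2)[OF b] admD(2)[OF a] klr_seqs_nth(3)[OF i, of 0 1] True by simp
      qed
      then have z: "psi 1 * psi 1 * e i = 0" using sq e_zero[OF j] True by simp
      have "i ! 0 = 0" "i ! 1 = 1"
        using admD(2)[OF a] klr_seqs_nth(3)[OF i, of 0 1] klr_seqs_nth(2)[OF i, of 1] True by auto
      then have "psi 1 * psi 1 * e i = (y (1 + 1) - y 1) * (y 1 - y (1 + 1)) * e i"
        using i True by (intro psi_sq_both) (auto simp: arrow_def)
      then show ?thesis using z y0 True by (simp add: numeral_2_eq_2 mult.assoc)
    next
      case False
      then have n: "2 < n" using n_gt_1 by simp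
      have "y n * (psi (n - 1) * psi (n - 1) * e i) = (y n * psi (n - 1) * e j) * psi (n - 1)"
        unfolding sq by (simp only: mult.assoc)
      also have "y n * psi (n - 1) * e j = psi (n - 1) * y (n - 1) * e j"
        using y_Suc_psi[of "n - 1" j] n j by simp
      finally have "y n * (psi (n - 1) * psi (n - 1) * e i) = 0" using y0 by simp
      then show ?thesis using psi_sq_last[OF a n] by (auto split: if_splits)
    qed
  qed
qed

lemma y_sq: "y n * y n = 0"
proof -
  have "y n * y n = (\<Sum>i\<in>klr_seqs n. y n * (y n * e i))"
    using unit_y[of n] n_gt_1 by (simp flip: sum_distrib_left)
  also have "\<dots> = 0" by (intro sum.neutral) (simp add: y_sq_e)
  finally show ?thesis .
qed

end

section \<open>Canonical paths between sequences with the same last entry\<close>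

context klr_elements
begin

text \<open>\<open>x\<close> is the product of crossings from \<open>i\<close> to the base sequence
  and \<open>x'\<close> the reversed product; the idempotents place them in
  \<open>e(c_p) R e(i)\<close> and \<open>e(i) R e(c_p)\<close>.\<close>

inductive path :: "nat \<Rightarrow> nat list \<Rightarrow> 'r \<Rightarrow> 'r \<Rightarrow> bool" for p where
  base: "path p (base_seq n p) (e (base_seq n p)) (e (base_seq n p))"
| step: "adm n p i \<Longrightarrow> desc n p i k \<Longrightarrow> path p (swap_at k i) x x' \<Longrightarrow>
    path p i (x * psi k * e i) (e i * psi k * x')"

lemma path_ex: "adm n p i \<Longrightarrow> \<exists>x x'. path p i x x'"
proof (induction "weight i" arbitrary: i rule: less_induct)
  case less
  show ?case
  proof (cases "\<exists>k. desc n p i k")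
    case True
    then obtain k where k: "desc n p i k" ..
    then show ?thesis
      using less.hyps[OF adm_desc(2) adm_desc(1)] less.prems by (blast intro: path.step)
  next
    case False
    then show ?thesis using adm_no_desc[OF less.prems n_gt_1] path.base by auto
  qed
qed

lemma e_psi:
  assumes "i \<in> klr_seqs n" "0 < k" "k < n"
  shows "e i * psi k = psi k * e (swap_at k i)"
  using psi_e[of k "swap_at k i"] swap_klr[OF assms] assms klr_seqs_nth(1)[OF assms(1)]
  by (simp add: swap_at_swap_at)

text \<open>The exchanged entries are nonzero and lie on different sides of \<open>p\<close>, so
  they are not joined by an arrow and the crossing is an involution.\<close>

lemma psi_psi_e:
  assumes a: "adm n p i" and k: "0 < k" "k < n - 1" and b: "adm n p (swap_at k i)"
  shows "psi k * (psi k * e i) = e i"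
proof -
  have s: "1 < k" "i ! (k - 1) < p \<and> p < i ! k \<or> p < i ! (k - 1) \<and> i ! k < p"
    using adm_swap_iff[OF a k] b by auto
  have "i ! (k - 1) \<noteq> 0" "i ! k \<noteq> 0"
    using klr_seqs_nth(3)[OF admD(1)[OF a], of _ 0] admD(2)[OF a] s(1) k by auto
  then have "psi k * psi k * e i = e i"
    using s k admD(1)[OF a] by (intro psi_sq_none) (auto simp: arrow_def)
  then show ?thesis by (simp add: mult.assoc)
qed

lemma path_props:
  assumes "path p i x x'" "0 < p" "p < n"
  shows "adm n p i \<and> x * e i = x \<and> e (base_seq n p) * x = x \<and> e i * x' = x' \<and> x' * e (base_seq n p) = x' \<and>
    x * x' = e (base_seq n p) \<and> x' * x = e i"
  using assms
proof (induction rule: path.induct)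
  case base
  then show ?case using adm_base_seq[of p n] e_e admD(1) by blast
next
  case (step i k x x')
  then have ad: "adm n p (swap_at k i)" and IH: "x * e (swap_at k i) = x" "e (base_seq n p) * x = x"
    "e (swap_at k i) * x' = x'" "x' * e (base_seq n p) = x'" "x * x' = e (base_seq n p)" "x' * x = e (swap_at k i)"
    by auto
  note i = admD(1)[OF step.hyps(1)] and j = admD(1)[OF ad]
  have k: "0 < k" "k < n - 1" "k < n" using step.hyps(2) by (auto simp: desc_def)
  have sw: "swap_at k (swap_at k i) = i" using k klr_seqs_nth(1)[OF i] by (simp add: swap_at_swap_at)
  have "x * psi k * e i * (e i * psi k * x') = x * psi k * (e i * e i * psi k) * x'"
    by (simp only: mult.assoc)
  also have "\<dots> = x * (psi k * (psi k * e (swap_at k i))) * x'"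
    using e_e[OF i] e_psi[OF i k(1,3)] by (simp only: mult.assoc)
  also have "\<dots> = x * x'"
    using psi_psi_e[OF ad k(1,2)] step.hyps(1) sw IH(3) by (simp add: mult.assoc)
  finally have 1: "x * psi k * e i * (e i * psi k * x') = e (base_seq n p)" using IH(5) by simp
  have "e i * psi k * x' * (x * psi k * e i) = e i * psi k * (x' * x) * psi k * e i"
    by (simp only: mult.assoc)
  also have "\<dots> = e i * psi k * (e (swap_at k i) * psi k) * e i" using IH(6) by (simp add: mult.assoc)
  also have "e (swap_at k i) * psi k = psi k * e i" using psi_e[of k i] i k by simp
  also have "e i * psi k * (psi k * e i) * e i = e i * (psi k * (psi k * e i)) * e i"
    by (simp only: mult.assoc)
  also have "\<dots> = e i" using psi_psi_e[OF step.hyps(1) k(1,2) ad] e_e[OF i] by simp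
  finally have 2: "e i * psi k * x' * (x * psi k * e i) = e i" .
  show ?case
    using step.hyps(1) 1 2 IH e_e[OF i]
    by (simp add: mult.assoc) (simp add: mult.assoc[symmetric])
qed

text \<open>
  A Newman-type argument: two descents of the same sequence are never adjacent, so the corresponding
  crossings commute.
\<close>

lemma path_unique:
  assumes "path p i x x'" "path p i z z'" "0 < p" "p < n"
  shows "x = z \<and> x' = z'"
  using assms
proof (induction "weight i" arbitrary: i x x' z z' rule: less_induct)
  case less
  note p = \<open>0 < p\<close> \<open>p < n\<close>
  have i: "adm n p i" using path_props[OF less.prems(1) p] by simp
  have nobase: "\<not> desc n p (base_seq n p) k" for k
    using p by (auto simp: desc_def nth_base_seq)
  have ordered: "x = z \<and> x' = z'"
    if kl: "k < l" and k: "desc n p i k" "path p (swap_at k i) xk xk'" "x = xk * psi k * e i" "x' = e i * psi k * xk'"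
      and l: "desc n p i l" "path p (swap_at l i) xl xl'" "z = xl * psi l * e i" "z' = e i * psi l * xl'"
    for k l x x' z z' xk xk' xl xl'
  proof -
    note s = klr_seqs_nth[OF admD(1)[OF i]]
    have kr: "0 < k" "k < n" "0 < l" "l < n" using k(1) l(1) by (auto simp: desc_def)
    \<comment> \<open>Two descents in a row would place the middle entry both below and above
      \<open>p\<close>.\<close>
    have "l \<noteq> Suc k" using k(1) l(1) by (auto simp: desc_def)
    then have sk: "Suc k < l" using kl by simp
    have ik: "adm n p (swap_at k i)" and il: "adm n p (swap_at l i)"
      using adm_desc(1)[OF i] k(1) l(1) by auto
    have dl: "desc n p (swap_at k i) l" and dk: "desc n p (swap_at l i) k"
      using k(1) l(1) sk kr by (auto simp: desc_def nth_swap_at s(1))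
    have comm: "swap_at k (swap_at l i) = swap_at l (swap_at k i)"
      using kr sk s(1) by (intro swap_at_commute) auto
    \<comment> \<open>A path from the common lower sequence closes the diamond; induction at both
      intermediate sequences identifies the given paths with its two extensions.\<close>
    obtain w w' where w: "path p (swap_at l (swap_at k i)) w w'"
      using path_ex[OF adm_desc(1)[OF ik dl]] by auto
    have 1: "xk = w * psi l * e (swap_at k i) \<and> xk' = e (swap_at k i) * psi l * w'"
      using less.hyps[OF adm_desc(2)[OF i k(1)] k(2) path.step[OF ik dl w] p] .
    have 2: "xl = w * psi k * e (swap_at l i) \<and> xl' = e (swap_at l i) * psi k * w'"
      using less.hyps[OF adm_desc(2)[OF i l(1)] l(2) path.step[OF il dk] p] w comm by simp
    have c: "psi k * psi l = psi l * psi k" using kr sk by (intro psi_psi) auto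
    have ek: "e (swap_at k i) * psi k = psi k * e i" "e i * psi k = psi k * e (swap_at k i)"
      and el: "e (swap_at l i) * psi l = psi l * e i" "e i * psi l = psi l * e (swap_at l i)"
      using psi_e[of k i] psi_e[of l i] e_psi[of i] admD(1)[OF i] kr by auto
    have "x = w * psi l * (e (swap_at k i) * psi k) * e i" using 1 k(3) by (simp add: mult.assoc)
    also have "\<dots> = w * (psi k * psi l) * (e i * e i)" unfolding ek c by (simp only: mult.assoc)
    also have "\<dots> = w * psi k * (e (swap_at l i) * psi l) * e i" unfolding el by (simp only: mult.assoc)
    also have "\<dots> = z" using 2 l(3) by (simp add: mult.assoc)
    finally have "x = z" .
    have "x' = e i * (psi k * e (swap_at k i)) * psi l * w'" using 1 k(4) by (simp add: mult.assoc)
    also have "\<dots> = e i * e i * (psi k * psi l) * w'" unfolding ek(2)[symmetric] by (simp only: mult.assoc)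
    also have "\<dots> = e i * (e i * psi l) * psi k * w'" unfolding c by (simp only: mult.assoc)
    also have "\<dots> = e i * (psi l * e (swap_at l i)) * psi k * w'" unfolding el(2) ..
    also have "\<dots> = z'" using 2 l(4) by (simp add: mult.assoc)
    finally show ?thesis using \<open>x = z\<close> by simp
  qed
  from less.prems(1) show ?case
  proof cases
    case base
    show ?thesis
      using less.prems(2) base by cases (auto simp: nobase)
  next
    case 1: (step k xk xk')
    from less.prems(2) show ?thesis
    proof cases
      case base
      then show ?thesis using 1 nobase by auto
    next
      case 2: (step l xl xl')
      consider "k < l" | "l < k" | "k = l" by linarith
      then show ?thesis
      proof cases
        assume "k < l"
        from ordered[OF this 1(4,5,1,2) 2(4,5,1,2)] show ?thesis .
      next
        assume "l < k"
        from ordered[OF this 2(4,5,1,2) 1(4,5,1,2)] show ?thesis by simp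
      next
        assume "k = l"
        then show ?thesis using less.hyps[OF adm_desc(2)[OF i 1(4)] 1(5) _ p] 1 2 by auto
      qed
    qed
  qed
qed

definition down :: "nat list \<Rightarrow> 'r" where
  "down i = (SOME x. \<exists>x'. path (i ! (n - 1)) i x x')"

definition up :: "nat list \<Rightarrow> 'r" where
  "up i = (SOME x'. \<exists>x. path (i ! (n - 1)) i x x')"

lemma down_up_eq:
  assumes "path p i x x'" "0 < p" "p < n"
  shows "down i = x" "up i = x'"
proof -
  have p: "i ! (n - 1) = p" using path_props[OF assms] admD(3) by blast
  note unique = path_unique[OF assms(1) _ assms(2,3)]
  show "down i = x"
    unfolding down_def p
  proof (rule some_equality)
    show "\<exists>x'. path p i x x'" using assms(1) by (rule exI)
    show "z = x" if "\<exists>x'. path p i z x'" for z using that unique by metis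
  qed
  show "up i = x'"
    unfolding up_def p
  proof (rule some_equality)
    show "\<exists>x. path p i x x'" using assms(1) by (rule exI)
    show "z = x'" if "\<exists>x. path p i x z" for z using that unique by metis
  qed
qed

lemma path_down_up:
  assumes "adm n p i"
  shows "path p i (down i) (up i)"
  using path_ex[OF assms] down_up_eq adm_bounds[OF assms n_gt_1] by metis

lemma down_up:
  assumes "adm n p i"
  shows "down i * e i = down i" "e (base_seq n p) * down i = down i" "e i * up i = up i"
    "up i * e (base_seq n p) = up i" "down i * up i = e (base_seq n p)" "up i * down i = e i"
  using path_props[OF path_down_up[OF assms] adm_bounds[OF assms n_gt_1]] by auto

lemma down_base [simp]: "0 < p \<Longrightarrow> p < n \<Longrightarrow> down (base_seq n p) = e (base_seq n p)"
  and up_base [simp]: "0 < p \<Longrightarrow> p < n \<Longrightarrow> up (base_seq n p) = e (base_seq n p)"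
  using down_up_eq[OF path.base] by auto

text \<open>If the swap removes a descent, this is the recursion defining paths; if it creates one,
  the recursion is read at the swapped sequence and inverted with \<open>psi_psi_e\<close>.\<close>

lemma down_up_swap:
  assumes a: "adm n p i" and k: "0 < k" "k < n - 1" and b: "adm n p (swap_at k i)"
  shows "down (swap_at k i) * psi k = down i" "psi k * up (swap_at k i) = up i"
proof -
  note p = adm_bounds[OF a n_gt_1]
  have desc: "down (swap_at k i) * psi k = down i" "psi k * up (swap_at k i) = up i"
    if a: "adm n p i" and d: "desc n p i k" for i
  proof -
    have k: "0 < k" "k < n" using d by (auto simp: desc_def)
    note i = admD(1)[OF a] and b = adm_desc(1)[OF a d]
    have "path p i (down (swap_at k i) * psi k * e i) (e i * psi k * up (swap_at k i))"
      using path.step[OF a d path_down_up[OF b]] .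
    then have eq: "down i = down (swap_at k i) * psi k * e i" "up i = e i * psi k * up (swap_at k i)"
      using down_up_eq p by blast+
    have "down i = down (swap_at k i) * (psi k * e i)" using eq by (simp add: mult.assoc)
    also have "psi k * e i = e (swap_at k i) * psi k" using psi_e[of k i] i k by simp
    finally show "down (swap_at k i) * psi k = down i" using down_up(1)[OF b] by (simp add: mult.assoc[symmetric])
    have "up i = psi k * (e (swap_at k i) * up (swap_at k i))"
      using eq e_psi[OF i k] by (simp add: mult.assoc)
    then show "psi k * up (swap_at k i) = up i" using down_up(3)[OF b] by simp
  qed
  from adm_swap_desc[OF a k b] consider "desc n p i k" | "desc n p (swap_at k i) k" by blast
  then have "down (swap_at k i) * psi k = down i \<and> psi k * up (swap_at k i) = up i"
  proof cases
    case 1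
    then show ?thesis using desc[OF a] by auto
  next
    case 2
    have sw: "swap_at k (swap_at k i) = i" using k adm_length[OF a] by (simp add: swap_at_swap_at)
    have eq: "down i * psi k = down (swap_at k i)" "psi k * up i = up (swap_at k i)"
      using desc[OF b 2] sw by auto
    note pp = psi_psi_e[OF a k b]
    have "down (swap_at k i) * psi k = down i * e i * psi k * psi k"
      using eq(1) down_up(1)[OF a] by simp
    also have "\<dots> = down i * (psi k * (psi k * e i))"
      using e_psi[of i k] e_psi[of "swap_at k i" k] admD(1)[OF a] admD(1)[OF b] k sw by (simp add: mult.assoc)
    finally have 1: "down (swap_at k i) * psi k = down i" using pp down_up(1)[OF a] by simp
    have "psi k * up (swap_at k i) = psi k * (psi k * e i) * up i"
      using eq(2) down_up(3)[OF a] by (simp add: mult.assoc)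
    then show ?thesis using 1 pp down_up(3)[OF a] by simp
  qed
  then show "down (swap_at k i) * psi k = down i" "psi k * up (swap_at k i) = up i" by auto
qed

lemma down_psi_zero:
  assumes "adm n p i" "0 < k" "k < n" "\<not> adm n (swap_at k i ! (n - 1)) (swap_at k i)"
  shows "down i * psi k = 0"
proof -
  have "down i * psi k = down i * (e i * psi k)" using down_up(1)[OF assms(1)] by (simp add: mult.assoc[symmetric])
  then show ?thesis using psi_eq_zero(2)[OF admD(1)[OF assms(1)] assms(2-)] by simp
qed

text \<open>A path uses only crossings with \<open>k < n - 1\<close>, and these commute with the
  last dot.\<close>

lemma y_down_up:
  assumes "adm n p i"
  shows "y n * down i = down i * y n" "y n * up i = up i * y n"
proof -
  note p = adm_bounds[OF assms n_gt_1]
  have "y n * x = x * y n \<and> y n * x' = x' * y n" if "path p i x x'" for x x'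
    using that p
  proof (induction rule: path.induct)
    case base
    then show ?case using y_e[of n "base_seq n p"] n_gt_1 admD(1)[OF adm_base_seq[OF p]] by simp
  next
    case (step i k x x')
    then have k: "0 < k" "k < n - 1" by (auto simp: desc_def)
    have 1: "psi k * y n = y n * psi k" using k by (intro psi_y) auto
    have 2: "y n * e i = e i * y n" using y_e[of n i] n_gt_1 admD(1)[OF step.hyps(1)] by simp
    have IH: "y n * x = x * y n" "y n * x' = x' * y n" using step by auto
    have "y n * (x * psi k * e i) = x * (y n * psi k) * e i" using IH(1) by (simp add: mult.assoc[symmetric])
    also have "\<dots> = x * psi k * (y n * e i)" unfolding 1[symmetric] by (simp only: mult.assoc)
    also have "\<dots> = x * psi k * e i * y n" unfolding 2 by (simp only: mult.assoc)
    finally have 3: "y n * (x * psi k * e i) = x * psi k * e i * y n" .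
    have "y n * (e i * psi k * x') = e i * (y n * psi k) * x'" using 2 by (simp add: mult.assoc[symmetric])
    also have "\<dots> = e i * psi k * (y n * x')" unfolding 1[symmetric] by (simp only: mult.assoc)
    also have "\<dots> = e i * psi k * x' * y n" unfolding IH by (simp only: mult.assoc)
    finally show ?case using 3 by simp
  qed
  then show "y n * down i = down i * y n" "y n * up i = up i * y n" using path_down_up[OF assms] by auto
qed

end

section \<open>A spanning set\<close>

context klr_elements
begin

text \<open>The element of \<open>e(c_(p+1)) R e(c_p)\<close> coming from the last crossing, which
  replaces the ending \<open>p\<close> by \<open>Suc p\<close>; \<open>down\<close> then returns to
  a chosen sequence. \<open>lower\<close> is its mirror image.\<close>

definition raise :: "nat \<Rightarrow> 'r" where
  "raise p = down (swap_at (n - 1) (base_seq n p)) * psi (n - 1) * e (base_seq n p)"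

definition lower :: "nat \<Rightarrow> 'r" where
  "lower p = e (base_seq n p) * psi (n - 1) * up (swap_at (n - 1) (base_seq n p))"

lemma base_seq_last2: "0 < p \<Longrightarrow> Suc p < n \<Longrightarrow> base_seq n p ! (n - 2) = Suc p"
  by (subst nth_base_seq) auto

lemma adm_swap_base: "0 < p \<Longrightarrow> Suc p < n \<Longrightarrow> adm n (Suc p) (swap_at (n - 1) (base_seq n p))"
  using adm_swap_last(1)[OF adm_base_seq[of p n]] base_seq_last2[of p] by simp

text \<open>The last crossing compresses to the same element from every admissible \<open>j\<close>
  with these two last entries. The entry at index \<open>n - 2\<close> exceeds \<open>p\<close>, so
  no descent ends there; hence all crossings that sort \<open>j\<close> commute with the last one
  and can be moved to the other side.\<close>

lemma psi_between:
  assumes a: "adm n p j" and n: "2 < n" and j: "j ! (n - 2) = Suc p"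
  shows "down (swap_at (n - 1) j) * psi (n - 1) * up j = raise p"
    "down j * psi (n - 1) * up (swap_at (n - 1) j) = lower p"
proof -
  have "down (swap_at (n - 1) j) * psi (n - 1) * up j = raise p \<and>
    down j * psi (n - 1) * up (swap_at (n - 1) j) = lower p"
    using a j
  proof (induction "weight j" arbitrary: j rule: less_induct)
    case less
    note a = less.prems(1) and len = adm_length[OF less.prems(1)]
    show ?case
    proof (cases "\<exists>k. desc n p j k")
      case False
      then have "j = base_seq n p" using adm_no_desc[OF a n_gt_1] by blast
      then show ?thesis using adm_bounds[OF a n_gt_1] by (simp add: raise_def lower_def)
    next
      case True
      then obtain k where d: "desc n p j k" ..
      define j1 where "j1 = swap_at k j"
      have "k \<noteq> n - 2" using d less.prems(2) by (auto simp: desc_def)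
      then have k: "0 < k" "k < n - 2" "k < n - 1" "Suc k < n - 1" using d n by (auto simp: desc_def)
      have a1: "adm n p j1" "weight j1 < weight j" using adm_desc[OF a d] by (auto simp: j1_def)
      have j1n: "j1 ! (n - 2) = Suc p"
        unfolding j1_def using k less.prems(2) len by (subst nth_swap_at) auto
      have comm: "swap_at (n - 1) j1 = swap_at k (swap_at (n - 1) j)"
        unfolding j1_def using k len by (intro swap_at_commute[symmetric]) auto
      have sw: "swap_at k (swap_at (n - 1) j1) = swap_at (n - 1) j"
        unfolding comm using k len by (intro swap_at_swap_at) auto
      have as: "adm n (Suc p) (swap_at (n - 1) j)" "adm n (Suc p) (swap_at (n - 1) j1)"
        using adm_swap_last(1)[OF a n] adm_swap_last(1)[OF a1(1) n] j1n less.prems(2) by simp_all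
      have c: "psi (n - 1) * psi k = psi k * psi (n - 1)" using k by (intro psi_psi) auto
      have sj: "down (swap_at (n - 1) j) * psi k = down (swap_at (n - 1) j1)"
        "psi k * up (swap_at (n - 1) j) = up (swap_at (n - 1) j1)"
        using down_up_swap[OF as(2) k(1,3)] as(1) sw by auto
      have dj: "down j1 * psi k = down j" "psi k * up j1 = up j"
        using down_up_swap[OF a k(1,3)] a1 by (auto simp: j1_def)
      have "down (swap_at (n - 1) j) * psi (n - 1) * up j = down (swap_at (n - 1) j) * (psi (n - 1) * psi k) * up j1"
        unfolding dj(2)[symmetric] by (simp only: mult.assoc)
      also have "\<dots> = down (swap_at (n - 1) j1) * psi (n - 1) * up j1"
        unfolding c sj(1)[symmetric] by (simp only: mult.assoc)
      finally have 1: "down (swap_at (n - 1) j) * psi (n - 1) * up j = raise p"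
        using less.hyps[OF a1(2,1) j1n] by simp
      have "down j * psi (n - 1) * up (swap_at (n - 1) j) = down j1 * (psi k * psi (n - 1)) * up (swap_at (n - 1) j)"
        unfolding dj(1)[symmetric] by (simp only: mult.assoc)
      also have "\<dots> = down j1 * psi (n - 1) * up (swap_at (n - 1) j1)"
        unfolding c[symmetric] sj(2)[symmetric] by (simp only: mult.assoc)
      finally show ?thesis using 1 less.hyps[OF a1(2,1) j1n] by simp
    qed
  qed
  then show "down (swap_at (n - 1) j) * psi (n - 1) * up j = raise p"
    "down j * psi (n - 1) * up (swap_at (n - 1) j) = lower p" by auto
qed

context
  fixes p assumes p: "0 < p" "Suc p < n"
begin

abbreviation (input) "c \<equiv> base_seq n p"
abbreviation (input) "c' \<equiv> swap_at (n - 1) (base_seq n p)"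

lemma bridge:
  "adm n p c" "adm n (Suc p) c'" "swap_at (n - 1) c' = c" "e c * psi (n - 1) = psi (n - 1) * e c'"
  "psi (n - 1) * e c = e c' * psi (n - 1)" "c' ! (n - 2) = p" "y n * e c = e c * y n"
  "y n * psi (n - 1) * e c = 0" "y n * psi (n - 1) * e c' = 0"
  "psi (n - 1) * y n * e c = 0" "psi (n - 1) * y n * e c' = 0" "y n * e c' = e c' * y n"
proof -
  show a: "adm n p c" using p by (intro adm_base_seq) auto
  show a': "adm n (Suc p) c'" by (rule adm_swap_base) fact+
  note len = adm_length[OF a] and k = admD(1)[OF a] and k' = admD(1)[OF a']
  show "swap_at (n - 1) c' = c" using p len by (intro swap_at_swap_at) auto
  show "e c * psi (n - 1) = psi (n - 1) * e c'" "psi (n - 1) * e c = e c' * psi (n - 1)"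
    using e_psi[OF k] psi_e[OF _ k] n_gt_1 by auto
  show "c' ! (n - 2) = p"
    using p len admD(3)[OF a] by (subst nth_swap_at) (auto simp: numeral_2_eq_2)
  show "y n * e c = e c * y n" "y n * e c' = e c' * y n" using y_e[of n] k k' n_gt_1 by auto
  have y0: "y (n - 1) = 0" using p by (intro y_zero) auto
  show "y n * psi (n - 1) * e c = 0" "y n * psi (n - 1) * e c' = 0"
    using y_Suc_psi[OF _ k, of "n - 1"] y_Suc_psi[OF _ k', of "n - 1"] n_gt_1 y0 by auto
  show "psi (n - 1) * y n * e c = 0" "psi (n - 1) * y n * e c' = 0"
    using psi_y_Suc[OF _ k, of "n - 1"] psi_y_Suc[OF _ k', of "n - 1"] n_gt_1 y0 by auto
qed

text \<open>The sign is the orientation of the arrow: the base sequence ends in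
  \<open>Suc p, p\<close>, against the arrow, while in \<open>raise_lower\<close> the square is
  taken at a sequence ending in \<open>p, Suc p\<close>.\<close>

lemma lower_raise: "lower p * raise p = - (y n * e c)"
proof -
  have "lower p * raise p = e c * psi (n - 1) * (up c' * down c') * psi (n - 1) * e c"
    unfolding lower_def raise_def by (simp only: mult.assoc)
  also have "\<dots> = e c * psi (n - 1) * e c' * psi (n - 1) * e c"
    using down_up(6)[OF bridge(2)] by simp
  also have "\<dots> = e c * psi (n - 1) * (e c' * psi (n - 1)) * e c" by (simp only: mult.assoc)
  also have "\<dots> = (e c * psi (n - 1)) * psi (n - 1) * (e c * e c)"
    unfolding bridge(5)[symmetric] by (simp only: mult.assoc)
  also have "\<dots> = psi (n - 1) * (e c' * psi (n - 1)) * e c"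
    using e_e[OF admD(1)[OF bridge(1)]] unfolding bridge(4) by (simp only: mult.assoc)
  also have "\<dots> = psi (n - 1) * psi (n - 1) * e c * e c"
    unfolding bridge(5)[symmetric] by (simp only: mult.assoc)
  also have "\<dots> = - (y n * e c) * e c"
    using psi_sq_last[OF bridge(1)] base_seq_last2[OF p] p by simp
  finally show ?thesis using e_e[OF admD(1)[OF bridge(1)]] by (simp add: mult.assoc)
qed

lemma raise_lower: "raise p * lower p = y n * e (base_seq n (Suc p))"
proof -
  have "raise p * lower p = down c' * psi (n - 1) * (e c * e c) * psi (n - 1) * up c'"
    unfolding lower_def raise_def by (simp only: mult.assoc)
  also have "\<dots> = down c' * psi (n - 1) * (e c * psi (n - 1)) * up c'"
    using e_e[OF admD(1)[OF bridge(1)]] by (simp only: mult.assoc)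
  also have "\<dots> = down c' * (psi (n - 1) * psi (n - 1) * e c') * up c'"
    unfolding bridge(4) by (simp only: mult.assoc)
  also have "\<dots> = down c' * y n * (e c' * up c')"
    using psi_sq_last[OF bridge(2)] bridge(6) p by (simp add: mult.assoc)
  also have "\<dots> = y n * (down c' * up c')"
    using y_down_up(1)[OF bridge(2)] down_up(3)[OF bridge(2)] by (simp add: mult.assoc[symmetric])
  finally show ?thesis using down_up(5)[OF bridge(2)] by simp
qed

lemma raise_e: "raise p * e c = raise p" "e (base_seq n (Suc p)) * raise p = raise p"
  and lower_e: "e c * lower p = lower p" "lower p * e (base_seq n (Suc p)) = lower p"
  using e_e[OF admD(1)[OF bridge(1)]] down_up(2,4)[OF bridge(2)] unfolding raise_def lower_def
  by (simp_all add: mult.assoc) (simp_all add: mult.assoc[symmetric])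

lemma y_raise_lower: "y n * raise p = 0" "raise p * y n = 0" "y n * lower p = 0" "lower p * y n = 0"
proof -
  have "y n * raise p = down c' * (y n * psi (n - 1) * e c)"
    using y_down_up(1)[OF bridge(2)] unfolding raise_def by (simp add: mult.assoc[symmetric])
  then show "y n * raise p = 0" using bridge(8) by simp
  have "raise p * y n = down c' * (psi (n - 1) * y n * e c)"
    unfolding raise_def mult.assoc bridge(7) ..
  then show "raise p * y n = 0" using bridge(10) by simp
  have "y n * lower p = (y n * psi (n - 1) * e c') * up c'"
    unfolding lower_def bridge(4) by (simp only: mult.assoc)
  then show "y n * lower p = 0" using bridge(9) by simp
  have "lower p * y n = psi (n - 1) * (e c' * y n) * up c'"
    unfolding lower_def bridge(4) mult.assoc y_down_up(2)[OF bridge(2)] ..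
  also have "\<dots> = (psi (n - 1) * y n * e c') * up c'"
    unfolding bridge(12)[symmetric] by (simp only: mult.assoc)
  finally show "lower p * y n = 0" using bridge(11) by simp
qed

text \<open>
  Both products factor through \<open>\<psi>\<^sub>n\<^sub>-\<^sub>1 \<psi>\<^sub>n\<^sub>-\<^sub>2 \<psi>\<^sub>n\<^sub>-\<^sub>1\<close>, and the other side of the braid relation
  passes through a sequence whose idempotent vanishes.
\<close>

lemma raise_raise:
  assumes p2: "Suc (Suc p) < n"
  shows "raise (Suc p) * raise p = 0" "lower p * lower (Suc p) = 0"
proof -
  note len = adm_length[OF bridge(1)] adm_length[OF bridge(2)]
  \<comment> \<open>\<open>m\<close> ends in \<open>Suc (Suc p), Suc p\<close>. It is on the way
    from \<open>c'\<close> to its base sequence, and \<open>psi_between\<close> lets the second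
    factor start at \<open>m\<close>; this exposes the three crossings of the braid
    relation.\<close>
  define m where "m = swap_at (n - 2) c'"
  have n: "2 < n" "0 < n - 2" "n - 2 < n - 1" "n - 2 < n" using p p2 by auto
  have c3: "c ! (n - 3) = Suc (Suc p)" using p p2 by (subst nth_base_seq) auto
  have c'3: "c' ! (n - 3) = Suc (Suc p)" using c3 p p2 len by (subst nth_swap_at) auto
  have n23: "n - 2 - 1 = n - 3" by simp
  have m: "adm n (Suc p) m"
    unfolding m_def adm_swap_iff[OF bridge(2) n(2,3)] n23 using c'3 bridge(6) p p2 by auto
  have m2: "m ! (n - 2) = Suc (Suc p)"
    unfolding m_def using n c'3 len n23 by (subst nth_swap_at) (auto simp del: One_nat_def)
  have sm: "swap_at (n - 2) m = c'" unfolding m_def using n len by (intro swap_at_swap_at) auto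
  have d: "down c' = down m * psi (n - 2)" "up c' = psi (n - 2) * up m"
    using down_up_swap[OF bridge(2) n(2,3)] m by (auto simp: m_def)
  \<comment> \<open>The entries at indices \<open>n - 3\<close> and \<open>n - 2\<close> both belong
    to the leg, so their exchange leaves the admissible sequences.\<close>
  have na: "\<not> adm n (swap_at (n - 2) c ! (n - 1)) (swap_at (n - 2) c)"
  proof
    assume a: "adm n (swap_at (n - 2) c ! (n - 1)) (swap_at (n - 2) c)"
    have "swap_at (n - 2) c ! (n - 1) = p"
      using n len admD(3)[OF bridge(1)] by (subst nth_swap_at) auto
    then have "adm n p (swap_at (n - 2) c)" using a by simp
    then show False
      unfolding adm_swap_iff[OF bridge(1) n(2,3)] n23 using c3 base_seq_last2[OF p] by auto
  qed
  have z: "psi (n - 2) * e c = 0" "e c * psi (n - 2) = 0"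
    using psi_eq_zero[OF admD(1)[OF bridge(1)] n(2,4) na] by auto
  have br: "psi (n - 2) * psi (n - 1) * psi (n - 2) * e i = psi (n - 1) * psi (n - 2) * psi (n - 1) * e i"
    if "i \<in> klr_seqs n" for i
    using braid[of "n - 2" i] that n by (simp add: numeral_2_eq_2 Suc_diff_Suc)
  have R: "raise (Suc p) = down (swap_at (n - 1) m) * psi (n - 1) * up m"
    and L: "lower (Suc p) = down m * psi (n - 1) * up (swap_at (n - 1) m)"
    using psi_between[OF m n(1) m2] by auto
  have "raise (Suc p) * raise p =
    down (swap_at (n - 1) m) * psi (n - 1) * (up m * down m) * psi (n - 2) * psi (n - 1) * e c"
    unfolding R raise_def[of p] d by (simp only: mult.assoc)
  also have "up m * down m = e m" by (rule down_up(6)[OF m])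
  also have "down (swap_at (n - 1) m) * psi (n - 1) * e m * psi (n - 2) * psi (n - 1) * e c
     = down (swap_at (n - 1) m) * psi (n - 1) * (e m * psi (n - 2)) * psi (n - 1) * e c"
    by (simp only: mult.assoc)
  also have "e m * psi (n - 2) = psi (n - 2) * e c'" using e_psi[OF admD(1)[OF m] n(2,4)] sm by simp
  also have "down (swap_at (n - 1) m) * psi (n - 1) * (psi (n - 2) * e c') * psi (n - 1) * e c
     = down (swap_at (n - 1) m) * psi (n - 1) * psi (n - 2) * (e c' * psi (n - 1)) * e c"
    by (simp only: mult.assoc)
  also have "\<dots> = down (swap_at (n - 1) m) * (psi (n - 1) * psi (n - 2) * psi (n - 1) * e c) * e c"
    unfolding bridge(5)[symmetric] by (simp only: mult.assoc)
  also have "psi (n - 1) * psi (n - 2) * psi (n - 1) * e c = psi (n - 2) * psi (n - 1) * (psi (n - 2) * e c)"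
    using br[OF admD(1)[OF bridge(1)]] by (simp add: mult.assoc)
  finally show "raise (Suc p) * raise p = 0" using z by simp
  let ?i = "swap_at (n - 1) m"
  have i: "?i \<in> klr_seqs n" using admD(1)[OF m] n_gt_1 by (intro swap_klr) auto
  have ui: "e ?i * up ?i = up ?i"
    using down_up(3)[OF adm_swap_last(1)[OF m n(1)]] .
  have "lower p * lower (Suc p) = e c * psi (n - 1) * psi (n - 2) * (up m * down m) * psi (n - 1) * up ?i"
    unfolding L lower_def[of p] d by (simp only: mult.assoc)
  also have "up m * down m = e m" by (rule down_up(6)[OF m])
  also have "e c * psi (n - 1) * psi (n - 2) * e m * psi (n - 1) * up ?i =
     e c * psi (n - 1) * psi (n - 2) * (e m * psi (n - 1)) * up ?i" by (simp only: mult.assoc)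
  also have "e m * psi (n - 1) = psi (n - 1) * e ?i" using e_psi[OF admD(1)[OF m], of "n - 1"] n_gt_1 by simp
  also have "e c * psi (n - 1) * psi (n - 2) * (psi (n - 1) * e ?i) * up ?i =
     e c * (psi (n - 1) * psi (n - 2) * psi (n - 1) * e ?i) * up ?i" by (simp only: mult.assoc)
  also have "\<dots> = (e c * psi (n - 2)) * psi (n - 1) * psi (n - 2) * e ?i * up ?i"
    unfolding br[OF i, symmetric] by (simp only: mult.assoc)
  finally show "lower p * lower (Suc p) = 0" using z by simp
qed

end

end

section \<open>Compressions between chosen sequences\<close>

locale klr_module = klr_elements n e y psi + Vector_Spaces.vector_space sc
  for n :: nat and e :: "nat list \<Rightarrow> 'r::ring" and y psi :: "nat \<Rightarrow> 'r"
    and sc :: "'k::field \<Rightarrow> 'r \<Rightarrow> 'r" +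
  assumes sc_mult_left: "sc a x * z = sc a (x * z)" and sc_mult_right: "x * sc a z = sc a (x * z)"
begin

text \<open>Coefficients are only asserted to exist: this bounds the space
  \<open>e(c_p) R e(c_q)\<close> from above and says nothing about independence.\<close>

definition block :: "nat \<Rightarrow> nat \<Rightarrow> 'r \<Rightarrow> bool" where
  "block p q x \<longleftrightarrow>
    (if p = q then \<exists>a b. x = sc a (e (base_seq n p)) + sc b (y n * e (base_seq n p))
     else if p = Suc q then \<exists>a. x = sc a (raise q)
     else if q = Suc p then \<exists>a. x = sc a (lower p)
     else x = 0)"

lemma block_diagI:
  "x = sc a (e (base_seq n p)) + sc b (y n * e (base_seq n p)) \<Longrightarrow> block p p x"
  by (auto simp: block_def)

lemma block_zero: "block p q 0"
  unfolding block_def by (auto intro!: exI[of _ 0])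

lemma block_add: "block p q x \<Longrightarrow> block p q z \<Longrightarrow> block p q (x + z)"
proof (cases "p = q")
  case True
  assume "block p q x" "block p q z"
  then obtain a b a' b' where "x = sc a (e (base_seq n p)) + sc b (y n * e (base_seq n p))"
    "z = sc a' (e (base_seq n p)) + sc b' (y n * e (base_seq n p))"
    using True unfolding block_def by auto
  then have "x + z = sc (a + a') (e (base_seq n p)) + sc (b + b') (y n * e (base_seq n p))"
    by (simp add: scale_left_distrib)
  then show ?thesis using True unfolding block_def by auto
qed (auto simp: block_def simp flip: scale_left_distrib split: if_splits)

lemma block_scale: "block p q x \<Longrightarrow> block p q (sc a x)"
  unfolding block_def by (auto 4 5 simp: scale_right_distrib split: if_splits)

lemma block_y:
  assumes "block p q x" "0 < p" "p < n" "0 < q" "q < n"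
  shows "block p q (y n * x)"
proof -
  have "y n * (y n * u) = 0" for u using y_sq by (simp add: mult.assoc[symmetric])
  then show ?thesis
    using assms y_raise_lower[of p] y_raise_lower[of q]
    unfolding block_def
    by (auto simp: distrib_left sc_mult_right intro: exI[of _ 0] split: if_splits)
qed

lemma block_raise:
  assumes x: "block p q x" and p: "0 < p" "Suc p < n" and q: "0 < q" "q < n"
  shows "block (Suc p) q (raise p * x)"
proof -
  have ry: "raise p * (y n * u) = 0" for u using y_raise_lower[OF p] by (simp add: mult.assoc[symmetric])
  consider "p = q" | "p = Suc q" | "q = Suc p" | "p \<noteq> q" "p \<noteq> Suc q" "q \<noteq> Suc p" by blast
  then show ?thesis
  proof cases
    case 1
    then obtain a b where "x = sc a (e (base_seq n p)) + sc b (y n * e (base_seq n p))"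
      using x unfolding block_def by auto
    then have "raise p * x = sc a (raise p)"
      using raise_e[OF p] ry by (simp add: distrib_left sc_mult_right)
    then show ?thesis using 1 unfolding block_def by auto
  next
    case 2
    then obtain a where "x = sc a (raise q)" using x unfolding block_def by auto
    then have "raise p * x = 0" using raise_raise(1)[of q] 2 p q by (simp add: sc_mult_right)
    then show ?thesis by (simp add: block_zero)
  next
    case 3
    then obtain a where "x = sc a (lower p)" using x unfolding block_def by auto
    then have "raise p * x = sc 0 (e (base_seq n (Suc p))) + sc a (y n * e (base_seq n (Suc p)))"
      using raise_lower[OF p] by (simp add: sc_mult_right)
    then show ?thesis unfolding 3 by (rule block_diagI)
  next
    case 4
    then have "x = 0" using x unfolding block_def by auto
    then show ?thesis by (simp add: block_zero)
  qed
qed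

lemma block_lower:
  assumes x: "block (Suc p) q x" and p: "0 < p" "Suc p < n" and q: "0 < q" "q < n"
  shows "block p q (lower p * x)"
proof -
  have ly: "lower p * (y n * u) = 0" for u using y_raise_lower[OF p] by (simp add: mult.assoc[symmetric])
  consider "q = Suc p" | "q = p" | "q = Suc (Suc p)" | "q \<noteq> Suc p" "q \<noteq> p" "q \<noteq> Suc (Suc p)" by blast
  then show ?thesis
  proof cases
    case 1
    then obtain a b where "x = sc a (e (base_seq n (Suc p))) + sc b (y n * e (base_seq n (Suc p)))"
      using x unfolding block_def by auto
    then have "lower p * x = sc a (lower p)"
      using lower_e[OF p] ly by (simp add: distrib_left sc_mult_right)
    then show ?thesis using 1 unfolding block_def by auto
  next
    case 2
    then obtain a where "x = sc a (raise p)" using x unfolding block_def by auto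
    then have "lower p * x = sc 0 (e (base_seq n p)) + sc (- a) (y n * e (base_seq n p))"
      using lower_raise[OF p] by (simp add: sc_mult_right)
    then show ?thesis unfolding 2 by (rule block_diagI)
  next
    case 3
    then obtain a where "x = sc a (lower (Suc p))" using x unfolding block_def by auto
    then have "lower p * x = 0" using raise_raise(2)[of p] 3 p q by (simp add: sc_mult_right)
    then show ?thesis by (simp add: block_zero)
  next
    case 4
    then have "x = 0" using x unfolding block_def by auto
    then show ?thesis by (simp add: block_zero)
  qed
qed

text \<open>All \<open>j\<close> and \<open>i\<close> are quantified, so that a generator multiplied
  on the left can be absorbed by passing from \<open>down j\<close> to another sequence.\<close>

definition in_span :: "'r \<Rightarrow> bool" where
  "in_span r \<longleftrightarrow> (\<forall>p q i j. adm n p j \<longrightarrow> adm n q i \<longrightarrow> block p q (down j * r * up i))"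

lemma in_span_zero: "in_span 0"
  by (simp add: in_span_def block_zero)

lemma in_span_add: "in_span r \<Longrightarrow> in_span s \<Longrightarrow> in_span (r + s)"
  by (auto simp: in_span_def distrib_left distrib_right intro: block_add)

lemma in_span_scale: "in_span r \<Longrightarrow> in_span (sc a r)"
  by (auto simp: in_span_def sc_mult_right sc_mult_left intro: block_scale)

lemma in_span_e_mult:
  assumes r: "in_span r" and i: "i \<in> klr_seqs n"
  shows "in_span (e i * r)"
  unfolding in_span_def
proof (intro allI impI)
  fix p q i' j assume a: "adm n p j" "adm n q i'"
  have "down j * (e i * r) * up i' = down j * (e j * e i) * r * up i'"
    using down_up(1)[OF a(1)] by (simp add: mult.assoc[symmetric])
  also have "\<dots> = (if i = j then down j * r * up i' else 0)"
    using idem[OF admD(1)[OF a(1)] i] down_up(1)[OF a(1)] by auto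
  finally show "block p q (down j * (e i * r) * up i')"
    using r a by (auto simp: in_span_def block_zero)
qed

lemma in_span_y_mult:
  assumes r: "in_span r" and k: "k \<in> {1..n}"
  shows "in_span (y k * r)"
proof (cases "k = n")
  case False
  then show ?thesis using y_zero[of k] k by (simp add: in_span_zero)
next
  case True
  show ?thesis
    unfolding in_span_def
  proof (intro allI impI)
    fix p q i j assume a: "adm n p j" "adm n q i"
    have "down j * (y k * r) * up i = y n * (down j * r * up i)"
      using y_down_up(1)[OF a(1)] True by (simp add: mult.assoc[symmetric])
    then show "block p q (down j * (y k * r) * up i)"
      using r a block_y adm_bounds[OF a(1) n_gt_1] adm_bounds[OF a(2) n_gt_1]
      by (simp add: in_span_def)
  qed
qed

lemma in_span_psi_mult:
  assumes r: "in_span r" and k: "k \<in> {1..n-1}"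
  shows "in_span (psi k * r)"
  unfolding in_span_def
proof (intro allI impI)
  fix p q i j assume a: "adm n p j" "adm n q i"
  note bp = adm_bounds[OF a(1) n_gt_1] and bq = adm_bounds[OF a(2) n_gt_1]
  let ?s = "swap_at k j"
  have k': "0 < k" "k < n" using k n_gt_1 by auto
  have eq: "down j * (psi k * r) * up i = (down j * psi k) * r * up i" by (simp only: mult.assoc)
  show "block p q (down j * (psi k * r) * up i)"
  proof (cases "adm n (?s ! (n - 1)) ?s")
    case False
    then show ?thesis using down_psi_zero[OF a(1) k'] unfolding eq by (simp add: block_zero)
  next
    case True
    show ?thesis
    proof (cases "k < n - 1")
      case kn: True
      have "?s ! (n - 1) = p"
        using admD(3)[OF a(1)] adm_length[OF a(1)] k' kn by (subst nth_swap_at) auto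
      then have b: "adm n p ?s" using True by simp
      have "swap_at k ?s = j" using k' adm_length[OF a(1)] by (intro swap_at_swap_at) auto
      then have "down j * psi k = down ?s" using down_up_swap(1)[OF b k'(1) kn] a(1) by simp
      then show ?thesis unfolding eq using r a b by (simp add: in_span_def)
    next
      case False
      then have kn: "k = n - 1" using k' by simp
      have s0: "?s ! 0 = 0" using admD(2)[OF True] .
      \<comment> \<open>For \<open>n = 2\<close> the last crossing is also the first one and would
        bring a nonzero entry to the front.\<close>
      have n: "2 < n"
      proof (rule ccontr)
        assume "\<not> 2 < n"
        then have n2: "n = 2" using n_gt_1 by simp
        then have "?s ! 0 = j ! 1" using kn adm_length[OF a(1)] by (subst nth_swap_at) auto
        then show False using s0 admD(3)[OF a(1)] bp n2 by simp
      qed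
      define p' where "p' = j ! (n - 2)"
      have b: "adm n p' ?s" and p': "Suc p' = p \<or> p' = Suc p"
        using adm_swap_last[OF a(1) n] kn by (auto simp: p'_def)
      note bp' = adm_bounds[OF b n_gt_1]
      have ss: "swap_at k ?s = j" using k' adm_length[OF a(1)] by (intro swap_at_swap_at) auto
      have s2: "?s ! (n - 2) = p"
        using n kn adm_length[OF a(1)] admD(3)[OF a(1)]
        by (subst nth_swap_at) (auto simp: numeral_2_eq_2)
      have "down j * psi k = down j * (e j * psi k)"
        using down_up(1)[OF a(1)] by (simp add: mult.assoc[symmetric])
      also have "e j * psi k = psi k * (up ?s * down ?s)"
        using e_psi[OF admD(1)[OF a(1)] k'] down_up(6)[OF b] by simp
      \<comment> \<open>Inserting \<open>up * down\<close> at the swapped sequence splits off a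
        factor between chosen sequences, which \<open>psi_between\<close> recognises as
        \<open>raise\<close> or \<open>lower\<close>.\<close>
      finally have d: "down j * psi k = (down j * psi k * up ?s) * down ?s" unfolding mult.assoc .
      have X: "block p' q (down ?s * r * up i)" using r a b by (auto simp: in_span_def)
      have rl: "down j * psi k * up ?s = (if Suc p' = p then raise p' else lower p)"
      proof (cases "Suc p' = p")
        case True
        then show ?thesis using psi_between(1)[OF b n] s2 ss kn by simp
      next
        case False
        then show ?thesis using psi_between(2)[OF a(1) n] p' kn by (simp add: p'_def)
      qed
      have "block p q ((if Suc p' = p then raise p' else lower p) * (down ?s * r * up i))"
        using X p' bp bp' bq block_raise[of p' q] block_lower[of p q] by auto
      then show ?thesis by (subst eq, subst d, subst rl) (simp only: mult.assoc)
    qed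
  qed
qed

lemma in_span_unit: "in_span (sum e (klr_seqs n))"
  unfolding in_span_def
proof (intro allI impI)
  fix p q i j assume a: "adm n p j" "adm n q i"
  have "down j * sum e (klr_seqs n) = (\<Sum>i\<in>klr_seqs n. down j * (e j * e i))"
    using down_up(1)[OF a(1)] by (simp add: sum_distrib_left mult.assoc[symmetric])
  also have "\<dots> = (\<Sum>i\<in>klr_seqs n. if i = j then down j else 0)"
    using idem[OF admD(1)[OF a(1)]] down_up(1)[OF a(1)] by (intro sum.cong) auto
  also have "\<dots> = down j" using admD(1)[OF a(1)] by simp
  finally have "down j * sum e (klr_seqs n) * up i = down j * (e j * e i) * up i"
    using down_up(1)[OF a(1)] down_up(3)[OF a(2)] by (simp add: mult.assoc) (simp add: mult.assoc[symmetric])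
  also have "\<dots> = (if i = j then e (base_seq n p) else 0)"
    using idem[OF admD(1)[OF a(1)] admD(1)[OF a(2)]] down_up(1,5)[OF a(1)] by auto
  finally have eq: "down j * sum e (klr_seqs n) * up i = (if i = j then e (base_seq n p) else 0)" .
  have "block p p (e (base_seq n p))"
    by (rule block_diagI[of _ 1 _ 0]) simp
  then show "block p q (down j * sum e (klr_seqs n) * up i)"
    unfolding eq using adm_unique[of n p i q] a by (auto simp: block_zero)
qed

text \<open>Every nonzero \<open>e j\<close> factors as \<open>up j * down j\<close>, so an element
  is recovered from its compressions to chosen sequences.\<close>

lemma e_mult_decompose:
  assumes "sum e (klr_seqs n) * r = r" "r * sum e (klr_seqs n) = r"
  shows "r = (\<Sum>j\<in>{j. adm n (j ! (n - 1)) j}. \<Sum>i\<in>{i. adm n (i ! (n - 1)) i}. up j * (down j * r * up i) * down i)"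
proof -
  let ?A = "{j. adm n (j ! (n - 1)) j}"
  have sub: "?A \<subseteq> klr_seqs n" using admD(1) by auto
  have U: "sum e (klr_seqs n) = sum e ?A"
    using e_zero by (intro sum.mono_neutral_right sub) auto
  have "r = sum e ?A * r * sum e ?A" using assms unfolding U by simp
  also have "\<dots> = (\<Sum>j\<in>?A. \<Sum>i\<in>?A. e j * r * e i)"
    unfolding sum_distrib_right sum_distrib_left by (rule sum.swap)
  also have "\<dots> = (\<Sum>j\<in>?A. \<Sum>i\<in>?A. up j * (down j * r * up i) * down i)"
  proof (intro sum.cong refl)
    fix j i assume "j \<in> ?A" "i \<in> ?A"
    then have "e j = up j * down j" "e i = up i * down i" using down_up(6) by auto
    then show "e j * r * e i = up j * (down j * r * up i) * down i" by (simp only: mult.assoc)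
  qed
  finally show ?thesis .
qed

end

text \<open>Adjacent entries of the same chain have consecutive values, since a value in between
  could be placed neither before nor after them. For \<open>k = 1\<close> the obstruction is the
  entry 0 in front, and the leg can only start with \<open>n - 1\<close>, which is joined to
  0.\<close>

lemma adm_not_swap_nbr:
  assumes a: "adm n p i" and k: "0 < k" "k < n - 1" and b: "\<not> adm n p (swap_at k i)"
  shows "nbr n (i ! (k - 1)) (i ! k)"
proof -
  note s = klr_seqs_nth[OF admD(1)[OF a]]
  have k': "k - 1 < k" "k < n" "k - 1 < n" "k - 1 < n - 1" using k by auto
  have n: "1 < n" using k by auto
  note pb = adm_bounds[OF a n]
  have pos: "m < k - 1 \<or> k < m" if "m < n" "i ! m \<noteq> i ! (k - 1)" "i ! m \<noteq> i ! k" for m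
  proof -
    have "m \<noteq> k" "m \<noteq> k - 1" using that by auto
    then show ?thesis by linarith
  qed
  consider "k = 1" "p < i ! k" | "i ! (k - 1) < p" "i ! k < p" | "p < i ! (k - 1)" "p < i ! k"
    using b adm_swap_iff[OF a k] adm_side[OF a k(2)] adm_side[OF a k'(4)] k admD(2)[OF a]
    by (cases "k = 1") auto
  then show ?thesis
  proof cases
    case 1
    have "i ! k = n - 1"
    proof (rule ccontr)
      assume ne: "i ! k \<noteq> n - 1"
      then have lt: "i ! k < n - 1" using s(2)[OF k'(2)] by simp
      obtain m where m: "m < n" "i ! m = n - 1" using s(4)[of "n - 1"] n by auto
      have "m \<noteq> 0" using m(2) admD(2)[OF a] n by (intro notI) simp
      moreover have "m \<noteq> k" using m(2) ne by auto
      ultimately have "m \<noteq> 0" "m \<noteq> k" by auto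
      then have "k < m" using 1 by auto
      then show False using admD(5)[OF a _ m(1), of k] m(2) 1 lt by auto
    qed
    then show ?thesis using 1 admD(2)[OF a] n by (simp add: nbr_def arrow_def)
  next
    case 2
    have lt: "i ! (k - 1) < i ! k" using admD(4)[OF a k'(1,2)] 2 by simp
    have "i ! k = Suc (i ! (k - 1))"
    proof (rule ccontr)
      assume ne: "i ! k \<noteq> Suc (i ! (k - 1))"
      have "Suc (i ! (k - 1)) < n" using 2 pb by simp
      then obtain m where m: "m < n" "i ! m = Suc (i ! (k - 1))" using s(4) by blast
      from pos[OF m(1)] m(2) ne have "m < k - 1 \<or> k < m" by auto
      then show False
        using admD(4)[OF a _ k'(3), of m] admD(4)[OF a _ m(1), of k] m(2) 2 lt by auto
    qed
    then show ?thesis using 2 pb by (simp add: nbr_def arrow_def)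
  next
    case 3
    have lt: "i ! k < i ! (k - 1)" using admD(5)[OF a k'(1,2)] 3 by simp
    have "i ! (k - 1) = Suc (i ! k)"
    proof (rule ccontr)
      assume ne: "i ! (k - 1) \<noteq> Suc (i ! k)"
      have "Suc (i ! k) < n" using lt s(2)[OF k'(3)] by simp
      then obtain m where m: "m < n" "i ! m = Suc (i ! k)" using s(4) by blast
      from pos[OF m(1)] m(2) ne have "m < k - 1 \<or> k < m" by auto
      then show False
        using admD(5)[OF a _ k'(3), of m] admD(5)[OF a _ m(1), of k] m(2) 3 lt by auto
    qed
    then show ?thesis using s(2)[OF k'(3)] by (simp add: nbr_def arrow_def)
  qed
qed

lemma adm_swap_not_nbr:
  assumes a: "adm n p i" and k: "0 < k" "k < n - 1" and b: "adm n p (swap_at k i)"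
  shows "\<not> nbr n (i ! (k - 1)) (i ! k)"
proof -
  have s: "1 < k" "i ! (k - 1) < p \<and> p < i ! k \<or> p < i ! (k - 1) \<and> i ! k < p"
    using adm_swap_iff[OF a k] b by auto
  have "i ! (k - 1) \<noteq> 0" "i ! k \<noteq> 0"
    using klr_seqs_nth(3)[OF admD(1)[OF a], of _ 0] admD(2)[OF a] s(1) k by auto
  then show ?thesis using s by (auto simp: nbr_def arrow_def)
qed

text \<open>Two of any three entries lie on the same chain, and reversing the three inverts their
  order.\<close>

lemma adm_not_reverse:
  assumes a: "adm n p i" and k: "0 < k" "Suc k < n - 1"
  shows "\<not> adm n p (swap_at k (swap_at (Suc k) (swap_at k i)))"
proof
  let ?r = "swap_at k (swap_at (Suc k) (swap_at k i))"
  assume b: "adm n p ?r"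
  obtain l where l: "k = Suc l" using k gr0_implies_Suc by blast
  have r: "?r ! l = i ! Suc (Suc l)" "?r ! Suc l = i ! Suc l" "?r ! Suc (Suc l) = i ! l"
    using k adm_length[OF a] unfolding l by (simp_all add: nth_swap_at_Suc)
  have n: "Suc (Suc l) < n" "Suc l < n" "Suc (Suc l) < n - 1" "Suc l < n - 1" "l < n - 1" using k l by auto
  have side: "i ! l < p \<or> p < i ! l" "i ! Suc l < p \<or> p < i ! Suc l"
    "i ! Suc (Suc l) < p \<or> p < i ! Suc (Suc l)"
    using adm_side[OF a] n by auto
  show False
    using side r n admD(4,5)[OF a, of l "Suc l"] admD(4,5)[OF a, of l "Suc (Suc l)"]
      admD(4,5)[OF a, of "Suc l" "Suc (Suc l)"]
      admD(4,5)[OF b, of l "Suc l"] admD(4,5)[OF b, of l "Suc (Suc l)"]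
      admD(4,5)[OF b, of "Suc l" "Suc (Suc l)"]
    by auto
qed

section \<open>The indecomposable projective modules\<close>

text \<open>
  The projective cover of the simple module attached to the last entry \<open>q\<close>. The function \<open>f\<close>
  stands for the combination of top vectors with coefficients \<open>f j False\<close> and socle vectors with
  coefficients \<open>f j True\<close>; the latter are the images of the former under \<open>y\<^sub>n\<close>.
\<close>

type_synonym 'k klr_vec = "nat list \<Rightarrow> bool \<Rightarrow> 'k"

text \<open>Composition factors in the line: the \<open>False\<close> vectors give the head
  \<open>q\<close> together with its neighbours \<open>q - 1\<close> and \<open>q + 1\<close>, the
  \<open>True\<close> vectors a second copy of \<open>q\<close> as socle.\<close>

definition basis_index :: "nat \<Rightarrow> nat \<Rightarrow> nat list \<Rightarrow> bool \<Rightarrow> bool" where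
  "basis_index n q j t \<longleftrightarrow> adm n (j ! (n - 1)) j \<and>
     (if t then j ! (n - 1) = q else j ! (n - 1) \<le> Suc q \<and> q \<le> Suc (j ! (n - 1)))"

definition proj_module :: "nat \<Rightarrow> nat \<Rightarrow> 'k::field klr_vec set" where
  "proj_module n q = {f. \<forall>j t. \<not> basis_index n q j t \<longrightarrow> f j t = 0}"

definition e_op :: "nat list \<Rightarrow> 'k::field klr_vec \<Rightarrow> 'k klr_vec" where
  "e_op i f j t = (if j = i then f j t else 0)"

definition y_op :: "nat \<Rightarrow> nat \<Rightarrow> nat \<Rightarrow> 'k::field klr_vec \<Rightarrow> 'k klr_vec" where
  "y_op n q k f j t = (if k = n \<and> t \<and> basis_index n q j True then f j False else 0)"

text \<open>Coordinates are pulled back along the swap. The last crossing maps the head to its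
  neighbours and the neighbours to the socle, never into the head; the sign is the one that
  \<open>psi_sq_last\<close> demands.\<close>

definition psi_op :: "nat \<Rightarrow> nat \<Rightarrow> nat \<Rightarrow> 'k::field klr_vec \<Rightarrow> 'k klr_vec" where
  "psi_op n q k f j t =
     (if \<not> basis_index n q j t then 0
      else if k < n - 1 then f (swap_at k j) t
      else if t then (if q = Suc (j ! (n - 2)) then f (swap_at k j) False else - f (swap_at k j) False)
      else if j ! (n - 1) = q then 0 else f (swap_at k j) False)"

primrec klr_op :: "nat \<Rightarrow> nat \<Rightarrow> klr_gen \<Rightarrow> 'k::field klr_vec \<Rightarrow> 'k klr_vec" where
  "klr_op n q (GE i) = e_op i"
| "klr_op n q (GY k) = y_op n q k"
| "klr_op n q (GPsi k) = psi_op n q k"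

definition vec_scale :: "'k::field \<Rightarrow> 'k klr_vec \<Rightarrow> 'k klr_vec" where
  "vec_scale c f = (\<lambda>j t. c * f j t)"

lemma free_action_klr_op: "free_action (vec_scale :: 'k::field \<Rightarrow> _) (klr_op n q)"
proof
  fix c d :: 'k and f g :: "'k klr_vec" and a
  show "vec_scale c (f + g) = vec_scale c f + vec_scale c g"
    "vec_scale (c + d) f = vec_scale c f + vec_scale d f"
    "vec_scale c (vec_scale d f) = vec_scale (c * d) f" "vec_scale 1 f = f"
    by (simp_all add: vec_scale_def fun_eq_iff algebra_simps)
  show "klr_op n q a (f + g) = klr_op n q a f + klr_op n q a g"
    "klr_op n q a (vec_scale c f) = vec_scale c (klr_op n q a f)"
    by (cases a; simp add: vec_scale_def fun_eq_iff e_op_def y_op_def psi_op_def)+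
qed

context
  fixes n q :: nat
  assumes n: "2 < n" and q: "0 < q" "q < n"
begin

lemma basisD:
  assumes "basis_index n q j t"
  shows "adm n (j ! (n - 1)) j" "j \<in> klr_seqs n" "length j = n"
  using assms admD(1) adm_length unfolding basis_index_def by blast+

lemma proj_moduleD: "f \<in> proj_module n q \<Longrightarrow> \<not> basis_index n q j t \<Longrightarrow> f j t = 0"
  by (simp add: proj_module_def)

lemma swap_last:
  assumes "length j = n" "0 < k" "k < n - 1"
  shows "swap_at k j ! (n - 1) = j ! (n - 1)"
  using assms by (subst nth_swap_at) auto

lemma swap_last2:
  assumes "length j = n"
  shows "swap_at (n - 1) j ! (n - 1) = j ! (n - 2)" "swap_at (n - 1) j ! (n - 2) = j ! (n - 1)"
  using assms n by (subst nth_swap_at; auto simp: numeral_2_eq_2)+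

lemma basis_swap:
  assumes "length j = n" "0 < k" "k < n - 1" "basis_index n q j t"
  shows "basis_index n q (swap_at k j) t \<longleftrightarrow> adm n (j ! (n - 1)) (swap_at k j)"
  using assms unfolding basis_index_def swap_last[OF assms(1-3)] by auto

lemma adm_swap_back:
  assumes "length j = n" "adm n p (swap_at (n - 1) j)"
  shows "adm n (j ! (n - 1)) j"
  using adm_swap_last(1)[OF assms(2) n] assms n by (simp add: swap_last2 swap_at_swap_at del: One_nat_def)

section \<open>The defining relations on the projective module\<close>

lemma ops_closed:
  assumes f: "f \<in> proj_module n q"
  shows "e_op i f \<in> proj_module n q" "y_op n q k f \<in> proj_module n q" "psi_op n q k f \<in> proj_module n q"
  using proj_moduleD[OF f] by (auto simp: proj_module_def e_op_def y_op_def psi_op_def)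

lemma op_psi_e:
  assumes i: "i \<in> klr_seqs n" and k: "0 < k" "k < n"
  shows "psi_op n q k (e_op i f) = e_op (swap_at k i) (psi_op n q k f)"
proof (intro ext)
  fix j t
  have "swap_at k j = i \<longleftrightarrow> j = swap_at k i" if "basis_index n q j t"
    using basisD(3)[OF that] klr_seqs_nth(1)[OF i] k by (auto simp: swap_at_swap_at)
  then show "psi_op n q k (e_op i f) j t = e_op (swap_at k i) (psi_op n q k f) j t"
    by (auto simp: psi_op_def e_op_def)
qed

lemma op_y_zero: "k < n \<Longrightarrow> y_op n q k f = 0"
  by (simp add: y_op_def fun_eq_iff)

lemma op_psi_y:
  assumes f: "f \<in> proj_module n q" and k: "0 < k" "k < n - 1"
  shows "psi_op n q k (y_op n q n f) = y_op n q n (psi_op n q k f)"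
proof (intro ext)
  fix j t
  show "psi_op n q k (y_op n q n f) j t = y_op n q n (psi_op n q k f) j t"
  proof (cases "t \<and> basis_index n q j True")
    case False
    then show ?thesis by (auto simp: psi_op_def y_op_def)
  next
    case True
    then have t: t and b: "basis_index n q j True" by auto
    note len = basisD(3)[OF b]
    have bF: "basis_index n q j False" using b by (auto simp: basis_index_def)
    have "basis_index n q (swap_at k j) True \<longleftrightarrow> basis_index n q (swap_at k j) False"
      using basis_swap[OF len k b] basis_swap[OF len k bF] by simp
    then show ?thesis
      using t b bF k proj_moduleD[OF f, of "swap_at k j" False] by (auto simp: psi_op_def y_op_def)
  qed
qed

lemma op_psi_y_last: "psi_op n q (n - 1) (y_op n q n f) = 0"
  by (simp add: psi_op_def y_op_def fun_eq_iff)

lemma op_y_psi_last: "y_op n q n (psi_op n q (n - 1) f) = 0"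
  by (auto simp: psi_op_def y_op_def fun_eq_iff basis_index_def)

text \<open>Both orders read the same coordinate of \<open>f\<close>. If it is nonzero, its index is
  admissible, and this makes the two intermediate sequences agree in being basis indices.\<close>

lemma op_psi_psi:
  assumes f: "f \<in> proj_module n q" and kl: "0 < k" "Suc k < l" "l < n"
  shows "psi_op n q k (psi_op n q l f) = psi_op n q l (psi_op n q k f)"
proof (intro ext)
  fix j t
  show "psi_op n q k (psi_op n q l f) j t = psi_op n q l (psi_op n q k f) j t"
  proof (cases "basis_index n q j t")
    case False
    then show ?thesis by (simp add: psi_op_def del: One_nat_def)
  next
    case b: True
    note len = basisD(3)[OF b] and a = basisD(1)[OF b]
    have k: "k < n - 1" "k < n - 2" using kl by auto
    have comm: "swap_at l (swap_at k j) = swap_at k (swap_at l j)"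
      using kl len by (intro swap_at_commute[symmetric]) auto
    have bk: "basis_index n q (swap_at k j) t \<longleftrightarrow> adm n (j ! (n - 1)) (swap_at k j)"
      by (rule basis_swap[OF len kl(1) k(1) b])
    show ?thesis
    proof (cases "l < n - 1")
      case l: True
      have l0: "0 < l" using kl by simp
      have bl: "basis_index n q (swap_at l j) t \<longleftrightarrow> adm n (j ! (n - 1)) (swap_at l j)"
        by (rule basis_swap[OF len l0 l b])
      have nth: "swap_at k j ! (l - 1) = j ! (l - 1)" "swap_at k j ! l = j ! l"
        "swap_at l j ! (k - 1) = j ! (k - 1)" "swap_at l j ! k = j ! k"
        using kl len by (auto simp: nth_swap_at)
      show ?thesis
      proof (cases "f (swap_at k (swap_at l j)) t = 0")
        case True
        then show ?thesis using b l k comm by (simp add: psi_op_def del: One_nat_def)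
      next
        case False
        then have "basis_index n q (swap_at k (swap_at l j)) t" using proj_moduleD[OF f] by auto
        from basisD(1)[OF this] have "adm n (j ! (n - 1)) (swap_at k (swap_at l j))"
          using swap_last[of "swap_at l j" k] swap_last[of j l] len kl l0 l k by simp
        then have a': "adm n (j ! (n - 1)) (swap_at k (swap_at l j))" "adm n (j ! (n - 1)) (swap_at l (swap_at k j))"
          by (simp_all only: comm)
        have "adm n (j ! (n - 1)) (swap_at l j)" if "adm n (j ! (n - 1)) (swap_at k j)"
          using adm_swap_iff[OF that l0 l] a'(2) adm_swap_iff[OF a l0 l] unfolding nth by blast
        moreover have "adm n (j ! (n - 1)) (swap_at k j)" if "adm n (j ! (n - 1)) (swap_at l j)"
          using adm_swap_iff[OF that kl(1) k(1)] a'(1) adm_swap_iff[OF a kl(1) k(1)] unfolding nth by blast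
        ultimately have "adm n (j ! (n - 1)) (swap_at k j) \<longleftrightarrow> adm n (j ! (n - 1)) (swap_at l j)" by blast
        then show ?thesis using b l k comm bk bl by (simp add: psi_op_def del: One_nat_def)
      qed
    next
      case False
      then have l: "l = n - 1" using kl by simp
      have nth: "swap_at k j ! (n - 1) = j ! (n - 1)" "swap_at k j ! (n - 2) = j ! (n - 2)"
        using kl k len by (auto simp: nth_swap_at)
      show ?thesis
      proof (cases "f (swap_at k (swap_at l j)) False = 0")
        case True
        then show ?thesis using b l k comm by (simp add: psi_op_def del: One_nat_def)
      next
        case False
        then have b': "basis_index n q (swap_at k (swap_at l j)) False" using proj_moduleD[OF f] by auto
        then have "basis_index n q (swap_at l (swap_at k j)) False" using comm by simp
        then have "adm n (j ! (n - 1)) (swap_at k j)"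
          using adm_swap_back[of "swap_at k j"] basisD(1) len l nth by auto
        then have 1: "basis_index n q (swap_at k j) t" using bk by simp
        have "adm n (j ! (n - 2)) (swap_at l j)" using adm_swap_last(1)[OF a n] l by simp
        moreover have "swap_at k (swap_at l j) ! (n - 1) = swap_at l j ! (n - 1)"
          using kl(1) k(1) len by (intro swap_last) simp_all
        ultimately have 2: "basis_index n q (swap_at l j) False"
          using b' swap_last2(1)[OF len] unfolding basis_index_def l by simp
        show ?thesis using b l k comm 1 2 nth by (auto simp: psi_op_def simp del: One_nat_def)
      qed
    qed
  qed
qed

text \<open>Dots before the last act as 0, so for joined entries the square of the crossing has to
  be 0. On admissible sequences joined entries are exactly those that cannot be swapped.\<close>

lemma op_psi_sq_inner:
  assumes f: "f \<in> proj_module n q" and k: "0 < k" "k < n - 1"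
  shows "psi_op n q k (psi_op n q k (e_op i f)) = (if nbr n (i ! (k - 1)) (i ! k) then 0 else e_op i f)"
proof (intro ext)
  fix j t
  show "psi_op n q k (psi_op n q k (e_op i f)) j t =
    (if nbr n (i ! (k - 1)) (i ! k) then 0 else e_op i f) j t"
  proof (cases "basis_index n q j t")
    case False
    then show ?thesis using proj_moduleD[OF ops_closed(1)[OF f], of j t i] by (simp add: psi_op_def del: One_nat_def)
  next
    case b: True
    note len = basisD(3)[OF b] and a = basisD(1)[OF b]
    have ss: "swap_at k (swap_at k j) = j" using k len by (intro swap_at_swap_at) auto
    show ?thesis
      using b k ss basis_swap[OF len k b] adm_not_swap_nbr[OF a k] adm_swap_not_nbr[OF a k]
      by (auto simp: psi_op_def e_op_def)
  qed
qed

lemma op_psi_sq_last: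
  assumes f: "f \<in> proj_module n q"
  shows "psi_op n q (n - 1) (psi_op n q (n - 1) (e_op i f)) j t =
    (if i ! (n - 1) = Suc (i ! (n - 2)) then y_op n q n (e_op i f) j t else - y_op n q n (e_op i f) j t)"
proof (cases "basis_index n q j t")
  case False
  then have "\<not> (t \<and> basis_index n q j True)" by auto
  then show ?thesis using False by (auto simp: psi_op_def y_op_def)
next
  case b: True
  note len = basisD(3)[OF b] and a = basisD(1)[OF b]
  have ss: "swap_at (n - 1) (swap_at (n - 1) j) = j" using n len by (intro swap_at_swap_at) auto
  have as: "adm n (j ! (n - 2)) (swap_at (n - 1) j)" "Suc (j ! (n - 2)) = j ! (n - 1) \<or> j ! (n - 2) = Suc (j ! (n - 1))"
    using adm_swap_last[OF a n] by auto
  show ?thesis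
  proof (cases t)
    case True
    then have "j ! (n - 1) = q" using b by (simp add: basis_index_def)
    then have "basis_index n q (swap_at (n - 1) j) False" using as by (auto simp: basis_index_def swap_last2 len simp del: One_nat_def)
    then have h1: "psi_op n q (n - 1) (e_op i f) (swap_at (n - 1) j) False = e_op i f j False"
      using as(2) \<open>j ! (n - 1) = q\<close> unfolding psi_op_def swap_last2[OF len] ss by auto
    have h2: "psi_op n q (n - 1) g j True =
        (if q = Suc (j ! (n - 2)) then g (swap_at (n - 1) j) False else - g (swap_at (n - 1) j) False)" for g
      using b True by (simp add: psi_op_def)
    have h3: "y_op n q n (e_op i f) j True = e_op i f j False"
      using b True by (simp add: y_op_def)
    have t: "t = True" using True by simp
    have "e_op i f j False = 0 \<or> j = i" by (simp add: e_op_def)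
    then show ?thesis unfolding t h2 h1 h3 using \<open>j ! (n - 1) = q\<close> by auto
  next
    case False
    have "psi_op n q (n - 1) (e_op i f) (swap_at (n - 1) j) False = 0" if "j ! (n - 1) \<noteq> q"
      using b False as(2) that unfolding psi_op_def swap_last2[OF len] basis_index_def by auto
    then have "psi_op n q (n - 1) (psi_op n q (n - 1) (e_op i f)) j False = 0"
      by (subst psi_op_def) (simp del: One_nat_def)
    then show ?thesis using False by (simp add: y_op_def)
  qed
qed

end

context
  fixes n q :: nat
  assumes n: "2 < n" and q: "0 < q" "q < n"
begin

lemma psi_op_inner:
  "k < n - 1 \<Longrightarrow> psi_op n q k f j t = (if basis_index n q j t then f (swap_at k j) t else 0)"
  by (simp add: psi_op_def)

lemma psi_op_off: "\<not> basis_index n q j t \<Longrightarrow> psi_op n q k g j t = 0"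
  by (simp add: psi_op_def)

lemma psi_op_last_zero: "g (swap_at (n - 1) j) False = 0 \<Longrightarrow> psi_op n q (n - 1) g j t = 0"
  by (simp add: psi_op_def del: One_nat_def)

lemma op_braid_inner:
  assumes f: "f \<in> proj_module n q" and k: "0 < k" "Suc k < n - 1"
  shows "psi_op n q k (psi_op n q (Suc k) (psi_op n q k f)) = 0"
    "psi_op n q (Suc k) (psi_op n q k (psi_op n q (Suc k) f)) = 0"
proof -
  have zero: "f (swap_at k (swap_at (Suc k) (swap_at k j))) t = 0" if b: "basis_index n q j t" for j t
  proof (rule ccontr)
    assume "\<not> ?thesis"
    then have "basis_index n q (swap_at k (swap_at (Suc k) (swap_at k j))) t"
      using proj_moduleD[OF n q f] by blast
    from basisD(1)[OF n q this] have "adm n (j ! (n - 1)) (swap_at k (swap_at (Suc k) (swap_at k j)))"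
      using basisD(3)[OF n q b] k by (simp add: swap_last[OF n q] del: One_nat_def)
    then show False using adm_not_reverse[OF basisD(1)[OF n q b] k] by simp
  qed
  have zero': "f (swap_at (Suc k) (swap_at k (swap_at (Suc k) j))) t = 0" if b: "basis_index n q j t" for j t
    using zero[OF b] swap_at_braid[of k j] basisD(3)[OF n q b] k by simp
  show "psi_op n q k (psi_op n q (Suc k) (psi_op n q k f)) = 0"
    "psi_op n q (Suc k) (psi_op n q k (psi_op n q (Suc k) f)) = 0"
    using k by (simp_all add: fun_eq_iff psi_op_inner zero zero')
qed

text \<open>Both sides vanish. On the first, \<open>j\<close> would end in \<open>p - 1\<close> and
  \<open>p + 1\<close> in some order before \<open>p\<close>, and after the three swaps both
  \<open>p\<close> and one of them lie on the same side of the new ending. On the second, the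
  endings would run through three consecutive values with the outer two within 1 of
  \<open>q\<close>; the middle one is then \<open>q\<close>, and no last crossing leads into the
  head.\<close>

lemma op_braid_last:
  assumes f: "f \<in> proj_module n q"
  shows "psi_op n q (n - 2) (psi_op n q (n - 1) (psi_op n q (n - 2) f)) = 0"
    "psi_op n q (n - 1) (psi_op n q (n - 2) (psi_op n q (n - 1) f)) = 0"
proof -
  have k: "0 < n - 2" "n - 2 < n - 1" "n - 2 < n" "n - 2 - 1 = n - 3" using n by auto
  have zero1: "f (swap_at (n - 2) (swap_at (n - 1) (swap_at (n - 2) j))) False = 0"
    if b: "basis_index n q j t" and b1: "basis_index n q (swap_at (n - 2) j) t" for j t
  proof (rule ccontr)
    let ?i = "swap_at (n - 2) j" and ?p = "j ! (n - 1)"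
    assume "\<not> ?thesis"
    then have "basis_index n q (swap_at (n - 2) (swap_at (n - 1) ?i)) False"
      using proj_moduleD[OF n q f] by blast
    note br = basisD(1)[OF n q this]
    note len = basisD(3)[OF n q b]
    have leni: "length ?i = n" "length (swap_at (n - 1) ?i) = n" using len by simp_all
    have r: "adm n (?i ! (n - 2)) (swap_at (n - 2) (swap_at (n - 1) ?i))"
      using br unfolding swap_last[OF n q leni(2) k(1,2)] swap_last2(1)[OF n q leni(1)] .
    have i: "adm n ?p ?i"
      using basisD(1)[OF n q b1] unfolding swap_last[OF n q len k(1,2)] .
    note j = basisD(1)[OF n q b]
    have vals: "?i ! (n - 2) = j ! (n - 3)" "swap_at (n - 1) ?i ! (n - 3) = j ! (n - 2)"
      "swap_at (n - 1) ?i ! (n - 2) = ?p"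
      using n len by (auto simp: nth_swap_at numeral_2_eq_2 numeral_3_eq_3)
    show False
      using adm_swap_iff[OF j k(1,2)] i adm_swap_last(2)[OF i n] adm_swap_last(2)[OF j n] r
        adm_swap_iff[OF adm_swap_last(1)[OF i n] k(1,2)] unfolding vals k(4) by auto
  qed
  have zero2: "f (swap_at (n - 1) (swap_at (n - 2) (swap_at (n - 1) j))) False = 0"
    if b: "basis_index n q j t" and b1: "basis_index n q (swap_at (n - 1) j) False"
      and b2: "basis_index n q (swap_at (n - 2) (swap_at (n - 1) j)) False" and qy: "j ! (n - 2) \<noteq> q" for j t
  proof (rule ccontr)
    let ?s = "swap_at (n - 1) j" and ?y = "j ! (n - 2)" and ?p = "j ! (n - 1)" and ?x = "j ! (n - 3)"
    assume "\<not> ?thesis"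
    then have r: "basis_index n q (swap_at (n - 1) (swap_at (n - 2) ?s)) False"
      using proj_moduleD[OF n q f] by blast
    note len = basisD(3)[OF n q b] and j = basisD(1)[OF n q b]
    have s: "adm n ?y ?s" using adm_swap_last(1)[OF j n] .
    have m: "adm n ?y (swap_at (n - 2) ?s)"
      using basisD(1)[OF n q b2] swap_last[OF n q _ k(1,2), of ?s] swap_last2(1)[OF n q len] len
      by (simp del: One_nat_def)
    have vals: "?s ! (n - 2) = ?p" "?s ! (n - 3) = ?x" "swap_at (n - 2) ?s ! (n - 2) = ?x"
      "swap_at (n - 1) (swap_at (n - 2) ?s) ! (n - 1) = ?x"
      using n len by (auto simp: nth_swap_at numeral_2_eq_2 numeral_3_eq_3)
    have "?x \<le> Suc q" "q \<le> Suc ?x" using r unfolding basis_index_def vals by auto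
    moreover have "?p \<le> Suc q" "q \<le> Suc ?p" using b unfolding basis_index_def by (auto split: if_splits)
    ultimately show False
      using adm_swap_iff[OF s k(1,2)] m adm_swap_last(2)[OF j n] adm_swap_last(2)[OF m n] qy
      unfolding vals k(4) by auto
  qed
  show "psi_op n q (n - 2) (psi_op n q (n - 1) (psi_op n q (n - 2) f)) = 0"
  proof (intro ext)
    fix j t
    have "psi_op n q (n - 1) (psi_op n q (n - 2) f) (swap_at (n - 2) j) t = 0"
      if "basis_index n q j t" "basis_index n q (swap_at (n - 2) j) t"
    proof -
      have "psi_op n q (n - 2) f (swap_at (n - 1) (swap_at (n - 2) j)) False = 0"
        using zero1[OF that] k by (simp add: psi_op_inner del: One_nat_def)
      then show ?thesis by (rule psi_op_last_zero)
    qed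
    then show "psi_op n q (n - 2) (psi_op n q (n - 1) (psi_op n q (n - 2) f)) j t = 0 j t"
      using k psi_op_off[of "swap_at (n - 2) j" t] by (auto simp: psi_op_inner simp del: One_nat_def)
  qed
  show "psi_op n q (n - 1) (psi_op n q (n - 2) (psi_op n q (n - 1) f)) = 0"
  proof (intro ext)
    fix j t
    have "psi_op n q (n - 2) (psi_op n q (n - 1) f) (swap_at (n - 1) j) False = 0"
      if b: "basis_index n q j t"
    proof (cases "basis_index n q (swap_at (n - 1) j) False \<and> basis_index n q (swap_at (n - 2) (swap_at (n - 1) j)) False \<and> j ! (n - 2) \<noteq> q")
      case True
      then have "psi_op n q (n - 1) f (swap_at (n - 2) (swap_at (n - 1) j)) False = 0"
        using zero2[OF b] by (simp add: psi_op_def del: One_nat_def)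
      then show ?thesis using k by (simp add: psi_op_inner del: One_nat_def)
    next
      case False
      have "swap_at (n - 2) (swap_at (n - 1) j) ! (n - 1) = j ! (n - 2)"
        using k basisD(3)[OF n q b] by (simp add: swap_last[OF n q] swap_last2[OF n q] del: One_nat_def)
      then show ?thesis using False k by (auto simp: psi_op_inner psi_op_off psi_op_def[of n q "n - 1"] simp del: One_nat_def)
    qed
    then show "psi_op n q (n - 1) (psi_op n q (n - 2) (psi_op n q (n - 1) f)) j t = 0 j t"
      by (cases "basis_index n q j t") (simp_all add: psi_op_last_zero psi_op_off del: One_nat_def)
  qed
qed

lemma op_braid:
  assumes f: "f \<in> proj_module n q" and k: "0 < k" "Suc k < n"
  shows "psi_op n q k (psi_op n q (Suc k) (psi_op n q k f)) =
    psi_op n q (Suc k) (psi_op n q k (psi_op n q (Suc k) f))"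
proof (cases "Suc k = n - 1")
  case True
  then have "k = n - 2" by simp
  then show ?thesis using op_braid_last[OF f] True by metis
next
  case False
  then show ?thesis using op_braid_inner[OF f k(1)] k by simp
qed

lemma op_zero [simp]: "psi_op n q k 0 = 0" "y_op n q k 0 = 0"
  by (simp_all add: psi_op_def y_op_def fun_eq_iff)

lemma sum_e_op:
  assumes f: "f \<in> proj_module n q"
  shows "(\<Sum>i\<in>klr_seqs n. e_op i f) = f"
proof (intro ext)
  fix j t
  have "(\<Sum>i\<in>I. e_op i f) j t = (\<Sum>i\<in>I. e_op i f j t)" for I
    by (induction I rule: infinite_finite_induct) auto
  also have "(\<Sum>i\<in>klr_seqs n. e_op i f j t) = (if j \<in> klr_seqs n then f j t else 0)"
    by (simp add: e_op_def)
  finally show "(\<Sum>i\<in>klr_seqs n. e_op i f) j t = f j t"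
    using proj_moduleD[OF n q f, of j t] basisD(2)[OF n q] by auto
qed

lemma e_op_not_adm:
  assumes f: "f \<in> proj_module n q" and "\<not> adm n (i ! (n - 1)) i"
  shows "e_op i f = 0"
  using proj_moduleD[OF n q f] basisD(1)[OF n q] assms(2)
  by (auto simp: fun_eq_iff e_op_def simp del: One_nat_def)

lemma op_psi_sq:
  assumes f: "f \<in> proj_module n q" and k: "0 < k" "k < n"
  shows "\<not> nbr n (i ! (k - 1)) (i ! k) \<Longrightarrow> psi_op n q k (psi_op n q k (e_op i f)) = e_op i f"
    "arrow n (i ! (k - 1)) (i ! k) \<Longrightarrow>
      psi_op n q k (psi_op n q k (e_op i f)) = y_op n q (k + 1) (e_op i f) - y_op n q k (e_op i f)"
    "arrow n (i ! k) (i ! (k - 1)) \<Longrightarrow>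
      psi_op n q k (psi_op n q k (e_op i f)) = y_op n q k (e_op i f) - y_op n q (k + 1) (e_op i f)"
proof -
  have "(\<not> nbr n (i ! (k - 1)) (i ! k) \<longrightarrow> psi_op n q k (psi_op n q k (e_op i f)) = e_op i f) \<and>
    (arrow n (i ! (k - 1)) (i ! k) \<longrightarrow>
      psi_op n q k (psi_op n q k (e_op i f)) = y_op n q (k + 1) (e_op i f) - y_op n q k (e_op i f)) \<and>
    (arrow n (i ! k) (i ! (k - 1)) \<longrightarrow>
      psi_op n q k (psi_op n q k (e_op i f)) = y_op n q k (e_op i f) - y_op n q (k + 1) (e_op i f))"
  proof (cases "k < n - 1")
    case True
    then show ?thesis
      using op_psi_sq_inner[OF n q f k(1) True, of i] op_y_zero[OF n q, of k "e_op i f"]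
        op_y_zero[OF n q, of "k + 1" "e_op i f"] by (auto simp: nbr_def)
  next
    case False
    then have kn: "k = n - 1" "k - 1 = n - 2" "k + 1 = n" using k by auto
    have zero: "psi_op n q k (psi_op n q k (e_op i f)) = 0" "e_op i f = 0" "y_op n q l (e_op i f) = 0"
      if "\<not> adm n (i ! (n - 1)) i" for l
      by (simp_all only: e_op_not_adm[OF f that] op_zero)
    have y0: "y_op n q k (e_op i f) = 0" by (rule op_y_zero[OF n q k(2)])
    have h1: "psi_op n q k (psi_op n q k (e_op i f)) = e_op i f" if nb: "\<not> nbr n (i ! (k - 1)) (i ! k)"
    proof (cases "adm n (i ! (n - 1)) i")
      case True
      then have "nbr n (i ! (n - 2)) (i ! (n - 1))"
        using adm_swap_last(2)[OF True n] klr_seqs_nth(2)[OF admD(1)[OF True], of "n - 2"]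
          adm_bounds[OF True] n unfolding nbr_def arrow_def by (elim disjE) simp_all
      then show ?thesis using nb unfolding kn(2) unfolding kn(1) by simp
    qed (simp add: zero)
    have h2: "psi_op n q k (psi_op n q k (e_op i f)) = y_op n q (k + 1) (e_op i f) - y_op n q k (e_op i f)"
      if ar: "arrow n (i ! (k - 1)) (i ! k)"
    proof (cases "adm n (i ! (n - 1)) i")
      case True
      have "i ! (n - 1) = Suc (i ! (n - 2))"
        using ar adm_bounds[OF True] n unfolding kn(2) unfolding kn(1) arrow_def by auto
      then show ?thesis
        unfolding y0 kn(3) unfolding kn(1) by (simp add: fun_eq_iff op_psi_sq_last[OF n q f] del: One_nat_def)
    qed (simp add: zero)
    have h3: "psi_op n q k (psi_op n q k (e_op i f)) = y_op n q k (e_op i f) - y_op n q (k + 1) (e_op i f)"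
      if ar: "arrow n (i ! k) (i ! (k - 1))"
    proof (cases "adm n (i ! (n - 1)) i")
      case True
      have "i ! (n - 2) \<noteq> 0" using klr_seqs_nth(3)[OF admD(1)[OF True], of "n - 2" 0] admD(2)[OF True] n by auto
      then have "i ! (n - 2) = Suc (i ! (n - 1))"
        using ar n unfolding kn(2) unfolding kn(1) arrow_def by auto
      then have "i ! (n - 1) \<noteq> Suc (i ! (n - 2))" by simp
      then show ?thesis
        unfolding y0 kn(3) unfolding kn(1) by (simp add: fun_eq_iff op_psi_sq_last[OF n q f] del: One_nat_def)
    qed (simp add: zero)
    show ?thesis using h1 h2 h3 by blast
  qed
  then show "\<not> nbr n (i ! (k - 1)) (i ! k) \<Longrightarrow> psi_op n q k (psi_op n q k (e_op i f)) = e_op i f"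
    "arrow n (i ! (k - 1)) (i ! k) \<Longrightarrow>
      psi_op n q k (psi_op n q k (e_op i f)) = y_op n q (k + 1) (e_op i f) - y_op n q k (e_op i f)"
    "arrow n (i ! k) (i ! (k - 1)) \<Longrightarrow>
      psi_op n q k (psi_op n q k (e_op i f)) = y_op n q k (e_op i f) - y_op n q (k + 1) (e_op i f)"
    by blast+
qed

lemma klr_action_klr_op: "klr_action (vec_scale :: 'k::field \<Rightarrow> _) (klr_op n q) n (proj_module n q)"
proof -
  interpret free_action "vec_scale :: 'k \<Rightarrow> _" "klr_op n q" by (rule free_action_klr_op)
  note opc = ops_closed[OF n q]
  show ?thesis
  proof
    show "0 < n" using n by simp
    show "(0 :: 'k klr_vec) \<in> proj_module n q" by (simp add: proj_module_def)
    show "f + g \<in> proj_module n q" "vec_scale c f \<in> proj_module n q"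
      if "f \<in> proj_module n q" "g \<in> proj_module n q" for f g :: "'k klr_vec" and c
      using that by (auto simp: proj_module_def vec_scale_def)
    show "klr_op n q g f \<in> proj_module n q" if "f \<in> proj_module n q" for g and f :: "'k klr_vec"
      using opc[OF that] by (cases g) auto
    fix f :: "'k klr_vec" assume f: "f \<in> proj_module n q"
    show "klr_op n q (GY 1) (klr_op n q (GE i) f) = 0" for i
      using op_y_zero[OF n q, of 1] n by simp
    show "klr_op n q (GE i) f = 0" if "entry i 1 \<noteq> 0" for i
    proof -
      have "\<not> adm n (i ! (n - 1)) i" using that admD(2)[of n "i ! (n - 1)" i] by auto
      then show ?thesis using e_op_not_adm[OF f] by simp
    qed
    fix a b :: "'k klr_free" assume "(a, b) \<in> klr_rels n"
    then show "act a f = act b f"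
    proof cases
      case (idem i j)
      then show ?thesis by (auto simp: e_op_def fun_eq_iff)
    next
      case unit
      then show ?thesis using sum_e_op[OF f] by (simp add: act_sum_left)
    next
      case (y_e k i)
      then show ?thesis by (auto simp: e_op_def y_op_def fun_eq_iff)
    next
      case (psi_e k i)
      then have "0 < k" "k < n" using n by auto
      then show ?thesis using psi_e op_psi_e[OF n q, of i k f] by simp
    next
      case (y_y k l)
      then show ?thesis by (auto simp: y_op_def fun_eq_iff)
    next
      case (psi_y k l)
      show ?thesis
      proof (cases "l = n")
        case True
        have "0 < k" "k < n - 1" using psi_y True by auto
        then show ?thesis using psi_y True op_psi_y[OF n q f, of k] by simp
      next
        case False
        then show ?thesis using psi_y False by (simp add: op_y_zero[OF n q])
      qed
    next
      case (psi_psi k l)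
      then have "Suc k < l \<or> Suc l < k" by auto
      then show ?thesis
        using psi_psi op_psi_psi[OF n q f, of k l] op_psi_psi[OF n q f, of l k] n by auto
    next
      case (psi_y_Suc k i)
      have "psi_op n q k (y_op n q (k + 1) (e_op i f)) = 0"
      proof (cases "k + 1 = n")
        case True
        then show ?thesis using op_psi_y_last[OF n q, of "e_op i f"] by auto
      next
        case False
        then have "k + 1 < n" using psi_y_Suc n by auto
        then show ?thesis by (simp add: op_y_zero[OF n q])
      qed
      moreover have "k < n" using psi_y_Suc n by auto
      ultimately show ?thesis using psi_y_Suc by (simp add: op_y_zero[OF n q])
    next
      case (y_Suc_psi k i)
      have "y_op n q (k + 1) (psi_op n q k (e_op i f)) = 0"
      proof (cases "k + 1 = n")
        case True
        then show ?thesis using op_y_psi_last[OF n q, of "e_op i f"] by auto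
      next
        case False
        then have "k + 1 < n" using y_Suc_psi n by auto
        then show ?thesis by (simp add: op_y_zero[OF n q])
      qed
      moreover have "k < n" using y_Suc_psi n by auto
      ultimately show ?thesis using y_Suc_psi by (simp add: op_y_zero[OF n q])
    next
      case (braid k i)
      then show ?thesis using op_braid[OF opc(1)[OF f], of k i] n by simp
    next
      case (psi_sq_none k i)
      then have "psi_op n q k (psi_op n q k (e_op i f)) = e_op i f"
        using n by (intro op_psi_sq(1)[OF f]) (auto simp: nbr_def)
      then show ?thesis using psi_sq_none by (simp add: power2_eq_square)
    next
      case (psi_sq_right k i)
      then have "psi_op n q k (psi_op n q k (e_op i f)) = y_op n q (k + 1) (e_op i f) - y_op n q k (e_op i f)"
        using n by (intro op_psi_sq(2)[OF f]) auto
      then show ?thesis using psi_sq_right by (simp add: power2_eq_square)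
    next
      case (psi_sq_left k i)
      then have "psi_op n q k (psi_op n q k (e_op i f)) = y_op n q k (e_op i f) - y_op n q (k + 1) (e_op i f)"
        using n by (intro op_psi_sq(3)[OF f]) auto
      then show ?thesis using psi_sq_left by (simp add: power2_eq_square)
    next
      case (psi_sq_both k i)
      then have "n = 2" using n unfolding arrow_def by auto
      then show ?thesis using n by simp
    qed
  qed
qed

text \<open>The last dot moves the head vector at the base sequence to its socle vector, where the
  coordinate is 1.\<close>

lemma y_e_base_nonzero:
  "cyc_proj n (fY n * fE (base_seq n q)) \<noteq> \<zero>\<^bsub>cyc_algebra n :: ('k::field, 'k cyc) module\<^esub>"
proof
  interpret klr_action "vec_scale :: 'k \<Rightarrow> _" "klr_op n q" n "proj_module n q"
    by (rule klr_action_klr_op)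
  let ?c = "base_seq n q"
  have c: "adm n q ?c" using q by (rule adm_base_seq)
  assume zero: "cyc_proj n (fY n * fE ?c) = \<zero>\<^bsub>cyc_algebra n :: ('k, 'k cyc) module\<^esub>"
  define f :: "'k klr_vec" where "f = (\<lambda>j t. if j = ?c \<and> \<not> t then 1 else 0)"
  have bT: "basis_index n q ?c True" and bF: "basis_index n q ?c False"
    using c admD(3)[OF c] by (auto simp: basis_index_def simp del: One_nat_def)
  then have "f \<in> proj_module n q" by (auto simp: proj_module_def f_def)
  moreover have "fY n * fE ?c \<in> carrier (klr_free_algebra n :: ('k, 'k klr_free) module)"
    using n admD(1)[OF c] by (intro klr_free_closed) auto
  ultimately have "act (fY n * fE ?c) f = 0" using zero by (intro act_eq_zero)
  then have "act (fY n * fE ?c) f ?c True = 0" by simp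
  then show False using bT by (simp add: y_op_def e_op_def f_def)
qed

end

section \<open>The generators as ring elements\<close>

definition cyc_el :: "nat \<Rightarrow> 'k klr_free \<Rightarrow> 'k::field cyc_prod" where
  "cyc_el n p = cyc_in n (cyc_proj n p)"

context
  fixes n :: nat
  assumes n_pos: "0 < n"
begin

lemma cyc_el_hom:
  fixes p q :: "'k::field klr_free"
  assumes "p \<in> carrier (klr_free_algebra n)" "q \<in> carrier (klr_free_algebra n)"
  shows "cyc_el n (p + q) = cyc_el n p + cyc_el n q"
    "cyc_el n (p * q) = cyc_el n p * cyc_el n q"
    "cyc_el n (Poly_Mapping.single 0 c * p) = cyc_scale c (cyc_el n p)"
    "cyc_el n (p - q) = cyc_el n p - cyc_el n q"
proof -
  have add: "cyc_el n (p + q) = cyc_el n p + cyc_el n q"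
    if "p \<in> carrier (klr_free_algebra n)" "q \<in> carrier (klr_free_algebra n)" for p q :: "'k klr_free"
    using that unfolding cyc_el_def
    by (simp add: cyc_proj_hom[OF n_pos] cyc_in_hom[OF n_pos] cyc_proj_closed[OF n_pos])
  show "cyc_el n (p + q) = cyc_el n p + cyc_el n q" by (rule add) fact+
  show "cyc_el n (p * q) = cyc_el n p * cyc_el n q"
    using assms unfolding cyc_el_def
    by (simp add: cyc_proj_hom[OF n_pos] cyc_in_hom[OF n_pos] cyc_proj_closed[OF n_pos])
  show "cyc_el n (Poly_Mapping.single 0 c * p) = cyc_scale c (cyc_el n p)"
    using assms unfolding cyc_el_def
    by (simp add: cyc_proj_hom(3)[OF n_pos assms] cyc_in_hom(3)[OF n_pos cyc_proj_closed[OF n_pos] cyc_proj_closed[OF n_pos]])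
  have "cyc_el n (p - q + q) = cyc_el n (p - q) + cyc_el n q"
    using assms by (intro add klr_free_closed)
  then show "cyc_el n (p - q) = cyc_el n p - cyc_el n q" by simp
qed

lemma cyc_el_zero: "cyc_el n (0 :: 'k::field klr_free) = 0"
  using cyc_el_hom(4)[OF klr_free_closed(1,1), where ?'k = 'k] by simp

lemma cyc_el_sum:
  fixes f :: "'a \<Rightarrow> 'k::field klr_free"
  assumes "\<And>i. i \<in> I \<Longrightarrow> f i \<in> carrier (klr_free_algebra n)"
  shows "cyc_el n (sum f I) = (\<Sum>i\<in>I. cyc_el n (f i))"
  using assms
  by (induction I rule: infinite_finite_induct)
    (auto simp: cyc_el_zero cyc_el_hom sum_klr_free_closed)

lemma cyc_el_rel: "(a, b) \<in> klr_rels n \<Longrightarrow> cyc_el n a = cyc_el n (b :: 'k::field klr_free)"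
  unfolding cyc_el_def using cyc_proj_rel[OF n_pos] by metis

lemma cyc_el_unit:
  fixes p :: "'k::field klr_free"
  assumes "p \<in> carrier (klr_free_algebra n)"
  shows "(\<Sum>i\<in>klr_seqs n. cyc_el n (fE i)) * cyc_el n p = cyc_el n p"
    "cyc_el n p * (\<Sum>i\<in>klr_seqs n. cyc_el n (fE i)) = cyc_el n p"
    "(\<Sum>i\<in>klr_seqs n. cyc_el n (fE i)) = cyc_el n (1 :: 'k klr_free)"
proof -
  show u: "(\<Sum>i\<in>klr_seqs n. cyc_el n (fE i)) = cyc_el n (1 :: 'k klr_free)"
    using cyc_el_rel[OF klr_rels.unit, where ?'k = 'k] cyc_el_sum[of "klr_seqs n" "fE :: _ \<Rightarrow> 'k klr_free"]
    by (simp add: klr_free_closed)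
  show "(\<Sum>i\<in>klr_seqs n. cyc_el n (fE i)) * cyc_el n p = cyc_el n p"
    "cyc_el n p * (\<Sum>i\<in>klr_seqs n. cyc_el n (fE i)) = cyc_el n p"
    unfolding u using cyc_el_hom(2)[OF klr_free_closed(2) assms] cyc_el_hom(2)[OF assms klr_free_closed(2)]
    by simp_all
qed

end

lemma klr_module_cyc:
  assumes n: "1 < n"
  shows "klr_module n (\<lambda>i. cyc_el n (fE i :: 'k::field klr_free)) (\<lambda>k. cyc_el n (fY k))
    (\<lambda>k. cyc_el n (fPsi k)) cyc_scale"
proof -
  interpret vs: Vector_Spaces.vector_space "cyc_scale :: 'k \<Rightarrow> _" by (rule vector_space_cyc_scale)
  have n0: "0 < n" using n by simp
  note cl = klr_free_closed(4,5,8,9,10)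
  note mult = cyc_el_hom(2)[OF n0, symmetric]
  have e2: "k + 1 \<in> {1..n}" "k \<in> {1..n}" if "k \<in> {1..n-1}" for k using that n by auto
  note rel = cyc_el_rel[OF n0] and fct = cl e2 swap_at_klr_seqs
  show ?thesis
  proof (unfold_locales, goal_cases)
    case 1
    then show ?case using n .
  next
    case (2 i j)
    then show ?case using rel[OF klr_rels.idem[OF 2], where ?'k = 'k] cyc_el_zero[OF n0, where ?'k = 'k]
      by (simp add: mult fct split: if_splits)
  next
    case (3 k)
    then show ?case using cyc_el_unit[OF n0 klr_free_closed(9), where ?'k = 'k] by simp
  next
    case (4 k i)
    then show ?case using rel[OF klr_rels.y_e[OF 4], where ?'k = 'k] by (simp add: mult fct)
  next
    case (5 k i)
    then have "swap_at k i \<in> klr_seqs n" by (intro swap_at_klr_seqs) auto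
    then show ?case using 5 rel[OF klr_rels.psi_e[OF 5], where ?'k = 'k] by (simp add: mult cl)
  next
    case (6 k l)
    then show ?case using rel[OF klr_rels.psi_y[OF 6], where ?'k = 'k] by (simp add: mult fct)
  next
    case (7 k l)
    then show ?case using rel[OF klr_rels.psi_psi[OF 7], where ?'k = 'k] by (simp add: mult fct)
  next
    case (8 k i)
    then show ?case using rel[OF klr_rels.psi_y_Suc[OF 8], where ?'k = 'k] e2[OF 8(1)] by (simp add: mult cl)
  next
    case (9 k i)
    then show ?case using rel[OF klr_rels.y_Suc_psi[OF 9], where ?'k = 'k] e2[OF 9(1)] by (simp add: mult cl)
  next
    case (10 k i)
    then show ?case using rel[OF klr_rels.braid[OF 10], where ?'k = 'k] by (simp add: mult cl)
  next
    case (11 k i)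
    then show ?case using rel[OF klr_rels.psi_sq_none[OF 11], where ?'k = 'k]
      by (simp add: mult cl power2_eq_square)
  next
    case (12 k i)
    then show ?case using rel[OF klr_rels.psi_sq_right[OF 12], where ?'k = 'k] e2[OF 12(1)]
      by (simp add: mult cl power2_eq_square cyc_el_hom(4)[OF n0, symmetric])
  next
    case (13 k i)
    then show ?case using rel[OF klr_rels.psi_sq_left[OF 13], where ?'k = 'k] e2[OF 13(1)]
      by (simp add: mult cl power2_eq_square cyc_el_hom(4)[OF n0, symmetric])
  next
    case (14 k i)
    then show ?case using rel[OF klr_rels.psi_sq_both[OF 14], where ?'k = 'k] e2[OF 14(1)]
      by (simp add: mult cl power2_eq_square cyc_el_hom(4)[OF n0, symmetric])
  next
    case (15 i)
    have "cyc_el n (fY 1 * fE i :: 'k klr_free) = 0"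
      unfolding cyc_el_def cyc_proj_cyc_rel(1)[OF n0 15]
      using cyc_el_zero[OF n0, where ?'k = 'k] cyc_proj_0[OF n0, where ?'k = 'k] by (simp add: cyc_el_def)
    then show ?case using 15 n by (simp add: mult cl)
  next
    case (16 i)
    show ?case
      unfolding cyc_el_def cyc_proj_cyc_rel(2)[OF n0 16]
      using cyc_el_zero[OF n0, where ?'k = 'k] cyc_proj_0[OF n0, where ?'k = 'k] by (simp add: cyc_el_def)
  next
    case 17
    then show ?case by (rule cyc_scale_mult_left)
  next
    case 18
    then show ?case by (rule cyc_scale_mult_right)
  qed
qed

section \<open>The map \<open>hat\<close> on sequences\<close>

lemma length_hat: "i \<noteq> [] \<Longrightarrow> length (hat i) = Suc (length i)"
  by (simp add: hat_def)

lemma nth_hat: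
  "hat i ! 0 = 0" "hat i ! 1 = 1" "0 < l \<Longrightarrow> l < length i \<Longrightarrow> hat i ! Suc l = Suc (i ! l)"
  by (auto simp: hat_def nth_tl nth_Cons' gr0_conv_Suc)

context
  fixes n :: nat
  assumes n: "2 < n"
begin

lemma hat_klr_seqs:
  assumes i: "i \<in> klr_seqs (n - 1)" "i ! 0 = 0"
  shows "hat i \<in> klr_seqs n"
proof -
  note s = klr_seqs_nth[OF i(1)]
  have pos: "i ! l \<noteq> 0" if "0 < l" "l < n - 1" for l using s(3)[of l 0] i(2) that by auto
  have h: "hat i ! l = (if l = 0 then 0 else if l = 1 then 1 else Suc (i ! (l - 1)))" if "l < n" for l
    using nth_hat(1,2)[of i] nth_hat(3)[of "l - 1" i] that s(1) by auto
  show ?thesis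
  proof (rule klr_seqsI)
    show "length (hat i) = n" using n s(1) by (subst length_hat) auto
    show "hat i ! m < n" if "m < n" for m
    proof (cases "m = 0")
      case False
      then have "m - 1 < n - 1" using that by auto
      then show ?thesis using h[OF that] n s(2)[of "m - 1"] by auto
    qed (use h n in auto)
    show "hat i ! l \<noteq> hat i ! m" if "l < m" "m < n" for l m
    proof (cases "l \<le> 1")
      case True
      then show ?thesis using that h[of l] h[of m] pos[of "m - 1"] by auto
    next
      case False
      then show ?thesis using that h[of l] h[of m] s(3)[of "l - 1" "m - 1"] by auto
    qed
  qed
qed

lemma hat_inj:
  assumes "i \<in> klr_seqs (n - 1)" "i ! 0 = 0" "j \<in> klr_seqs (n - 1)" "j ! 0 = 0" "hat i = hat j"
  shows "i = j"
proof -
  have "tl i = tl j" using assms(5) by (simp add: hat_def)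
  moreover have "i \<noteq> []" "j \<noteq> []" using assms klr_seqs_nth(1) n by fastforce+
  ultimately show ?thesis using assms(2,4) by (cases i; cases j) auto
qed

lemma hat_surj:
  assumes j: "j \<in> klr_seqs n" "j ! 0 = 0" "j ! 1 = 1"
  shows "\<exists>i. i \<in> klr_seqs (n - 1) \<and> i ! 0 = 0 \<and> hat i = j"
proof -
  note s = klr_seqs_nth[OF j(1)]
  define i where "i = 0 # map (\<lambda>x. x - 1) (drop 2 j)"
  have nth: "i ! l = (if l = 0 then 0 else j ! Suc l - 1)" if "l < n - 1" for l
    unfolding i_def using that s(1) by (cases l) auto
  have big: "1 < j ! l" if "1 < l" "l < n" for l
    using s(3)[of l 0] s(3)[of l 1] that j by (cases "j ! l = 0"; cases "j ! l = 1") auto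
  have len: "length i = n - 1" using s(1) n by (simp add: i_def)
  have "i \<in> klr_seqs (n - 1)"
  proof (rule klr_seqsI)
    show "length i = n - 1" by (rule len)
    show "i ! m < n - 1" if "m < n - 1" for m
    proof (cases "m = 0")
      case False
      then have "Suc m < n" "1 < Suc m" using that by auto
      then have "j ! Suc m < n" "1 < j ! Suc m" using s(2) big by blast+
      then show ?thesis using nth[OF that] False by simp
    qed (use nth[OF that] n in auto)
    show "i ! l \<noteq> i ! m" if "l < m" "m < n - 1" for l m
    proof -
      have "1 < j ! Suc m" using big[of "Suc m"] that by auto
      moreover have "1 < j ! Suc l" "j ! Suc l \<noteq> j ! Suc m" if "l \<noteq> 0"
        using big[of "Suc l"] s(3)[of "Suc l" "Suc m"] that \<open>l < m\<close> \<open>m < n - 1\<close> by auto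
      ultimately show ?thesis using nth[of l] nth[of m] that by auto
    qed
  qed
  moreover have "hat i = j"
  proof (rule nth_equalityI)
    show "length (hat i) = length j" using len n s(1) by (subst length_hat) auto
    fix l assume "l < length (hat i)"
    then have l: "l < n" using len n by (subst (asm) length_hat) auto
    have "l = 0 \<or> l = 1 \<or> (\<exists>l'. l = Suc l' \<and> 0 < l')" by (cases l) auto
    then show "hat i ! l = j ! l"
      using nth_hat(1,2)[of i] nth_hat(3)[of "l - 1" i] nth[of "l - 1"] big[of l] l len j by auto
  qed
  ultimately show ?thesis by (auto simp: i_def)
qed

lemma hat_swap:
  assumes i: "i \<in> klr_seqs (n - 1)" "i ! 0 = 0" and k: "1 < k" "k < n - 1"
  shows "swap_at (Suc k) (hat i) = hat (swap_at k i)" "swap_at k i ! 0 = 0"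
proof -
  have len: "length i = n - 1" "i \<noteq> []" "swap_at k i \<noteq> []"
    using klr_seqs_nth(1)[OF i(1)] n by (auto simp flip: length_0_conv)
  show "swap_at k i ! 0 = 0" using k i(2) len by (subst nth_swap_at) auto
  show "swap_at (Suc k) (hat i) = hat (swap_at k i)"
  proof (rule nth_equalityI)
    show "length (swap_at (Suc k) (hat i)) = length (hat (swap_at k i))" using len by (simp add: length_hat)
    fix l assume "l < length (swap_at (Suc k) (hat i))"
    then have l: "l < n" using len n by (simp add: length_hat)
    have lh: "Suc k < length (hat i)" "length (hat i) = n" using len k n by (auto simp: length_hat)
    consider "l = 0" | "l = 1" | "1 < l" by linarith
    then show "swap_at (Suc k) (hat i) ! l = hat (swap_at k i) ! l"
    proof cases
      case 3
      then obtain l' where l': "l = Suc l'" "0 < l'" by (cases l) auto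
      have "hat i ! Suc k = Suc (i ! k)" "hat i ! Suc l' = Suc (i ! l')"
        "hat (swap_at k i) ! Suc l' = Suc (swap_at k i ! l')"
        using l l' len k by (auto intro!: nth_hat(3))
      moreover have "hat i ! k = Suc (i ! (k - 1))" using nth_hat(3)[of "k - 1" i] k len by auto
      ultimately show ?thesis
        using l' l lh k len by (subst nth_swap_at_Suc) (auto simp: nth_swap_at)
    qed (use lh l k nth_hat(1,2)[of i] nth_hat(1,2)[of "swap_at k i"] in \<open>auto simp: nth_swap_at_Suc\<close>)
  qed
qed

lemma hat_base_seq:
  assumes "0 < p" "p < n - 1"
  shows "hat (base_seq (n - 1) p) = base_seq n (Suc p)"
proof (rule nth_equalityI)
  have len: "length (base_seq (n - 1) p) = n - 1" "base_seq (n - 1) p \<noteq> []" "length (base_seq n (Suc p)) = n"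
    using assms length_base_seq[of p "n - 1"] length_base_seq[of "Suc p" n] by auto
  then show "length (hat (base_seq (n - 1) p)) = length (base_seq n (Suc p))"
    using n by (simp add: length_hat)
  fix l assume "l < length (hat (base_seq (n - 1) p))"
  then have l: "l < n" using len n by (simp add: length_hat)
  consider "l = 0" | "l = 1" | "1 < l" by linarith
  then show "hat (base_seq (n - 1) p) ! l = base_seq n (Suc p) ! l"
  proof cases
    case 3
    then obtain l' where l': "l = Suc l'" "0 < l'" by (cases l) auto
    have "hat (base_seq (n - 1) p) ! Suc l' = Suc (base_seq (n - 1) p ! l')"
      using l l' len by (intro nth_hat(3)) auto
    then show ?thesis using l l' assms by (auto simp: nth_base_seq)
  qed (use assms l nth_hat(1,2)[of "base_seq (n - 1) p"] in \<open>auto simp: nth_base_seq\<close>)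
qed

text \<open>Away from 0 both cycles are lines with arrows from \<open>u\<close> to
  \<open>u + 1\<close>. Arrows at 0 concern only the first crossing of the small algebra, which is
  treated separately.\<close>

lemma hat_arrow:
  "u \<noteq> 0 \<Longrightarrow> v \<noteq> 0 \<Longrightarrow> arrow n (Suc u) (Suc v) \<longleftrightarrow> arrow (n - 1) u v"
  using n by (auto simp: arrow_def)

end

section \<open>Images of the generators in the corner\<close>

context klr_module
begin

text \<open>Vanishing idempotents are included, which keeps the set independent of the field;
  \<open>component_corner_unit\<close> shows that the sum is the same.\<close>

definition corner_seqs :: "nat list set" where
  "corner_seqs = {i \<in> klr_seqs n. i ! 0 = 0 \<and> i ! 1 = 1}"

definition corner_unit :: 'r where
  "corner_unit = sum e corner_seqs"

text \<open>\<open>hat\<close> forgets the first entry, so sequences not starting with 0 are sent to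
  0 explicitly, as the cyclotomic relation demands. All dots get a value although the theorem names
  only the last: the earlier ones are 0 on both sides.\<close>

primrec corner_gen :: "klr_gen \<Rightarrow> 'r" where
  "corner_gen (GE i) = (if i ! 0 = 0 then e (hat i) else 0)"
| "corner_gen (GY k) = y (Suc k) * corner_unit"
| "corner_gen (GPsi k) = corner_unit * psi (Suc k) * corner_unit"

lemma corner_seqs_klr: "i \<in> corner_seqs \<Longrightarrow> i \<in> klr_seqs n"
  by (simp add: corner_seqs_def)

lemma finite_corner_seqs [simp]: "finite corner_seqs"
  by (simp add: corner_seqs_def)

lemma e_corner_unit: "i \<in> klr_seqs n \<Longrightarrow> e i * corner_unit = (if i \<in> corner_seqs then e i else 0)"
  and corner_unit_e: "i \<in> klr_seqs n \<Longrightarrow> corner_unit * e i = (if i \<in> corner_seqs then e i else 0)"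
proof -
  assume i: "i \<in> klr_seqs n"
  have "e i * corner_unit = (\<Sum>j\<in>corner_seqs. if i = j then e i else 0)"
    unfolding corner_unit_def sum_distrib_left using i idem corner_seqs_klr by (intro sum.cong) auto
  then show "e i * corner_unit = (if i \<in> corner_seqs then e i else 0)" by simp
  have "corner_unit * e i = (\<Sum>j\<in>corner_seqs. if j = i then e i else 0)"
    unfolding corner_unit_def sum_distrib_right using i idem corner_seqs_klr by (intro sum.cong) auto
  then show "corner_unit * e i = (if i \<in> corner_seqs then e i else 0)" by simp
qed

lemma corner_unit_idem [simp]: "corner_unit * corner_unit = corner_unit"
proof -
  have "corner_unit * corner_unit = (\<Sum>j\<in>corner_seqs. e j * corner_unit)"
    by (simp add: corner_unit_def sum_distrib_right)
  also have "\<dots> = sum e corner_seqs" using e_corner_unit corner_seqs_klr by (intro sum.cong) auto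
  finally show ?thesis by (simp add: corner_unit_def)
qed

lemma y_corner_unit: "k \<in> {1..n} \<Longrightarrow> y k * corner_unit = corner_unit * y k"
  unfolding corner_unit_def sum_distrib_left sum_distrib_right
  using y_e corner_seqs_klr by (intro sum.cong) auto

context
  assumes n: "2 < n"
begin

lemma swap_corner_seqs:
  assumes "i \<in> corner_seqs" "2 < k" "k < n"
  shows "swap_at k i \<in> corner_seqs"
proof -
  have "swap_at k i ! 0 = i ! 0" "swap_at k i ! 1 = i ! 1"
    using assms klr_seqs_nth(1)[OF corner_seqs_klr[OF assms(1)]] by (auto simp: nth_swap_at)
  then show ?thesis using assms by (auto simp: corner_seqs_def intro: swap_klr)
qed

lemma psi_corner_unit:
  assumes k: "2 < k" "k < n"
  shows "psi k * corner_unit = corner_unit * psi k"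
proof -
  have "psi k * corner_unit = (\<Sum>i\<in>corner_seqs. corner_unit * (psi k * e i))"
    unfolding corner_unit_def[unfolded corner_seqs_def] sum_distrib_left
    unfolding corner_seqs_def[symmetric] corner_unit_def[symmetric]
  proof (intro sum.cong refl)
    fix i assume i: "i \<in> corner_seqs"
    note j = swap_corner_seqs[OF i k]
    have "psi k * e i = e (swap_at k i) * psi k" using psi_e[of k i] corner_seqs_klr[OF i] k by simp
    moreover have "corner_unit * e (swap_at k i) = e (swap_at k i)"
      using corner_unit_e[OF corner_seqs_klr[OF j]] j by simp
    ultimately show "psi k * e i = corner_unit * (psi k * e i)" by (simp add: mult.assoc[symmetric])
  qed
  also have "\<dots> = corner_unit * psi k * corner_unit"
    by (simp add: corner_unit_def sum_distrib_left mult.assoc)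
  finally have 1: "psi k * corner_unit = corner_unit * psi k * corner_unit" .
  have "corner_unit * psi k = (\<Sum>i\<in>corner_seqs. (e i * psi k) * corner_unit)"
    unfolding corner_unit_def[unfolded corner_seqs_def] sum_distrib_right
    unfolding corner_seqs_def[symmetric] corner_unit_def[symmetric]
  proof (intro sum.cong refl)
    fix i assume i: "i \<in> corner_seqs"
    note j = swap_corner_seqs[OF i k]
    have "e i * psi k = psi k * e (swap_at k i)" using e_psi[of i k] corner_seqs_klr[OF i] k by simp
    moreover have "e (swap_at k i) * corner_unit = e (swap_at k i)"
      using e_corner_unit[OF corner_seqs_klr[OF j]] j by simp
    ultimately show "e i * psi k = e i * psi k * corner_unit" by (simp add: mult.assoc)
  qed
  also have "\<dots> = corner_unit * psi k * corner_unit"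
    by (simp add: corner_unit_def sum_distrib_right)
  finally show ?thesis using 1 by simp
qed

text \<open>The crossing at places 2 and 3 takes the entry 1 away from place 2 and so leaves the
  corner.\<close>

lemma corner_psi_2: "corner_unit * psi 2 * corner_unit = 0"
proof -
  have "corner_unit * psi 2 * corner_unit = (\<Sum>i\<in>corner_seqs. (e i * psi 2) * corner_unit)"
    by (simp add: corner_unit_def sum_distrib_right)
  also have "\<dots> = 0"
  proof (intro sum.neutral ballI)
    fix i assume i: "i \<in> corner_seqs"
    note s = klr_seqs_nth[OF corner_seqs_klr[OF i]]
    have j: "swap_at 2 i \<in> klr_seqs n" using corner_seqs_klr[OF i] n by (intro swap_klr) auto
    have "swap_at 2 i ! 1 = i ! 2" using s(1) n by (subst nth_swap_at) auto
    moreover have "i ! 2 \<noteq> 1" using s(3)[of 2 1] n i by (auto simp: corner_seqs_def)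
    ultimately have "swap_at 2 i \<notin> corner_seqs" by (auto simp: corner_seqs_def)
    then have "e (swap_at 2 i) * corner_unit = 0" using e_corner_unit[OF j] by simp
    then show "(e i * psi 2) * corner_unit = 0"
      using e_psi[of i 2] corner_seqs_klr[OF i] n by (simp add: mult.assoc)
  qed
  finally show ?thesis .
qed

lemma hat_image: "hat ` {i \<in> klr_seqs (n - 1). i ! 0 = 0} = corner_seqs"
proof
  show "hat ` {i \<in> klr_seqs (n - 1). i ! 0 = 0} \<subseteq> corner_seqs"
    using hat_klr_seqs[OF n] nth_hat(1,2) by (auto simp: corner_seqs_def)
  show "corner_seqs \<subseteq> hat ` {i \<in> klr_seqs (n - 1). i ! 0 = 0}"
    using hat_surj[OF n] by (fastforce simp: corner_seqs_def)
qed

lemma sum_corner_gen: "(\<Sum>i\<in>klr_seqs (n - 1). corner_gen (GE i)) = corner_unit"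
proof -
  have "(\<Sum>i\<in>klr_seqs (n - 1). corner_gen (GE i)) = (\<Sum>i\<in>{i \<in> klr_seqs (n - 1). i ! 0 = 0}. e (hat i))"
    by (simp add: sum.inter_filter)
  also have "\<dots> = sum e (hat ` {i \<in> klr_seqs (n - 1). i ! 0 = 0})"
    using hat_inj[OF n] by (subst sum.reindex) (auto simp: inj_on_def)
  finally show ?thesis unfolding hat_image corner_unit_def .
qed

text \<open>If the second entry of \<open>i\<close> is not joined to 0 in the small cycle, then the
  third entry of \<open>hat i\<close> is joined neither to 0 nor to 1 in the large one, and the
  prefix condition fails.\<close>

lemma e_hat_zero:
  assumes i: "i \<in> klr_seqs (n - 1)" "i ! 0 = 0" and nb: "\<not> nbr (n - 1) (i ! 0) (i ! 1)"
  shows "e (hat i) = 0"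
proof -
  note s = klr_seqs_nth[OF i(1)]
  have x: "i ! 1 \<noteq> 0" "i ! 1 < n - 1" using s(3)[of 1 0] s(2)[of 1] i(2) n by auto
  have h: "hat i ! 2 = Suc (i ! 1)" using nth_hat(3)[of 1 i] s(1) n by (simp add: numeral_2_eq_2)
  have "\<not> nbr n (hat i ! l) (hat i ! 2)" if "l < 2" for l
  proof -
    have "l = 0 \<or> l = 1" using that by auto
    then show ?thesis
      using nb x i(2) n unfolding h nbr_def arrow_def by (elim disjE) (auto simp: nth_hat(1,2)[simplified])
  qed
  then have "\<not> (\<exists>l<2. nbr n (hat i ! l) (hat i ! 2))" by blast
  moreover have "0 < (2::nat)" by simp
  ultimately have "\<not> prefix_adm n (hat i)" using n unfolding prefix_adm_def by blast
  then show ?thesis using prefix_vanish[of n "hat i"] n hat_klr_seqs[OF n i] by simp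
qed

lemma corner_act:
  assumes v: "corner_unit * v = v"
  shows "i \<in> klr_seqs (n - 1) \<Longrightarrow> corner_unit * (corner_gen (GE i) * v) = corner_gen (GE i) * v"
    "k \<in> {1..n-1} \<Longrightarrow> corner_gen (GY k) * v = y (Suc k) * v"
    "k \<in> {1..n-1} \<Longrightarrow> corner_unit * (y (Suc k) * v) = y (Suc k) * v"
    "corner_gen (GPsi 1) * v = 0"
    "1 < k \<Longrightarrow> k < n - 1 \<Longrightarrow> corner_gen (GPsi k) * v = psi (Suc k) * v"
    "1 < k \<Longrightarrow> k < n - 1 \<Longrightarrow> corner_unit * (psi (Suc k) * v) = psi (Suc k) * v"
proof -
  show "corner_unit * (corner_gen (GE i) * v) = corner_gen (GE i) * v" if i: "i \<in> klr_seqs (n - 1)"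
  proof (cases "i ! 0 = 0")
    case True
    then have "hat i \<in> corner_seqs" using i hat_image by auto
    then have "corner_unit * e (hat i) = e (hat i)" using corner_unit_e corner_seqs_klr by auto
    then show ?thesis using True by (simp add: mult.assoc[symmetric])
  qed simp
  show "corner_gen (GY k) * v = y (Suc k) * v" by (simp add: mult.assoc v)
  show "corner_unit * (y (Suc k) * v) = y (Suc k) * v" if "k \<in> {1..n-1}"
  proof -
    have "Suc k \<in> {1..n}" using that by auto
    then show ?thesis using y_corner_unit[of "Suc k"] v by (metis mult.assoc)
  qed
  show "corner_gen (GPsi 1) * v = 0" using corner_psi_2 by (simp add: numeral_2_eq_2)
  show *: "corner_unit * (psi (Suc k) * v) = psi (Suc k) * v" if "1 < k" "k < n - 1"
  proof -
    have "2 < Suc k" "Suc k < n" using that by auto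
    then show ?thesis using psi_corner_unit[of "Suc k"] v by (metis mult.assoc)
  qed
  show "corner_gen (GPsi k) * v = psi (Suc k) * v" if "1 < k" "k < n - 1"
    using *[OF that] by (simp add: mult.assoc v)
qed

text \<open>On elements fixed by \<open>corner_unit\<close> the generators act as those of the large
  algebra with index raised by one, so relations with \<open>k > 1\<close> are inherited. The first
  crossing acts as 0, and its relations are checked through vanishing idempotents and dots.\<close>

lemma klr_action_corner:
  "klr_action sc (\<lambda>g v. corner_gen g * v) (n - 1) {v. corner_unit * v = v}"
proof -
  interpret free_action sc "\<lambda>g v. corner_gen g * v"
    by unfold_locales (simp_all add: distrib_left sc_mult_right)
  let ?V = "{v. corner_unit * v = v}"
  have psi_cases: "(k = 1 \<and> corner_gen (GPsi k) * v = 0) \<or> (1 < k \<and> k < n - 1 \<and> corner_gen (GPsi k) * v = psi (Suc k) * v)"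
    if "k \<in> {1..n-1-1}" "v \<in> ?V" for k v
  proof (cases "k = 1")
    case True
    then show ?thesis using corner_act(4)[of v] that by simp
  next
    case False
    then have "1 < k" "k < n - 1" using that(1) by auto
    then show ?thesis using corner_act(5)[of v k] that by simp
  qed
  have closed: "corner_gen g * v \<in> ?V" if "g \<in> klr_gens (n - 1)" "v \<in> ?V" for g v
  proof (cases g)
    case (GE i)
    then show ?thesis using that corner_act(1)[of v i] by (auto simp: klr_gens_def)
  next
    case (GY k)
    then have "k \<in> {1..n-1}" using that by (auto simp: klr_gens_def)
    then show ?thesis using GY that corner_act(2,3)[of v k] by auto
  next
    case (GPsi k)
    then have "k \<in> {1..n-1-1}" using that by (auto simp: klr_gens_def)
    from psi_cases[OF this that(2)] show ?thesis
      using GPsi that corner_act(6)[of v k] by auto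
  qed
  have cE: "corner_gen (GE i) * v \<in> ?V" if "i \<in> klr_seqs (n - 1)" "v \<in> ?V" for i v
    using closed[of "GE i" v] that by (auto simp: klr_gens_def)
  have cY: "corner_gen (GY k) * v \<in> ?V" "corner_gen (GY k) * v = y (Suc k) * v" "y (Suc k) * v \<in> ?V"
    if "k \<in> {1..n-1}" "v \<in> ?V" for k v
    using closed[of "GY k" v] corner_act(2)[of v k] that by (auto simp: klr_gens_def)
  have cP: "corner_gen (GPsi k) * v \<in> ?V" if "k \<in> {1..n-1-1}" "v \<in> ?V" for k v
    using closed[of "GPsi k" v] that by (auto simp: klr_gens_def)
  have cP1: "corner_gen (GPsi k) * v = 0" if "\<not> 1 < k" "k \<in> {1..n-1-1}" "v \<in> ?V" for k v
    using psi_cases[OF that(2,3)] that(1) by auto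
  have cP2: "corner_gen (GPsi k) * v = psi (Suc k) * v" "psi (Suc k) * v \<in> ?V"
    if "1 < k" "k \<in> {1..n-1-1}" "v \<in> ?V" for k v
    using psi_cases[OF that(2,3)] cP[OF that(2,3)] that(1) by auto
  have y0: "y (Suc k) = 0" if "k \<in> {1..n-1}" "k < n - 1" for k using that by (intro y_zero) auto
  have psi_sq: "corner_gen (GPsi k) * (corner_gen (GPsi k) * w) = psi (Suc k) * (psi (Suc k) * w)"
    if "1 < k" "k \<in> {1..n-1-1}" "w \<in> ?V" for k w
    using cP2(1)[OF that] cP2(1)[OF that(1,2) cP[OF that(2,3)]] by simp
  have entries: "arrow (n - 1) (entry i k) (entry i (k + 1)) \<longleftrightarrow> arrow n (entry (hat i) (Suc k)) (entry (hat i) (Suc k + 1))"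
    "arrow (n - 1) (entry i (k + 1)) (entry i k) \<longleftrightarrow> arrow n (entry (hat i) (Suc k + 1)) (entry (hat i) (Suc k))"
    if i: "i \<in> klr_seqs (n - 1)" "i ! 0 = 0" and k: "1 < k" "k \<in> {1..n-1-1}" for i k
  proof -
    note s = klr_seqs_nth[OF i(1)]
    have nz: "i ! (k - 1) \<noteq> 0" "i ! k \<noteq> 0" using s(3)[of "k - 1" 0] s(3)[of k 0] i(2) k by auto
    have "hat i ! k = Suc (i ! (k - 1))" "hat i ! Suc k = Suc (i ! k)"
      using nth_hat(3)[of "k - 1" i] nth_hat(3)[of k i] k s(1) by auto
    then show "arrow (n - 1) (entry i k) (entry i (k + 1)) \<longleftrightarrow> arrow n (entry (hat i) (Suc k)) (entry (hat i) (Suc k + 1))"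
      "arrow (n - 1) (entry i (k + 1)) (entry i k) \<longleftrightarrow> arrow n (entry (hat i) (Suc k + 1)) (entry (hat i) (Suc k))"
      using hat_arrow[OF n] nz by simp_all
  qed
  show ?thesis
  proof
    show "0 < n - 1" using n by simp
    show "(0::'r) \<in> ?V" by simp
    show "v + w \<in> ?V" if "v \<in> ?V" "w \<in> ?V" for v w using that by (simp add: distrib_left)
    show "sc c v \<in> ?V" if "v \<in> ?V" for c v using that by (simp add: sc_mult_right)
    show "corner_gen g * v \<in> ?V" if "g \<in> klr_gens (n - 1)" "v \<in> ?V" for g v by (rule closed) fact+
    show "corner_gen (GY 1) * (corner_gen (GE i) * v) = 0" if "i \<in> klr_seqs (n - 1)" "v \<in> ?V" for i v
      using cY(2)[OF _ cE[OF that], of 1] y0[of 1] n by simp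
    show "corner_gen (GE i) * v = 0" if "entry i 1 \<noteq> 0" for i v using that by simp
    fix a b :: "'k klr_free" and v assume ab: "(a, b) \<in> klr_rels (n - 1)" and v: "v \<in> ?V"
    from ab show "act a v = act b v"
    proof cases
      case (idem i j)
      show ?thesis
      proof (cases "i ! 0 = 0 \<and> j ! 0 = 0")
        case True
        then have "e (hat i) * e (hat j) = (if i = j then e (hat i) else 0)"
          using klr_elements.idem[OF klr_elements_axioms hat_klr_seqs[OF n] hat_klr_seqs[OF n], of i j]
            hat_inj[OF n, of i j] idem by auto
        then show ?thesis using True idem by (auto simp: mult.assoc[symmetric])
      qed (use idem in auto)
    next
      case unit
      then show ?thesis using sum_corner_gen v by (simp add: act_sum_left sum_distrib_right[symmetric])
    next
      case (y_e k i)
      show ?thesis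
      proof (cases "i ! 0 = 0")
        case True
        have "y (Suc k) * e (hat i) = e (hat i) * y (Suc k)"
          using y_e klr_elements.y_e[OF klr_elements_axioms _ hat_klr_seqs[OF n _ True], of "Suc k"] by auto
        then show ?thesis using y_e cY(2)[OF y_e(3) v] cY(2)[OF y_e(3) cE[OF y_e(4) v]] True
          by (simp add: mult.assoc[symmetric] del: corner_gen.simps(2))
      next
        case False
        then show ?thesis using y_e by simp
      qed
    next
      case (psi_e k i)
      show ?thesis
      proof (cases "1 < k")
        case False
        then show ?thesis using psi_e cP1[OF False psi_e(3) v] cP1[OF False psi_e(3) cE[OF psi_e(4) v]]
          by (simp del: corner_gen.simps)
      next
        case k: True
        note P = cP2(1)[OF k psi_e(3) v] cP2(1)[OF k psi_e(3) cE[OF psi_e(4) v]]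
        have len: "length i = n - 1" "k < n - 1" using klr_seqs_nth(1)[OF psi_e(4)] psi_e(3) by auto
        show ?thesis
        proof (cases "i ! 0 = 0")
          case True
          note sw = hat_swap[OF n psi_e(4) True k len(2)]
          have "psi (Suc k) * e (hat i) = e (hat (swap_at k i)) * psi (Suc k)"
            using klr_elements.psi_e[OF klr_elements_axioms _ hat_klr_seqs[OF n psi_e(4) True], of "Suc k"] len sw by auto
          then show ?thesis using psi_e P True sw
            by (simp add: mult.assoc[symmetric] del: corner_gen.simps(3))
        next
          case False
          have "swap_at k i ! 0 = i ! 0" using k len by (subst nth_swap_at) auto
          then show ?thesis using False psi_e by simp
        qed
      qed
    next
      case (y_y k l)
      have "y (Suc k) * (y (Suc l) * v) = y (Suc l) * (y (Suc k) * v)"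
      proof (cases "k = l")
        case False
        then have "k < n - 1 \<or> l < n - 1" using y_y by auto
        then show ?thesis using y0[OF y_y(3)] y0[OF y_y(4)] by auto
      qed simp
      then show ?thesis
        using y_y cY(2)[OF y_y(3) v] cY(2)[OF y_y(4) v] cY(2)[OF y_y(3) cY(1)[OF y_y(4) v]]
          cY(2)[OF y_y(4) cY(1)[OF y_y(3) v]] by (simp del: corner_gen.simps)
    next
      case (psi_y k l)
      note Y = cY[OF psi_y(4) v] cY(2)[OF psi_y(4) cP[OF psi_y(3) v]]
      show ?thesis
      proof (cases "1 < k")
        case False
        then show ?thesis using psi_y Y cP1[OF False psi_y(3) v] cP1[OF False psi_y(3) Y(1)]
          by (simp del: corner_gen.simps)
      next
        case k: True
        have "psi (Suc k) * y (Suc l) = y (Suc l) * psi (Suc k)"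
          using psi_y by (intro klr_elements.psi_y[OF klr_elements_axioms]) auto
        then show ?thesis using psi_y Y cP2(1)[OF k psi_y(3) v] cP2(1)[OF k psi_y(3) Y(1)]
          by (simp add: mult.assoc[symmetric] del: corner_gen.simps)
      qed
    next
      case (psi_psi k l)
      note Pk = cP[OF psi_psi(3) v] and Pl = cP[OF psi_psi(4) v]
      show ?thesis
      proof (cases "1 < k \<and> 1 < l")
        case False
        then show ?thesis
          using psi_psi cP1[OF _ psi_psi(3) v] cP1[OF _ psi_psi(4) v] cP1[OF _ psi_psi(3) Pl] cP1[OF _ psi_psi(4) Pk]
          by (cases "1 < k") (simp_all del: corner_gen.simps)
      next
        case True
        have "psi (Suc k) * psi (Suc l) = psi (Suc l) * psi (Suc k)"
          using psi_psi by (intro klr_elements.psi_psi[OF klr_elements_axioms]) auto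
        then show ?thesis
          using True psi_psi cP2(1)[OF _ psi_psi(3) v] cP2(1)[OF _ psi_psi(4) v] cP2(1)[OF _ psi_psi(3) Pl] cP2(1)[OF _ psi_psi(4) Pk]
          by (simp add: mult.assoc[symmetric] del: corner_gen.simps)
      qed
    next
      case (psi_y_Suc k i)
      define w where "w = corner_gen (GE i) * v"
      have w: "w \<in> ?V" unfolding w_def by (rule cE[OF psi_y_Suc(4) v])
      have k1: "k + 1 \<in> {1..n-1}" "k \<in> {1..n-1}" "k < n - 1" using psi_y_Suc(3) n by auto
      note Y = cY[OF k1(1) w] cY(2)[OF k1(2) cP[OF psi_y_Suc(3) w]]
      \<comment> \<open>Both sides of the relation vanish: the other side contains the dot at
        \<open>Suc k < n\<close>, which is 0.\<close>
      have "corner_gen (GPsi k) * (y (Suc (k + 1)) * w) = 0"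
      proof (cases "1 < k")
        case False
        then show ?thesis by (rule cP1[OF _ psi_y_Suc(3) Y(3)])
      next
        case k: True
        have "psi (Suc k) * y (Suc k + 1) * e (hat i) = 0" if "i ! 0 = 0"
          using klr_elements.psi_y_Suc[OF klr_elements_axioms _ hat_klr_seqs[OF n psi_y_Suc(4) that], of "Suc k"]
            k1 y0[OF k1(2,3)] by simp
        then have "psi (Suc k) * (y (Suc (k + 1)) * w) = 0"
          unfolding w_def by (auto simp: mult.assoc[symmetric])
        then show ?thesis using cP2(1)[OF k psi_y_Suc(3) Y(3)] by simp
      qed
      then show ?thesis
        using psi_y_Suc Y y0[OF k1(2,3)] by (simp add: w_def[symmetric] del: corner_gen.simps)
    next
      case (y_Suc_psi k i)
      define w where "w = corner_gen (GE i) * v"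
      have w: "w \<in> ?V" unfolding w_def by (rule cE[OF y_Suc_psi(4) v])
      have k1: "k + 1 \<in> {1..n-1}" "k \<in> {1..n-1}" "k < n - 1" using y_Suc_psi(3) n by auto
      note Y = cY(2)[OF k1(1) cP[OF y_Suc_psi(3) w]] cY(2)[OF k1(2) w]
      have "y (Suc (k + 1)) * (corner_gen (GPsi k) * w) = 0"
      proof (cases "1 < k")
        case False
        then show ?thesis using cP1[OF _ y_Suc_psi(3) w] by simp
      next
        case k: True
        have "y (Suc k + 1) * psi (Suc k) * e (hat i) = 0" if "i ! 0 = 0"
          using klr_elements.y_Suc_psi[OF klr_elements_axioms _ hat_klr_seqs[OF n y_Suc_psi(4) that], of "Suc k"]
            k1 y0[OF k1(2,3)] by simp
        then have "y (Suc (k + 1)) * (psi (Suc k) * w) = 0"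
          unfolding w_def by (auto simp: mult.assoc[symmetric])
        then show ?thesis using cP2(1)[OF k y_Suc_psi(3) w] by simp
      qed
      then show ?thesis
        using y_Suc_psi Y y0[OF k1(2,3)] by (simp add: w_def[symmetric] del: corner_gen.simps)
    next
      case (braid k i)
      define w where "w = corner_gen (GE i) * v"
      have w: "w \<in> ?V" unfolding w_def by (rule cE[OF braid(5) v])
      note P = cP[OF braid(3) w] cP[OF braid(4) w]
      note PP = cP[OF braid(4) P(1)] cP[OF braid(3) P(2)]
      show ?thesis
      proof (cases "1 < k")
        case False
        have "act a v = corner_gen (GPsi k) * (corner_gen (GPsi (k + 1)) * (corner_gen (GPsi k) * w))"
          "act b v = corner_gen (GPsi (k + 1)) * (corner_gen (GPsi k) * (corner_gen (GPsi (k + 1)) * w))"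
          unfolding braid(1,2) act_mult act_gen w_def by (rule refl)+
        then show ?thesis
          unfolding cP1[OF False braid(3) w] cP1[OF False braid(3) P(2)] by simp
      next
        case k: True
        then have k': "1 < k + 1" by simp
        have "psi (Suc k) * psi (Suc k + 1) * psi (Suc k) * e (hat i) = psi (Suc k + 1) * psi (Suc k) * psi (Suc k + 1) * e (hat i)" if "i ! 0 = 0"
          using braid(3,4) by (intro klr_elements.braid[OF klr_elements_axioms] hat_klr_seqs[OF n braid(5) that]) auto
        then have "psi (Suc k) * (psi (Suc (k + 1)) * (psi (Suc k) * w)) = psi (Suc (k + 1)) * (psi (Suc k) * (psi (Suc (k + 1)) * w))"
          unfolding w_def by (auto simp: mult.assoc[symmetric])
        then show ?thesis
          using braid cP2(1)[OF k braid(3) w] cP2(1)[OF k' braid(4) w] cP2(1)[OF k' braid(4) P(1)]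
            cP2(1)[OF k braid(3) P(2)] cP2(1)[OF k braid(3) PP(1)] cP2(1)[OF k' braid(4) PP(2)]
          by (simp add: w_def[symmetric] del: corner_gen.simps)
      qed
    next
      case (psi_sq_none k i)
      define w where "w = corner_gen (GE i) * v"
      have w: "w \<in> ?V" unfolding w_def by (rule cE[OF psi_sq_none(4) v])
      have "corner_gen (GPsi k) * (corner_gen (GPsi k) * w) = w"
      proof (cases "i ! 0 = 0")
        case i0: True
        show ?thesis
        proof (cases "1 < k")
          case k: True
          note ent = entries[OF psi_sq_none(4) i0 k psi_sq_none(3)]
          have "psi (Suc k) * psi (Suc k) * e (hat i) = e (hat i)"
            using psi_sq_none(3)
            by (intro klr_elements.psi_sq_none[OF klr_elements_axioms _ hat_klr_seqs[OF n psi_sq_none(4) i0]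
                  psi_sq_none(5)[unfolded ent(1)] psi_sq_none(6)[unfolded ent(2)]]) auto
          then show ?thesis
            unfolding psi_sq[OF k psi_sq_none(3) w] by (simp add: w_def i0 mult.assoc[symmetric])
        next
          case False
          then have "k = 1" using psi_sq_none(3) by auto
          then have "e (hat i) = 0"
            using psi_sq_none by (intro e_hat_zero i0) (auto simp: nbr_def)
          then show ?thesis by (simp add: w_def)
        qed
      qed (simp add: w_def)
      then show ?thesis using psi_sq_none by (simp add: power2_eq_square w_def[symmetric] del: corner_gen.simps)
    next
      case (psi_sq_right k i)
      define w where "w = corner_gen (GE i) * v"
      have w: "w \<in> ?V" unfolding w_def by (rule cE[OF psi_sq_right(4) v])
      have kk: "k \<in> {1..n-1}" "k + 1 \<in> {1..n-1}" using psi_sq_right(3) by auto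
      have "corner_gen (GPsi k) * (corner_gen (GPsi k) * w) = y (Suc (k + 1)) * w - y (Suc k) * w"
      proof (cases "i ! 0 = 0")
        case i0: True
        show ?thesis
        proof (cases "1 < k")
          case k: True
          note ent = entries[OF psi_sq_right(4) i0 k psi_sq_right(3)]
          have "psi (Suc k) * psi (Suc k) * e (hat i) = (y (Suc k + 1) - y (Suc k)) * e (hat i)"
            using psi_sq_right(3)
            by (intro klr_elements.psi_sq_right[OF klr_elements_axioms _ hat_klr_seqs[OF n psi_sq_right(4) i0]
                  psi_sq_right(5)[unfolded ent(1)] psi_sq_right(6)[unfolded ent(2)]]) auto
          then have "psi (Suc k) * (psi (Suc k) * w) = (y (Suc k + 1) - y (Suc k)) * w"
            by (simp add: w_def i0 mult.assoc[symmetric])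
          then show ?thesis unfolding psi_sq[OF k psi_sq_right(3) w] by (simp add: left_diff_distrib)
        next
          case False
          then have k: "k = 1" using psi_sq_right(3) by auto
          \<comment> \<open>A single arrow excludes the quiver with two vertices, so
            \<open>n >= 4\<close> and both dots are zero, as is the first crossing.\<close>
          have "n - 1 \<noteq> 2"
          proof
            assume m: "n - 1 = 2"
            have "arrow (n - 1) (i ! 1) (i ! 0)"
              using psi_sq_right(5) m k i0 by (auto simp: arrow_def)
            then show False using psi_sq_right(6) k by simp
          qed
          then have "Suc (k + 1) < n" using k n by simp
          then have "y (Suc (k + 1)) = 0" "y (Suc k) = 0"
            using y_zero[of "Suc (k + 1)"] y_zero[of "Suc k"] by auto
          then show ?thesis using cP1[OF False psi_sq_right(3) w] by simp
        qed
      qed (simp add: w_def)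
      then show ?thesis using psi_sq_right cY(2)[OF kk(1) w] cY(2)[OF kk(2) w]
        by (simp add: power2_eq_square w_def[symmetric] del: corner_gen.simps)
    next
      case (psi_sq_left k i)
      define w where "w = corner_gen (GE i) * v"
      have w: "w \<in> ?V" unfolding w_def by (rule cE[OF psi_sq_left(4) v])
      have kk: "k \<in> {1..n-1}" "k + 1 \<in> {1..n-1}" using psi_sq_left(3) by auto
      have "corner_gen (GPsi k) * (corner_gen (GPsi k) * w) = y (Suc k) * w - y (Suc (k + 1)) * w"
      proof (cases "i ! 0 = 0")
        case i0: True
        show ?thesis
        proof (cases "1 < k")
          case k: True
          note ent = entries[OF psi_sq_left(4) i0 k psi_sq_left(3)]
          have "psi (Suc k) * psi (Suc k) * e (hat i) = (y (Suc k) - y (Suc k + 1)) * e (hat i)"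
            using psi_sq_left(3)
            by (intro klr_elements.psi_sq_left[OF klr_elements_axioms _ hat_klr_seqs[OF n psi_sq_left(4) i0]
                  psi_sq_left(5)[unfolded ent(1)] psi_sq_left(6)[unfolded ent(2)]]) auto
          then have "psi (Suc k) * (psi (Suc k) * w) = (y (Suc k) - y (Suc k + 1)) * w"
            by (simp add: w_def i0 mult.assoc[symmetric])
          then show ?thesis unfolding psi_sq[OF k psi_sq_left(3) w] by (simp add: left_diff_distrib)
        next
          case False
          then have k: "k = 1" using psi_sq_left(3) by auto
          have "n - 1 \<noteq> 2"
          proof
            assume m: "n - 1 = 2"
            have "arrow (n - 1) (i ! 0) (i ! 1)"
              using psi_sq_left(6) m k i0 by (auto simp: arrow_def)
            then show False using psi_sq_left(5) k by simp
          qed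
          then have "Suc (k + 1) < n" using k n by simp
          then have "y (Suc (k + 1)) = 0" "y (Suc k) = 0"
            using y_zero[of "Suc (k + 1)"] y_zero[of "Suc k"] by auto
          then show ?thesis using cP1[OF False psi_sq_left(3) w] by simp
        qed
      qed (simp add: w_def)
      then show ?thesis using psi_sq_left cY(2)[OF kk(1) w] cY(2)[OF kk(2) w]
        by (simp add: power2_eq_square w_def[symmetric] del: corner_gen.simps)
    next
      case (psi_sq_both k i)
      define w where "w = corner_gen (GE i) * v"
      have w: "w \<in> ?V" unfolding w_def by (rule cE[OF psi_sq_both(4) v])
      have kk: "k \<in> {1..n-1}" "k + 1 \<in> {1..n-1}" using psi_sq_both(3) by auto
      \<comment> \<open>The double arrow forces \<open>n = 3\<close>. The crossing and the dot
        \<open>y 2\<close> act as 0, and what remains of the relation is that the square of the last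
        dot is 0.\<close>
      have "n - 1 = 2" using arrow_both[OF _ psi_sq_both(5,6)] n by simp
      then have k: "k = 1" "Suc (k + 1) = n" "Suc k < n" "\<not> 1 < k" using psi_sq_both(3) by auto
      have yk: "y (Suc k) = 0" using k by (intro y_zero) auto
      have yy: "y n * (y n * w) = 0" using y_sq by (simp add: mult.assoc[symmetric])
      have g1: "corner_gen (GY k) * w = 0" using cY(2)[OF kk(1) w] yk by simp
      have g2: "corner_gen (GY (k + 1)) * (corner_gen (GY (k + 1)) * w) = 0"
        using cY(2)[OF kk(2) cY(1)[OF kk(2) w]] cY(2)[OF kk(2) w] yy k(2) by simp
      have g3: "corner_gen (GY k) * (corner_gen (GY (k + 1)) * w) = 0"
        using cY(2)[OF kk(1) cY(1)[OF kk(2) w]] yk by simp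
      have g4: "corner_gen (GPsi k) * (corner_gen (GPsi k) * w) = 0"
        using cP1[OF k(4) psi_sq_both(3) w] by simp
      show ?thesis
        unfolding psi_sq_both(1,2) power2_eq_square act_mult act_minus_left act_gen w_def[symmetric]
          right_diff_distrib g1 g2 g3 g4 by simp
    qed
  qed
qed

end
end

section \<open>The isomorphism\<close>

lemma component_sum:
  fixes f :: "'a \<Rightarrow> 'k::field cyc_prod"
  assumes "0 < n" "finite I"
  shows "component n (sum f I) = (\<Oplus>\<^bsub>cyc_algebra n\<^esub> i\<in>I. component n (f i))"
proof -
  interpret ring "cyc_algebra n :: ('k, 'k cyc) module" by (rule ring_cyc_algebra) fact
  from assms(2) show ?thesis
    by (induction I rule: finite_induct) (auto simp: component_simps[OF assms(1)] component_closed[OF assms(1)])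
qed

lemma in_span_cyc_el:
  fixes p :: "'k::field klr_free"
  assumes n: "1 < n" and p: "p \<in> carrier (klr_free_algebra n)"
  shows "klr_module.in_span n (\<lambda>i. cyc_el n (fE i :: 'k klr_free)) (\<lambda>k. cyc_el n (fY k))
    (\<lambda>k. cyc_el n (fPsi k)) cyc_scale (cyc_el n p)"
proof -
  interpret R: klr_module n "\<lambda>i. cyc_el n (fE i :: 'k klr_free)" "\<lambda>k. cyc_el n (fY k)"
    "\<lambda>k. cyc_el n (fPsi k)" cyc_scale
    by (rule klr_module_cyc[OF n])
  have n0: "0 < n" using n by simp
  from p show ?thesis
  proof (induction rule: free_algebra_induct)
    case zero
    then show ?case by (simp add: cyc_el_zero[OF n0] R.in_span_zero)
  next
    case one
    then show ?case using R.in_span_unit cyc_el_unit(3)[OF n0 klr_free_closed(1), where ?'k = 'k] by simp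
  next
    case (gen g p)
    have "cyc_el n (fgen g * p) = cyc_el n (fgen g) * cyc_el n p"
      using gen by (intro cyc_el_hom[OF n0] fgen_in_free_algebra)
    moreover have "(\<exists>i\<in>klr_seqs n. g = GE i) \<or> (\<exists>k\<in>{1..n}. g = GY k) \<or> (\<exists>k\<in>{1..n-1}. g = GPsi k)"
      using gen(1) by (auto simp: klr_gens_def)
    ultimately show ?case
      using gen(3) R.in_span_e_mult R.in_span_y_mult R.in_span_psi_mult by auto
  next
    case (add p q)
    then show ?case by (simp add: cyc_el_hom[OF n0] R.in_span_add)
  next
    case (smult c p)
    then show ?case by (simp add: cyc_el_hom(3)[OF n0 smult(1) smult(1)] R.in_span_scale)
  qed
qed

context
  fixes n :: nat and K :: "'k::field itself"
  assumes n: "2 < n"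
  notes One_nat_def [simp del]
begin

abbreviation (input) "F \<equiv> carrier (klr_free_algebra (n - 1) :: ('k, 'k klr_free) module)"

interpretation R: klr_module n "\<lambda>i. cyc_el n (fE i :: 'k klr_free)" "\<lambda>k. cyc_el n (fY k)"
  "\<lambda>k. cyc_el n (fPsi k)" cyc_scale
  using n by (intro klr_module_cyc) simp

interpretation M: klr_module "n - 1" "\<lambda>i. cyc_el (n - 1) (fE i :: 'k klr_free)" "\<lambda>k. cyc_el (n - 1) (fY k)"
  "\<lambda>k. cyc_el (n - 1) (fPsi k)" cyc_scale
  using n by (intro klr_module_cyc) simp

interpretation A: klr_action "cyc_scale :: 'k \<Rightarrow> _" "\<lambda>g v. R.corner_gen g * v" "n - 1"
  "{v. R.corner_unit * v = v}"
  using n by (rule R.klr_action_corner)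

text \<open>The wanted isomorphism, lifted to the free algebra by letting a polynomial act on the
  unit of the corner.\<close>

definition corner_eval :: "'k klr_free \<Rightarrow> 'k cyc_prod" where
  "corner_eval p = A.act p R.corner_unit"

lemma n_pos: "0 < n" "0 < n - 1"
  using n by auto

text \<open>The generators act by left multiplication, so the action commutes with right
  multiplication; this makes \<open>corner_eval\<close> multiplicative.\<close>

lemma act_mult_right: "A.act p (v * w) = A.act p v * w"
proof (induction p rule: poly_mapping_single_induct)
  case (add u c q)
  have "foldr (\<lambda>g v. R.corner_gen g * v) l (v * w) = foldr (\<lambda>g v. R.corner_gen g * v) l v * w" for l
    by (induction l) (simp_all add: mult.assoc)
  then show ?case using add by (simp add: A.act_single distrib_right cyc_scale_mult_left)
qed simp

lemma corner_eval_unit: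
  assumes "p \<in> F"
  shows "R.corner_unit * corner_eval p = corner_eval p" "corner_eval p * R.corner_unit = corner_eval p"
  using A.act_V[OF assms, of R.corner_unit] act_mult_right[of p R.corner_unit R.corner_unit]
  by (simp_all add: corner_eval_def)

lemma corner_eval_hom:
  "corner_eval (p + q) = corner_eval p + corner_eval q"
  "corner_eval (p - q) = corner_eval p - corner_eval q"
  "corner_eval (Poly_Mapping.single 0 c * p) = cyc_scale c (corner_eval p)"
  "q \<in> F \<Longrightarrow> corner_eval (p * q) = corner_eval p * corner_eval q"
  "corner_eval 1 = R.corner_unit" "corner_eval 0 = 0"
  using act_mult_right[of p R.corner_unit "corner_eval q"] corner_eval_unit[of q]
  by (simp_all add: corner_eval_def)

lemma corner_eval_gen:
  "corner_eval (fE i) = (if i ! 0 = 0 then cyc_el n (fE (hat i)) * R.corner_unit else 0)"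
  "corner_eval (fY k) = cyc_el n (fY (Suc k)) * R.corner_unit"
  "corner_eval (fPsi k) = R.corner_unit * cyc_el n (fPsi (Suc k)) * R.corner_unit"
  by (simp_all add: corner_eval_def mult.assoc)

lemma corner_eval_e:
  assumes "i \<in> klr_seqs (n - 1)" "i ! 0 = 0"
  shows "corner_eval (fE i) = cyc_el n (fE (hat i))"
proof -
  have "hat i \<in> R.corner_seqs" using R.hat_image[OF n] assms by auto
  then show ?thesis
    using R.e_corner_unit[OF R.corner_seqs_klr] assms by (simp add: corner_eval_gen)
qed

lemma corner_eval_cong:
  assumes "p \<in> F" "q \<in> F" "cyc_el (n - 1) p = cyc_el (n - 1) q"
  shows "corner_eval p = corner_eval q"
proof -
  have "component (n - 1) (cyc_el (n - 1) p) = component (n - 1) (cyc_el (n - 1) q)" using assms(3) by simp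
  then have "cyc_proj (n - 1) p = cyc_proj (n - 1) q"
    unfolding cyc_el_def using n_pos(2) assms
    by (simp add: component_cyc_in cyc_proj_closed)
  then show ?thesis unfolding corner_eval_def using assms by (intro A.act_cong) auto
qed

section \<open>Injectivity\<close>

lemma y_base_nonzero:
  assumes "0 < q" "q < n"
  shows "cyc_el n (fY n) * cyc_el n (fE (base_seq n q)) \<noteq> (0 :: 'k cyc_prod)"
proof
  let ?p = "fY n * fE (base_seq n q) :: 'k klr_free"
  have c: "fY n \<in> carrier (klr_free_algebra n :: ('k, 'k klr_free) module)"
    "fE (base_seq n q) \<in> carrier (klr_free_algebra n :: ('k, 'k klr_free) module)"
    using n base_seq_klr_seqs[OF assms(2)] by (auto intro: klr_free_closed)
  assume "cyc_el n (fY n) * cyc_el n (fE (base_seq n q)) = (0 :: 'k cyc_prod)"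
  then have "cyc_el n ?p = 0" using cyc_el_hom(2)[OF n_pos(1) c] by simp
  then have "component n (cyc_el n ?p) = component n 0" by simp
  then have "cyc_proj n ?p = \<zero>\<^bsub>cyc_algebra n\<^esub>"
    unfolding cyc_el_def using n_pos(1) cyc_proj_closed[OF n_pos(1) klr_free_closed(5)[OF c]]
    by (simp add: component_cyc_in component_simps)
  then show False using y_e_base_nonzero[OF n assms, where ?'k = 'k] by simp
qed

text \<open>\<open>corner_eval\<close> takes polynomials, so the canonical products of the small
  algebra have to be lifted to the free algebra before they can be used as factors.\<close>

lemma M_path_range:
  assumes "M.path p i x x'" "0 < p" "p < n - 1"
  shows "x \<in> cyc_el (n - 1) ` F \<and> x' \<in> cyc_el (n - 1) ` F"
  using assms
proof (induction rule: M.path.induct)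
  case base
  then have "fE (base_seq (n - 1) p) \<in> F" by (intro klr_free_closed base_seq_klr_seqs)
  then show ?case by simp
next
  case (step i k x x')
  then obtain a a' where a: "a \<in> F" "x = cyc_el (n - 1) a" "a' \<in> F" "x' = cyc_el (n - 1) a'" by auto
  have c: "fPsi k \<in> F" "fE i \<in> F"
    using step.hyps admD(1) by (auto simp: desc_def intro!: klr_free_closed)
  have "cyc_el (n - 1) (a * fPsi k * fE i) = x * cyc_el (n - 1) (fPsi k) * cyc_el (n - 1) (fE i)"
    "cyc_el (n - 1) (fE i * fPsi k * a') = cyc_el (n - 1) (fE i) * cyc_el (n - 1) (fPsi k) * x'"
    using a c by (simp_all add: cyc_el_hom[OF n_pos(2)] klr_free_closed)
  moreover have "a * fPsi k * fE i \<in> F" "fE i * fPsi k * a' \<in> F" using a c by (auto intro: klr_free_closed)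
  ultimately show ?case by (metis imageI)
qed

lemma M_down_up_range:
  assumes "adm (n - 1) p i"
  shows "M.down i \<in> cyc_el (n - 1) ` F" "M.up i \<in> cyc_el (n - 1) ` F"
  using M_path_range[OF M.path_down_up[OF assms]] adm_bounds[OF assms] n by auto

lemma cyc_el_range_mult:
  "x \<in> cyc_el (n - 1) ` F \<Longrightarrow> z \<in> cyc_el (n - 1) ` F \<Longrightarrow> x * z \<in> cyc_el (n - 1) ` F"
  using klr_free_closed(5)[where ?'k = 'k] cyc_el_hom(2)[OF n_pos(2), symmetric] by fastforce

lemma M_raise_lower_range:
  assumes "0 < p" "Suc p < n - 1"
  shows "M.raise p \<in> cyc_el (n - 1) ` F" "M.lower p \<in> cyc_el (n - 1) ` F"
proof -
  have "fE (base_seq (n - 1) p) \<in> F" "fPsi (n - 1 - 1) \<in> F"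
    using assms n by (auto intro!: klr_free_closed base_seq_klr_seqs)
  then show "M.raise p \<in> cyc_el (n - 1) ` F" "M.lower p \<in> cyc_el (n - 1) ` F"
    unfolding M.raise_def M.lower_def
    using M_down_up_range[OF M.adm_swap_base[OF assms]] by (auto intro!: cyc_el_range_mult)
qed

text \<open>The relation maps to the one with the same coefficients at the base sequence of
  \<open>Suc p\<close> in the large algebra. Multiplication by the last dot kills the second term
  and forces \<open>a = 0\<close>; then \<open>b = 0\<close>, since the dot on that idempotent is
  nonzero.\<close>

lemma diag_zero:
  assumes r: "r \<in> F" "corner_eval r = 0" and p: "0 < p" "p < n - 1"
    and eq: "cyc_el (n - 1) r = cyc_scale a (cyc_el (n - 1) (fE (base_seq (n - 1) p))) +
      cyc_scale b (cyc_el (n - 1) (fY (n - 1)) * cyc_el (n - 1) (fE (base_seq (n - 1) p)))"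
  shows "a = 0 \<and> b = 0"
proof -
  let ?c = "base_seq (n - 1) p" and ?c' = "base_seq n (Suc p)"
  have c: "?c \<in> klr_seqs (n - 1)" "?c ! 0 = 0" and h: "hat ?c = ?c'"
    using admD(1,2)[OF adm_base_seq[OF p]] hat_base_seq[OF n p] by auto
  have cl: "fE ?c \<in> F" "fY (n - 1) \<in> F" using c n by (auto intro!: klr_free_closed)
  let ?q = "Poly_Mapping.single 0 a * fE ?c + Poly_Mapping.single 0 b * (fY (n - 1) * fE ?c) :: 'k klr_free"
  have q: "?q \<in> F" by (intro klr_free_closed(3,7) klr_free_closed(5)[OF cl(2,1)] cl)
  have "cyc_el (n - 1) r = cyc_el (n - 1) ?q"
    using cl by (simp add: eq cyc_el_hom[OF n_pos(2)] klr_free_closed)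
  then have "corner_eval ?q = 0" using corner_eval_cong[OF r(1) q] r(2) by simp
  moreover have "corner_eval (fY (n - 1) * fE ?c) = cyc_el n (fY n) * cyc_el n (fE ?c')"
  proof -
    have "corner_eval (fY (n - 1) * fE ?c) = cyc_el n (fY n) * (R.corner_unit * corner_eval (fE ?c))"
      using cl n by (simp add: corner_eval_hom(4) corner_eval_gen(2) mult.assoc)
    then show ?thesis unfolding corner_eval_unit(1)[OF cl(1)] unfolding corner_eval_e[OF c] h .
  qed
  ultimately have z: "cyc_scale a (cyc_el n (fE ?c')) + cyc_scale b (cyc_el n (fY n) * cyc_el n (fE ?c')) = 0"
    using corner_eval_e[OF c] h by (simp add: corner_eval_hom(1,3))
  have nz: "cyc_el n (fY n) * cyc_el n (fE ?c') \<noteq> (0 :: 'k cyc_prod)"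
    using p by (intro y_base_nonzero) auto
  have "cyc_el n (fY n) * (cyc_scale a (cyc_el n (fE ?c')) + cyc_scale b (cyc_el n (fY n) * cyc_el n (fE ?c'))) =
    cyc_scale a (cyc_el n (fY n) * cyc_el n (fE ?c'))"
    using R.y_sq by (simp add: distrib_left cyc_scale_mult_right mult.assoc[symmetric])
  then have "cyc_scale a (cyc_el n (fY n) * cyc_el n (fE ?c')) = 0" unfolding z by simp
  then have "a = 0" using nz by simp
  then show ?thesis using z nz by simp
qed

text \<open>An element off the diagonal is multiplied by the opposite \<open>raise\<close> or
  \<open>lower\<close>, which turns its coefficient into one of a diagonal element, up to
  sign.\<close>

lemma block_kernel:
  assumes w: "M.block p q (cyc_el (n - 1) r)" and r: "r \<in> F" "corner_eval r = 0"
    and p: "0 < p" "p < n - 1" "0 < q" "q < n - 1"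
  shows "cyc_el (n - 1) r = 0"
proof -
  have offdiag: "a = 0"
    if b: "u \<in> cyc_el (n - 1) ` F" and p: "0 < p" "p < n - 1"
      and eq: "u * cyc_el (n - 1) r = cyc_scale a (cyc_el (n - 1) (fY (n - 1)) * cyc_el (n - 1) (fE (base_seq (n - 1) p)))"
    for u a p
  proof -
    from b obtain s where s: "s \<in> F" "u = cyc_el (n - 1) s" by auto
    have "corner_eval (s * r) = 0" using r by (simp add: corner_eval_hom(4))
    moreover have "cyc_el (n - 1) (s * r) = u * cyc_el (n - 1) r"
      using s r by (simp add: cyc_el_hom[OF n_pos(2)])
    ultimately show ?thesis
      using diag_zero[OF klr_free_closed(5)[OF s(1) r(1)] _ p, of 0 a] eq by simp
  qed
  consider "p = q" | "p = Suc q" | "q = Suc p" | "p \<noteq> q" "p \<noteq> Suc q" "q \<noteq> Suc p" by blast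
  then show ?thesis
  proof cases
    case 1
    then obtain a b where ab: "cyc_el (n - 1) r = cyc_scale a (cyc_el (n - 1) (fE (base_seq (n - 1) p))) +
      cyc_scale b (cyc_el (n - 1) (fY (n - 1)) * cyc_el (n - 1) (fE (base_seq (n - 1) p)))"
      using w unfolding M.block_def by auto
    then show ?thesis using diag_zero[OF r p(1,2) ab] by simp
  next
    case 2
    then obtain a where a: "cyc_el (n - 1) r = cyc_scale a (M.raise q)"
      using w unfolding M.block_def by auto
    have q: "0 < q" "Suc q < n - 1" using p 2 by auto
    have "M.lower q * cyc_el (n - 1) r = cyc_scale (- a) (cyc_el (n - 1) (fY (n - 1)) * cyc_el (n - 1) (fE (base_seq (n - 1) q)))"
      unfolding a using M.lower_raise[OF q] by (simp add: cyc_scale_mult_right)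
    then have "- a = 0" using offdiag[OF M_raise_lower_range(2)[OF q] p(3,4)] by blast
    then show ?thesis using a by simp
  next
    case 3
    then obtain a where a: "cyc_el (n - 1) r = cyc_scale a (M.lower p)"
      using w unfolding M.block_def by auto
    have q: "0 < p" "Suc p < n - 1" using p 3 by auto
    have "M.raise p * cyc_el (n - 1) r = cyc_scale a (cyc_el (n - 1) (fY (n - 1)) * cyc_el (n - 1) (fE (base_seq (n - 1) (Suc p))))"
      unfolding a using M.raise_lower[OF q] by (simp add: cyc_scale_mult_right)
    then have "a = 0" using offdiag[OF M_raise_lower_range(1)[OF q], of "Suc p"] q by blast
    then show ?thesis using a by simp
  next
    case 4
    then show ?thesis using w unfolding M.block_def by auto
  qed
qed

text \<open>The kernel is closed under multiplication from both sides, so every compression of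
  \<open>p\<close> lies in it and vanishes by \<open>block_kernel\<close>; the compressions
  determine \<open>p\<close>.\<close>

lemma corner_eval_inj:
  assumes p: "p \<in> F" and zero: "corner_eval p = 0"
  shows "cyc_el (n - 1) p = 0"
proof -
  let ?x = "cyc_el (n - 1) p"
  have vanish: "M.down j * ?x * M.up i = 0" if j: "adm (n - 1) P j" and i: "adm (n - 1) Q i" for i j P Q
  proof -
    obtain a where a: "a \<in> F" "M.down j = cyc_el (n - 1) a" using M_down_up_range(1)[OF j] by auto
    obtain b where b: "b \<in> F" "M.up i = cyc_el (n - 1) b" using M_down_up_range(2)[OF i] by auto
    have c: "a * p \<in> F" "a * p * b \<in> F" using a b p by (auto intro: klr_free_closed)
    have eq: "cyc_el (n - 1) (a * p * b) = M.down j * ?x * M.up i"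
      using a b p c by (simp add: cyc_el_hom[OF n_pos(2)])
    have "corner_eval (a * p * b) = corner_eval a * corner_eval p * corner_eval b"
      using a b p by (simp add: corner_eval_hom(4))
    then have z: "corner_eval (a * p * b) = 0" using zero by simp
    have "M.in_span ?x" using in_span_cyc_el[OF _ p] n by simp
    then have "M.block P Q (cyc_el (n - 1) (a * p * b))"
      unfolding eq using j i by (simp add: M.in_span_def)
    then have "cyc_el (n - 1) (a * p * b) = 0"
      using adm_bounds[OF j] adm_bounds[OF i] n by (intro block_kernel c z) auto
    then show ?thesis using eq by simp
  qed
  have "?x = (\<Sum>j\<in>{j. adm (n - 1) (j ! (n - 1 - 1)) j}. \<Sum>i\<in>{i. adm (n - 1) (i ! (n - 1 - 1)) i}.
      M.up j * (M.down j * ?x * M.up i) * M.down i)"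
    using cyc_el_unit(1,2)[OF n_pos(2) p] by (rule M.e_mult_decompose)
  also have "\<dots> = 0" by (intro sum.neutral ballI) (simp add: vanish)
  finally show ?thesis .
qed

section \<open>Surjectivity\<close>

lemma range_closed:
  defines "T \<equiv> corner_eval ` F"
  shows "0 \<in> T" "u \<in> T \<Longrightarrow> v \<in> T \<Longrightarrow> u + v \<in> T" "u \<in> T \<Longrightarrow> v \<in> T \<Longrightarrow> u * v \<in> T"
    "u \<in> T \<Longrightarrow> cyc_scale c u \<in> T" "(\<And>a. a \<in> I \<Longrightarrow> f a \<in> T) \<Longrightarrow> sum f I \<in> T"
    "i \<in> R.corner_seqs \<Longrightarrow> cyc_el n (fE i) \<in> T" "cyc_el n (fY n) * R.corner_unit \<in> T"
    "2 < k \<Longrightarrow> k < n \<Longrightarrow> cyc_el n (fPsi k) * R.corner_unit \<in> T"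
proof -
  have mem: "x \<in> T" if "p \<in> F" "x = corner_eval p" for x p using that by (simp add: T_def)
  show zero: "0 \<in> T" by (rule mem[OF klr_free_closed(1)]) (simp add: corner_eval_hom)
  show add: "u + v \<in> T" if "u \<in> T" "v \<in> T" for u v
    using that mem[OF klr_free_closed(3)] by (fastforce simp: T_def corner_eval_hom)
  show "u * v \<in> T" if "u \<in> T" "v \<in> T"
    using that mem[OF klr_free_closed(5)] by (fastforce simp: T_def corner_eval_hom)
  show "cyc_scale c u \<in> T" if "u \<in> T"
    using that mem[OF klr_free_closed(7)] by (fastforce simp: T_def corner_eval_hom)
  show "sum f I \<in> T" if "\<And>a. a \<in> I \<Longrightarrow> f a \<in> T"
    using that by (induction I rule: infinite_finite_induct) (auto intro: zero add)
  show "cyc_el n (fE i) \<in> T" if i: "i \<in> R.corner_seqs"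
  proof -
    obtain j where j: "j \<in> klr_seqs (n - 1)" "j ! 0 = 0" "i = hat j"
      using i R.hat_image[OF n] by auto
    show ?thesis by (rule mem[OF klr_free_closed(8)[OF j(1)]]) (simp add: corner_eval_e[OF j(1,2)] j(3))
  qed
  show "cyc_el n (fY n) * R.corner_unit \<in> T"
    by (rule mem[OF klr_free_closed(9)[of "n - 1"]]) (use n in \<open>simp_all add: corner_eval_gen\<close>)
  show "cyc_el n (fPsi k) * R.corner_unit \<in> T" if k: "2 < k" "k < n"
  proof (rule mem[OF klr_free_closed(10)[of "k - 1"]])
    show "k - 1 \<in> {1..n - 1 - 1}" using k by auto
    have "corner_eval (fPsi (k - 1)) = R.corner_unit * cyc_el n (fPsi k) * R.corner_unit"
      using k by (simp add: corner_eval_gen)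
    also have "\<dots> = cyc_el n (fPsi k) * R.corner_unit"
      unfolding R.psi_corner_unit[OF n k, symmetric] mult.assoc R.corner_unit_idem ..
    finally show "cyc_el n (fPsi k) * R.corner_unit = corner_eval (fPsi (k - 1))" by simp
  qed
qed

lemma psi_e_range:
  assumes i: "i \<in> R.corner_seqs" and k: "2 < k" "k < n"
  shows "cyc_el n (fPsi k) * cyc_el n (fE i) \<in> corner_eval ` F"
    "cyc_el n (fE i) * cyc_el n (fPsi k) \<in> corner_eval ` F"
proof -
  have e: "R.corner_unit * cyc_el n (fE j) = cyc_el n (fE j)" "cyc_el n (fE j) * R.corner_unit = cyc_el n (fE j)"
    if "j \<in> R.corner_seqs" for j
    using that R.corner_unit_e R.e_corner_unit R.corner_seqs_klr by auto
  have "cyc_el n (fPsi k) * R.corner_unit * cyc_el n (fE i) \<in> corner_eval ` F"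
    "cyc_el n (fE i) * (cyc_el n (fPsi k) * R.corner_unit) \<in> corner_eval ` F"
    by (intro range_closed(3,6,8) i k)+
  moreover have "cyc_el n (fE i) * (cyc_el n (fPsi k) * R.corner_unit) = cyc_el n (fE i) * cyc_el n (fPsi k)"
    unfolding R.psi_corner_unit[OF n k] using e(2)[OF i] by (simp add: mult.assoc[symmetric])
  ultimately show "cyc_el n (fPsi k) * cyc_el n (fE i) \<in> corner_eval ` F"
    "cyc_el n (fE i) * cyc_el n (fPsi k) \<in> corner_eval ` F"
    using e(1)[OF i] by (simp_all add: mult.assoc)
qed

text \<open>Sorting a sequence with second entry 1 never leaves the corner, so each factor of the
  path is in the image.\<close>

lemma R_path_range:
  assumes "R.path p i x x'" "1 < p" "p < n" "i ! 1 = 1"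
  shows "x \<in> corner_eval ` F \<and> x' \<in> corner_eval ` F"
  using assms
proof (induction rule: R.path.induct)
  case base
  then have "base_seq n p \<in> R.corner_seqs"
    using admD(1,2)[OF adm_base_seq[of p n]] by (auto simp: R.corner_seqs_def)
  then show ?case using range_closed(6) by auto
next
  case (step i k x x')
  note len = adm_length[OF step.hyps(1)]
  have i: "i \<in> R.corner_seqs" using admD(1,2)[OF step.hyps(1)] step.prems by (auto simp: R.corner_seqs_def)
  \<comment> \<open>A descent at 2 would mean \<open>p < i ! 1 = 1\<close>.\<close>
  have "k \<noteq> 2" using step.hyps(2) step.prems by (auto simp: desc_def One_nat_def)
  then have k: "2 < k" "k < n" using adm_desc(3)[OF step.hyps(1,2)] step.hyps(2) by (auto simp: desc_def)
  have "swap_at k i ! 1 = 1" using k len step.prems by (subst nth_swap_at) auto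
  then have IH: "x \<in> corner_eval ` F" "x' \<in> corner_eval ` F" using step.IH step.prems by auto
  show ?case
    using range_closed(3)[OF IH(1) psi_e_range(1)[OF i k]] range_closed(3)[OF psi_e_range(2)[OF i k] IH(2)]
    by (simp add: mult.assoc)
qed

lemma R_down_up_range:
  assumes "adm n p i" "i ! 1 = 1"
  shows "R.down i \<in> corner_eval ` F" "R.up i \<in> corner_eval ` F" "1 < p" "p < n"
proof -
  have "p \<noteq> 1" using klr_seqs_nth(3)[OF admD(1)[OF assms(1)], of 1 "n - 1"] admD(3)[OF assms(1)] assms(2) n by auto
  then show p: "1 < p" "p < n" using adm_bounds[OF assms(1)] n by auto
  show "R.down i \<in> corner_eval ` F" "R.up i \<in> corner_eval ` F"
    using R_path_range[OF R.path_down_up[OF assms(1)] p assms(2)] by auto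
qed

lemma R_raise_lower_range:
  assumes p: "1 < p" "Suc p < n"
  shows "R.raise p \<in> corner_eval ` F" "R.lower p \<in> corner_eval ` F"
proof -
  have p0: "0 < p" "p < n" using p by auto
  have a: "adm n (Suc p) (swap_at (n - 1) (base_seq n p))" using p by (intro R.adm_swap_base) auto
  have c: "base_seq n p \<in> R.corner_seqs"
    using admD(1,2)[OF adm_base_seq[of p n]] p by (auto simp: R.corner_seqs_def nth_base_seq)
  \<comment> \<open>\<open>1 < p\<close> and \<open>Suc p < n\<close> give \<open>n >= 4\<close>, so
    the last crossing does not touch the first two places.\<close>
  have n3: "2 < n - 1" "n - 1 < n" using p by auto
  have "swap_at (n - 1) (base_seq n p) ! 1 = base_seq n p ! 1"
    using n3 length_base_seq[OF p0(2)] by (subst nth_swap_at) auto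
  then have s1: "swap_at (n - 1) (base_seq n p) ! 1 = 1" using p n by (simp add: nth_base_seq)
  show "R.raise p \<in> corner_eval ` F"
    unfolding R.raise_def mult.assoc
    by (rule range_closed(3)[OF R_down_up_range(1)[OF a s1] psi_e_range(1)[OF c n3]])
  show "R.lower p \<in> corner_eval ` F"
    unfolding R.lower_def
    by (rule range_closed(3)[OF psi_e_range(2)[OF c n3] R_down_up_range(2)[OF a s1]])
qed

lemma block_range:
  assumes w: "R.block p q w" and p: "1 < p" "p < n" "1 < q" "q < n"
  shows "w \<in> corner_eval ` F"
proof -
  have c: "base_seq n p \<in> R.corner_seqs"
    using admD(1,2)[OF adm_base_seq[of p n]] p by (auto simp: R.corner_seqs_def nth_base_seq)
  have "cyc_el n (fY n) * R.corner_unit * cyc_el n (fE (base_seq n p)) \<in> corner_eval ` F"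
    by (intro range_closed(3,6,7) c)
  then have yc: "cyc_el n (fY n) * cyc_el n (fE (base_seq n p)) \<in> corner_eval ` F"
    using R.corner_unit_e[OF R.corner_seqs_klr[OF c]] c by (simp add: mult.assoc)
  consider "p = q" | "p = Suc q" | "q = Suc p" | "p \<noteq> q" "p \<noteq> Suc q" "q \<noteq> Suc p" by blast
  then show ?thesis
  proof cases
    case 1
    then obtain a b where "w = cyc_scale a (cyc_el n (fE (base_seq n p))) +
        cyc_scale b (cyc_el n (fY n) * cyc_el n (fE (base_seq n p)))"
      using w unfolding R.block_def by auto
    then show ?thesis using c yc by (simp add: range_closed)
  next
    case 2
    then obtain a where "w = cyc_scale a (R.raise q)" using w unfolding R.block_def by auto
    then show ?thesis using R_raise_lower_range(1)[of q] 2 p by (simp add: range_closed)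
  next
    case 3
    then obtain a where "w = cyc_scale a (R.lower p)" using w unfolding R.block_def by auto
    then show ?thesis using R_raise_lower_range(2)[of p] 3 p by (simp add: range_closed)
  next
    case 4
    then show ?thesis using w unfolding R.block_def by (auto simp: range_closed)
  qed
qed

text \<open>Compressing the decomposition by the corner unit keeps the summands whose two sequences
  both lie in the corner. In these, \<open>up\<close>, \<open>down\<close> and the block in between
  are all in the image.\<close>

lemma corner_eval_surj:
  assumes "p \<in> carrier (klr_free_algebra n :: ('k, 'k klr_free) module)"
  shows "R.corner_unit * cyc_el n p * R.corner_unit \<in> corner_eval ` F"
proof -
  let ?A = "{j. adm n (j ! (n - 1)) j}"
  let ?x = "cyc_el n p"
  have "R.corner_unit * ?x * R.corner_unit =
     (\<Sum>j\<in>?A. \<Sum>i\<in>?A. R.corner_unit * (R.up j * (R.down j * ?x * R.up i) * R.down i) * R.corner_unit)"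
    by (subst R.e_mult_decompose[OF cyc_el_unit(1,2)[OF n_pos(1) assms]])
      (simp add: sum_distrib_left sum_distrib_right)
  also have "\<dots> \<in> corner_eval ` F"
  proof (intro range_closed(5))
    fix i j assume "i \<in> ?A" "j \<in> ?A"
    then have a: "adm n (i ! (n - 1)) i" "adm n (j ! (n - 1)) j" by auto
    have e: "R.corner_unit * R.up j = (if j \<in> R.corner_seqs then R.up j else 0)"
    proof -
      have "R.corner_unit * R.up j = R.corner_unit * cyc_el n (fE j) * R.up j"
        using R.down_up(3)[OF a(2)] by (simp add: mult.assoc)
      then show ?thesis using R.corner_unit_e[OF admD(1)[OF a(2)]] R.down_up(3)[OF a(2)] by auto
    qed
    have d: "R.down i * R.corner_unit = (if i \<in> R.corner_seqs then R.down i else 0)"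
    proof -
      have "R.down i * R.corner_unit = R.down i * (cyc_el n (fE i) * R.corner_unit)"
        using R.down_up(1)[OF a(1)] by (simp add: mult.assoc[symmetric])
      then show ?thesis using R.e_corner_unit[OF admD(1)[OF a(1)]] R.down_up(1)[OF a(1)] by auto
    qed
    have eq: "R.corner_unit * (R.up j * (R.down j * ?x * R.up i) * R.down i) * R.corner_unit =
      (R.corner_unit * R.up j) * (R.down j * ?x * R.up i) * (R.down i * R.corner_unit)"
      by (simp only: mult.assoc)
    show "R.corner_unit * (R.up j * (R.down j * ?x * R.up i) * R.down i) * R.corner_unit \<in> corner_eval ` F"
    proof (cases "i \<in> R.corner_seqs \<and> j \<in> R.corner_seqs")
      case False
      then show ?thesis unfolding eq e d by (auto simp: range_closed)
    next
      case True
      then have i1: "i ! 1 = 1" "j ! 1 = 1" by (auto simp: R.corner_seqs_def)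
      note I = R_down_up_range[OF a(1) i1(1)] and J = R_down_up_range[OF a(2) i1(2)]
      have "R.in_span ?x" using in_span_cyc_el[OF _ assms] n by simp
      then have "R.block (j ! (n - 1)) (i ! (n - 1)) (R.down j * ?x * R.up i)"
        using a by (simp add: R.in_span_def)
      then have "R.down j * ?x * R.up i \<in> corner_eval ` F" using I J by (intro block_range)
      then show ?thesis unfolding eq e d using True I J by (simp add: range_closed)
    qed
  qed
  finally show ?thesis .
qed

section \<open>Return from the product to the component \<open>n\<close>\<close>

lemma component_corner_unit: "component n R.corner_unit = cyc_idem n"
proof -
  interpret cyc: ring "cyc_algebra n :: ('k, 'k cyc) module" by (rule ring_cyc_algebra[OF n_pos(1)])
  have cE: "component n (cyc_el n (fE i)) = (cyc_e n i :: 'k cyc)" if "i \<in> klr_seqs n" for i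
    unfolding cyc_el_def using that n_pos(1)
    by (simp add: component_cyc_in cyc_proj_closed klr_free_closed cyc_gen_eq)
  let ?N = "nz_seqs1 TYPE('k) n"
  have "i ! 0 = 0" if "i \<in> nz_seqs TYPE('k) n" for i
    using that cyc_proj_cyc_rel(2)[OF n_pos(1), of i, where ?'k = 'k] n_pos(1)
    by (auto simp: nz_seqs_def cyc_gen_eq)
  then have sub: "?N \<subseteq> R.corner_seqs" and fin: "finite ?N"
    by (auto simp: nz_seqs1_def R.corner_seqs_def nz_seqs_def One_nat_def intro!: finite_subset[OF _ finite_klr_seqs[of n]])
  have "cyc_el n (fE i) = (0 :: 'k cyc_prod)" if "i \<in> R.corner_seqs - ?N" for i
  proof -
    have "cyc_e n i = \<zero>\<^bsub>cyc_algebra n :: ('k, 'k cyc) module\<^esub>"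
      using that by (auto simp: nz_seqs1_def R.corner_seqs_def nz_seqs_def One_nat_def)
    then show ?thesis
      using cyc_in_hom(4)[OF n_pos(1) cyc.zero_closed cyc.zero_closed] n_pos(1)
      by (simp add: cyc_el_def cyc_gen_eq)
  qed
  then have "R.corner_unit = (\<Sum>i\<in>?N. cyc_el n (fE i))"
    unfolding R.corner_unit_def using sub by (intro sum.mono_neutral_right) auto
  then have "component n R.corner_unit = (\<Oplus>\<^bsub>cyc_algebra n\<^esub> i\<in>?N. component n (cyc_el n (fE i)))"
    using component_sum[OF n_pos(1) fin] by simp
  also have "\<dots> = cyc_idem n"
    unfolding cyc_idem_def using sub R.corner_seqs_klr cE
    by (intro cyc.finsum_cong') (auto simp: cyc_gen_eq n_pos intro!: cyc_proj_closed klr_free_closed)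
  finally show ?thesis .
qed

text \<open>Values of \<open>corner_eval\<close> absorb \<open>corner_unit\<close>, whose components
  other than the one at \<open>n\<close> are zero.\<close>

lemma corner_eval_component:
  assumes "p \<in> F" "component n (corner_eval p) = \<zero>\<^bsub>cyc_algebra n\<^esub>"
  shows "corner_eval p = 0"
proof (rule cyc_prod_eqI)
  fix m :: nat assume m: "0 < m"
  show "component m (corner_eval p) = component m 0"
  proof (cases "m = n")
    case True
    then show ?thesis using assms(2) m by (simp add: component_simps)
  next
    case False
    interpret ring "cyc_algebra m :: ('k, 'k cyc) module" by (rule ring_cyc_algebra[OF m])
    have "component m (cyc_el n (fE i) :: 'k cyc_prod) = \<zero>\<^bsub>cyc_algebra m\<^esub>" if "i \<in> R.corner_seqs" for i
      unfolding cyc_el_def using False m n_pos(1) R.corner_seqs_klr[OF that]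
      by (simp add: component_cyc_in cyc_proj_closed klr_free_closed)
    then have "component m R.corner_unit = \<zero>\<^bsub>cyc_algebra m\<^esub>"
      unfolding R.corner_unit_def component_sum[OF m R.finite_corner_seqs] by (rule add.finprod_one_eqI)
    then have "component m (R.corner_unit * corner_eval p) = \<zero>\<^bsub>cyc_algebra m\<^esub>"
      using m by (simp add: component_simps component_closed)
    then show ?thesis unfolding corner_eval_unit(1)[OF assms(1)] using m by (simp add: component_simps)
  qed
qed

theorem corner_isomorphism:
  "\<exists>\<Phi> \<in> algebra_iso (cyc_algebra (n - 1) :: ('k, 'k cyc) module)
                      (corner_algebra (cyc_algebra n) (cyc_idem n)).
     (\<forall>i \<in> nz_seqs TYPE('k) (n - 1). \<Phi> (cyc_e (n - 1) i) = cyc_e n (hat i)) \<and>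
     \<Phi> (cyc_y (n - 1) (n - 1)) =
       cyc_idem n \<otimes>\<^bsub>cyc_algebra n\<^esub> cyc_y n n \<otimes>\<^bsub>cyc_algebra n\<^esub> cyc_idem n \<and>
     (\<forall>k \<in> {1..n - 2}. \<Phi> (cyc_psi (n - 1) k) =
       cyc_idem n \<otimes>\<^bsub>cyc_algebra n\<^esub> cyc_psi n (k + 1) \<otimes>\<^bsub>cyc_algebra n\<^esub> cyc_idem n)"
proof -
  let ?R = "cyc_algebra (n - 1) :: ('k, 'k cyc) module"
  let ?S = "cyc_algebra n :: ('k, 'k cyc) module"
  let ?C = "corner_algebra ?S (cyc_idem n)"
  \<comment> \<open>The value is computed on a chosen representative;
    \<open>corner_eval_cong\<close> makes the choice irrelevant.\<close>
  define phi where "phi X = component n (corner_eval (SOME p. p \<in> F \<and> cyc_proj (n - 1) p = X))" for X :: "'k cyc"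
  have phi: "phi (cyc_proj (n - 1) p) = component n (corner_eval p)" if p: "p \<in> F" for p
  proof -
    let ?q = "SOME q. q \<in> F \<and> cyc_proj (n - 1) q = cyc_proj (n - 1) p"
    have "?q \<in> F \<and> cyc_proj (n - 1) ?q = cyc_proj (n - 1) p"
      by (rule someI[of _ p]) (simp add: p)
    then have "corner_eval ?q = corner_eval p" using p by (intro corner_eval_cong) (auto simp: cyc_el_def)
    then show ?thesis by (simp add: phi_def)
  qed
  note carR = cyc_carrier[OF n_pos(2), where ?'k = 'k]
  have comp_el: "component n (cyc_el n p) = cyc_proj n p" if "p \<in> carrier (klr_free_algebra n)" for p :: "'k klr_free"
    unfolding cyc_el_def using that n_pos(1) by (simp add: component_cyc_in cyc_proj_closed)
  have comp_mult: "component n (u * v) = component n u \<otimes>\<^bsub>?S\<^esub> component n v"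
    and comp_add: "component n (u + v) = component n u \<oplus>\<^bsub>?S\<^esub> component n v" for u v :: "'k cyc_prod"
    using n_pos(1) by (simp_all add: component_simps)
  have corner: "carrier ?C = {component n (R.corner_unit * cyc_el n p * R.corner_unit) | p. p \<in> carrier (klr_free_algebra n)}"
    unfolding corner_algebra_def cyc_carrier[OF n_pos(1)]
    by (auto simp: comp_mult comp_el component_corner_unit) (metis comp_el imageI)
  have ev_corner: "component n (corner_eval p) \<in> carrier ?C" if p: "p \<in> F" for p
  proof -
    obtain q where q: "q \<in> carrier (klr_free_algebra n)" "cyc_proj n q = component n (corner_eval p)"
      using component_closed[OF n_pos(1), of "corner_eval p"] cyc_carrier[OF n_pos(1), where ?'k = 'k] by auto
    have "component n (R.corner_unit * cyc_el n q * R.corner_unit) = component n (R.corner_unit * corner_eval p * R.corner_unit)"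
      by (simp add: comp_mult comp_el q)
    also have "\<dots> = component n (corner_eval p)" by (simp add: corner_eval_unit[OF p])
    finally show ?thesis unfolding corner using q(1) by force
  qed
  have "phi \<in> ring_hom ?R ?C"
  proof (rule ring_hom_memI)
    fix X assume "X \<in> carrier ?R"
    then obtain p where p: "p \<in> F" "X = cyc_proj (n - 1) p" using carR by auto
    then show "phi X \<in> carrier ?C" using phi ev_corner by simp
    fix Y assume "Y \<in> carrier ?R"
    then obtain q where q: "q \<in> F" "Y = cyc_proj (n - 1) q" using carR by auto
    have "X \<otimes>\<^bsub>?R\<^esub> Y = cyc_proj (n - 1) (p * q)" "X \<oplus>\<^bsub>?R\<^esub> Y = cyc_proj (n - 1) (p + q)"
      using p q by (simp_all add: cyc_proj_hom[OF n_pos(2)])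
    moreover have "p * q \<in> F" "p + q \<in> F" using p q by (auto intro: klr_free_closed)
    ultimately show "phi (X \<otimes>\<^bsub>?R\<^esub> Y) = phi X \<otimes>\<^bsub>?C\<^esub> phi Y" "phi (X \<oplus>\<^bsub>?R\<^esub> Y) = phi X \<oplus>\<^bsub>?C\<^esub> phi Y"
      using p q by (simp_all add: phi corner_eval_hom comp_mult comp_add corner_algebra_def)
  next
    show "phi \<one>\<^bsub>?R\<^esub> = \<one>\<^bsub>?C\<^esub>"
      using phi[OF klr_free_closed(2)] cyc_proj_one[OF n_pos(2), where ?'k = 'k]
      by (simp add: corner_eval_hom component_corner_unit corner_algebra_def)
  qed
  moreover have "bij_betw phi (carrier ?R) (carrier ?C)"
  proof (rule bij_betw_imageI)
    show "inj_on phi (carrier ?R)"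
    proof (rule inj_onI)
      fix X Y assume "X \<in> carrier ?R" "Y \<in> carrier ?R" and eq: "phi X = phi Y"
      then obtain p q where p: "p \<in> F" "X = cyc_proj (n - 1) p" and q: "q \<in> F" "Y = cyc_proj (n - 1) q"
        using carR by auto
      have d: "p - q \<in> F" using p q by (auto intro: klr_free_closed)
      have "component n (corner_eval p) = component n (corner_eval q)" using eq p q phi by simp
      \<comment> \<open>Equality is known only in the component \<open>n\<close>; the difference is
        taken there and then lifted with \<open>corner_eval_component\<close>.\<close>
      then have "component n (corner_eval (p - q)) = component n (corner_eval q - corner_eval q)"
        using n_pos(1) by (simp only: corner_eval_hom component_simps)
      then have "corner_eval (p - q) = 0"
        using n_pos(1) by (intro corner_eval_component[OF d]) (simp add: component_simps)
      then have "cyc_el (n - 1) (p - q) = 0" by (rule corner_eval_inj[OF d])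
      then have "cyc_el (n - 1) p = cyc_el (n - 1) q" using p q by (simp add: cyc_el_hom[OF n_pos(2)])
      then have "component (n - 1) (cyc_el (n - 1) p) = component (n - 1) (cyc_el (n - 1) q)" by simp
      then show "X = Y"
        unfolding cyc_el_def using p q n_pos(2) by (simp add: component_cyc_in cyc_proj_closed)
    qed
    show "phi ` carrier ?R = carrier ?C"
    proof
      show "phi ` carrier ?R \<subseteq> carrier ?C" using carR phi ev_corner by auto
      show "carrier ?C \<subseteq> phi ` carrier ?R"
      proof
        fix Z assume "Z \<in> carrier ?C"
        then obtain p where p: "p \<in> carrier (klr_free_algebra n)"
          "Z = component n (R.corner_unit * cyc_el n p * R.corner_unit)"
          unfolding corner by auto
        then obtain q where "q \<in> F" "R.corner_unit * cyc_el n p * R.corner_unit = corner_eval q"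
          using corner_eval_surj[OF p(1)] by auto
        then show "Z \<in> phi ` carrier ?R" using p phi carR by (metis imageI)
      qed
    qed
  qed
  moreover have "phi (c \<odot>\<^bsub>?R\<^esub> X) = c \<odot>\<^bsub>?C\<^esub> phi X" if "X \<in> carrier ?R" for c X
  proof -
    from that obtain p where p: "p \<in> F" "X = cyc_proj (n - 1) p" using carR by auto
    have "c \<odot>\<^bsub>?R\<^esub> X = cyc_proj (n - 1) (Poly_Mapping.single 0 c * p)"
      using p by (simp add: cyc_proj_hom(3)[OF n_pos(2) p(1) p(1)])
    then show ?thesis
      using p phi[OF klr_free_closed(7)[OF p(1)]] phi[OF p(1)] n_pos(1)
      by (simp add: corner_eval_hom(3) component_cyc_scale corner_algebra_def)
  qed
  ultimately have iso: "phi \<in> algebra_iso ?R ?C" by (simp add: algebra_iso_def ring_iso_def)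
  have vE: "phi (cyc_e (n - 1) i) = cyc_e n (hat i)" if i: "i \<in> nz_seqs TYPE('k) (n - 1)" for i
  proof -
    have i': "i \<in> klr_seqs (n - 1)" "i ! 0 = 0"
      using i cyc_proj_cyc_rel(2)[OF n_pos(2), of i, where ?'k = 'k] n_pos(2)
      by (auto simp: nz_seqs_def cyc_gen_eq)
    then show ?thesis
      using phi[OF klr_free_closed(8)[OF i'(1)]] n_pos comp_el[OF klr_free_closed(8)[OF hat_klr_seqs[OF n i']]]
      by (simp add: cyc_gen_eq corner_eval_e)
  qed
  have vY: "phi (cyc_y (n - 1) (n - 1)) = cyc_idem n \<otimes>\<^bsub>?S\<^esub> cyc_y n n \<otimes>\<^bsub>?S\<^esub> cyc_idem n"
  proof -
    have c: "fY (n - 1) \<in> F" "fY n \<in> carrier (klr_free_algebra n :: ('k, 'k klr_free) module)"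
      using n by (auto intro!: klr_free_closed)
    have "n \<in> {1..n}" using n by simp
    note yc = R.y_corner_unit[OF this]
    have "corner_eval (fY (n - 1)) = R.corner_unit * cyc_el n (fY n) * R.corner_unit"
      unfolding yc[symmetric] using n by (simp add: corner_eval_gen mult.assoc)
    then show ?thesis
      using phi[OF c(1)] n_pos by (simp add: cyc_gen_eq comp_mult comp_el[OF c(2)] component_corner_unit)
  qed
  have vP: "phi (cyc_psi (n - 1) k) = cyc_idem n \<otimes>\<^bsub>?S\<^esub> cyc_psi n (k + 1) \<otimes>\<^bsub>?S\<^esub> cyc_idem n"
    if "k \<in> {1..n - 2}" for k
  proof -
    have c: "fPsi k \<in> F" "fPsi (k + 1) \<in> carrier (klr_free_algebra n :: ('k, 'k klr_free) module)"
      using n that by (auto intro!: klr_free_closed)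
    then show ?thesis
      using phi[OF c(1)] n_pos comp_el[OF c(2)]
      by (simp add: cyc_gen_eq comp_mult component_corner_unit corner_eval_gen Suc_eq_plus1)
  qed
  show ?thesis using iso vE vY vP by blast
qed

end

theorem proposition5:
  fixes n :: nat
  assumes "n > 2"
  shows "\<exists>\<Phi> \<in> algebra_iso (cyc_algebra (n - 1) :: ('k::field, 'k cyc) module)
                          (corner_algebra (cyc_algebra n) (cyc_idem n)).
           (\<forall>i \<in> nz_seqs TYPE('k) (n - 1). \<Phi> (cyc_e (n - 1) i) = cyc_e n (hat i)) \<and>
           \<Phi> (cyc_y (n - 1) (n - 1)) =
             cyc_idem n \<otimes>\<^bsub>cyc_algebra n\<^esub> cyc_y n n \<otimes>\<^bsub>cyc_algebra n\<^esub> cyc_idem n \<and>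
           (\<forall>k \<in> {1..n - 2}. \<Phi> (cyc_psi (n - 1) k) =
             cyc_idem n \<otimes>\<^bsub>cyc_algebra n\<^esub> cyc_psi n (k + 1) \<otimes>\<^bsub>cyc_algebra n\<^esub> cyc_idem n)"
  using assms by (rule corner_isomorphism)

end
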